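(* Let $\big(\widetilde{\omega^{(n)}}\big)_{n\ge0}$ be the state sequence of the $d$-dimensional open QBN walk, where $\omega^{(n)}$ is the nucleus of $\widetilde{\omega^{(n)}}$. Let $(W_n)_{n\ge0}$ be the state sequence of the $d$-dimensional QBN walk. Suppose that $$\omega^{(0)}(\mathrm{x})=|W_0(\mathrm{x})\rangle\langle W_0(\mathrm{x})|,\qquad \mathrm{x}\in\mathbb{Z}^d.$$ Then, for all $n\ge0$, $$\mathrm{Tr}\big[\omega^{(n)}(\mathrm{x})\big]=\|W_n(\mathrm{x})\|^2,\qquad \mathrm{x}\in\mathbb{Z}^d.$$
   Context: Let $d\ge 2$ be a fixed integer, $\mathbb{N}=\{0,1,2,\dots\}$, $\Lambda=\{-1,+1\}$, and $\Gamma$ the set of finite subsets of $\mathbb{N}$. Bernoulli functionals. Let $\Omega$ be the set of all functions $f\colon\mathbb{N}\to\{-1,1\}$, $\zeta_n(f)=f(n)$, $\mathscr{F}$ the $\sigma$-field generated by $(\zeta_n)_{n\ge0}$, $(p_n)_{n\ge0}$ a given sequence with $0<p_n<1$, $q_n=1-p_n$, and $\mathbb{P}$ the unique probability measure on $\mathscr{F}$ with $\mathbb{P}(\zeta_{n_1}=\epsilon_1,\dots,\zeta_{n_k}=\epsilon_k)=\prod_{j=1}^k p_{n_j}^{(1+\epsilon_j)/2}(1-p_{n_j})^{(1-\epsilon_j)/2}$ for all $k\ge 1$, distinct $n_1,\dots,n_k\in\mathbb{N}$ and $\epsilon_j\in\{-1,1\}$. Put $Z_n=(\zeta_n+q_n-p_n)/(2\sqrt{p_nq_n})$,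 $\mathcal{H}=L^2(\Omega,\mathscr{F},\mathbb{P})$ (complex-valued, norm $\|\cdot\|$), $Z_\emptyset=1$ and $Z_\sigma=\prod_{j\in\sigma}Z_j$ for nonempty $\sigma\in\Gamma$; $\{Z_\sigma\mid\sigma\in\Gamma\}$ is an orthonormal basis of $\mathcal{H}$. For $k\ge0$, $\partial_k$ is the bounded operator on $\mathcal{H}$ with $\partial_kZ_\sigma=\mathbf{1}_\sigma(k)Z_{\sigma\setminus\{k\}}$; its adjoint satisfies $\partial_k^*Z_\sigma=[1-\mathbf{1}_\sigma(k)]Z_{\sigma\cup\{k\}}$. Put $L_n=\frac12(\partial_n^*+\partial_n-I)$ and $R_n=\frac12(\partial_n^*+\partial_n+I)$, $I$ being the identity on $\mathcal{H}$. Operators $C_n^{(\varepsilon)}$. Fix a unitary isomorphism $\mathsf{K}\colon\mathcal{H}^{\otimes d}\to\mathcal{H}$ ($\mathcal{H}^{\otimes d}$ is the $d$-fold Hilbert space tensor product). For $n\ge0$ and $\varepsilon=(\varepsilon_1,\dots,\varepsilon_d)\in\Lambda^d$ set $C_n^{(\varepsilon)}=\mathsf{K}\big(\bigotimes_{j=1}^dB_n^{(\varepsilon_j)}\big)\mathsf{K}^{-1}$, where $B_n^{(-1)}=L_n$ and $B_n^{(+1)}=R_n$. Open QBN walk. $\mathfrak{S}_+(\mathcal{H})$ is the cone of positive trace class operators on $\mathcal{H}$. A $d$-dimensional nucleus on $\mathcal{H}$ is a mapping $\omega\colon\mathbb{Z}^d\to\mathfrak{S}_+(\mathcal{H})$ with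 $\sum_{\mathrm{x}\in\mathbb{Z}^d}\mathrm{Tr}[\omega(\mathrm{x})]=1$; the set of all of them is $\mathscr{T}^{(d)}(\mathcal{H})$. Define $\mathfrak{J}_n^{(d)}\colon\mathscr{T}^{(d)}(\mathcal{H})\to\mathscr{T}^{(d)}(\mathcal{H})$ by $[\mathfrak{J}_n^{(d)}\omega](\mathrm{x})=\sum_{\varepsilon\in\Lambda^d}C_n^{(\varepsilon)}\omega(\mathrm{x}-\varepsilon)C_n^{(\varepsilon)}$. The state of the $d$-dimensional open QBN walk at time $n\ge0$ is the density operator $\widetilde{\omega^{(n)}}=\sum_{\mathrm{x}\in\mathbb{Z}^d}|\delta_{\mathrm{x}}\rangle\langle\delta_{\mathrm{x}}|\otimes\omega^{(n)}(\mathrm{x})$ on $l^2(\mathbb{Z}^d)\otimes\mathcal{H}$, where $\{\delta_{\mathrm{x}}\}$ is the canonical orthonormal basis of $l^2(\mathbb{Z}^d)$ and $\omega^{(n)}\in\mathscr{T}^{(d)}(\mathcal{H})$ is called its nucleus; the evolution is $\omega^{(n+1)}=\mathfrak{J}_n^{(d)}\omega^{(n)}$, $n\ge0$. For $u\in\mathcal{H}$, $|u\rangle\langle u|$ is the operator $w\mapsto\langle u,w\rangle u$ (inner product linear in the second argument). QBN walk. $l^2(\mathbb{Z}^d,\mathcal{H})$ is the Hilbert space of functions $W\colon\mathbb{Z}^d\to\mathcal{H}$ with $\sum_{\mathrm{x}}\|W(\mathrm{x})\|^2<\infty$. The $d$-dimensional QBN walk has as states unit vectors $W_n\in l^2(\mathbb{Z}^d,\mathcal{H})$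 and evolution $W_{n+1}=\mathcal{U}_n^{(d)}W_n$, $n\ge0$, where $\mathcal{U}_n^{(d)}$ is the unitary operator on $l^2(\mathbb{Z}^d,\mathcal{H})$ given by $(\mathcal{U}_n^{(d)}W)(\mathrm{x})=\sum_{\varepsilon\in\Lambda^d}C_n^{(\varepsilon)}W(\mathrm{x}-\varepsilon)$. *)

theory Defs
  imports "HOL-Probability.Probability" "HOL-Algebra.Module"
begin

section \<open>Complex Hilbert spaces\<close>

text \<open>
  Spaces such as \<open>L\<^sup>2(\<Omega>, \<F>, P)\<close> depend on parameters of the statement, so they are not types.
  A Hilbert space is a module in the sense of HOL-Algebra over the field of complex numbers,
  together with an inner product that is linear in its second argument. The record fields
  \<open>mult\<close> and \<open>one\<close> that a module inherits from rings are not used.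
\<close>

record 'a hspace = "(complex, 'a) module" +
  cinner :: "'a \<Rightarrow> 'a \<Rightarrow> complex"

definition complex_field :: "complex ring" where
  "complex_field = \<lparr>carrier = UNIV, mult = (*), one = 1, zero = 0, add = (+)\<rparr>"

definition hnorm :: "('a, 'm) hspace_scheme \<Rightarrow> 'a \<Rightarrow> real" where
  "hnorm H u = sqrt (Re (cinner H u u))"

locale hilbert_space = module complex_field H for H :: "'a hspace" (structure) +
  assumes cinner_add: "\<And>u v w. \<lbrakk>u \<in> carrier H; v \<in> carrier H; w \<in> carrier H\<rbrakk>
      \<Longrightarrow> cinner H u (v \<oplus> w) = cinner H u v + cinner H u w"
    and cinner_smult: "\<And>a u v. \<lbrakk>u \<in> carrier H; v \<in> carrier H\<rbrakk>
      \<Longrightarrow> cinner H u (a \<odot> v) = a * cinner H u v"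
    and cinner_commute: "\<And>u v. \<lbrakk>u \<in> carrier H; v \<in> carrier H\<rbrakk>
      \<Longrightarrow> cinner H v u = cnj (cinner H u v)"
    and cinner_nonneg: "\<And>u. u \<in> carrier H \<Longrightarrow> 0 \<le> Re (cinner H u u)"
    and cinner_definite: "\<And>u. \<lbrakk>u \<in> carrier H; cinner H u u = 0\<rbrakk> \<Longrightarrow> u = \<zero>"
    and complete: "\<And>X :: nat \<Rightarrow> 'a. \<lbrakk>range X \<subseteq> carrier H;
        \<forall>e>0. \<exists>N. \<forall>m\<ge>N. \<forall>n\<ge>N. hnorm H (X m \<ominus> X n) < e\<rbrakk>
      \<Longrightarrow> \<exists>u\<in>carrier H. (\<lambda>n. hnorm H (X n \<ominus> u)) \<longlonglongrightarrow> 0"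

definition hspan :: "'a hspace \<Rightarrow> 'a set \<Rightarrow> 'a set" where
  "hspan H E = {\<Oplus>\<^bsub>H\<^esub>e\<in>F. c e \<odot>\<^bsub>H\<^esub> e | F c. finite F \<and> F \<subseteq> E}"

definition total_in :: "'a hspace \<Rightarrow> 'a set \<Rightarrow> bool" where
  "total_in H E \<longleftrightarrow> E \<subseteq> carrier H \<and>
    (\<forall>u\<in>carrier H. \<forall>e>0. \<exists>v\<in>hspan H E. hnorm H (u \<ominus>\<^bsub>H\<^esub> v) < e)"

definition orthonormal_basis :: "'a hspace \<Rightarrow> 'a set \<Rightarrow> bool" where
  "orthonormal_basis H E \<longleftrightarrow> total_in H E \<and>
    (\<forall>e\<in>E. \<forall>f\<in>E. cinner H e f = (if e = f then 1 else 0))"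


section \<open>Bounded operators\<close>

text \<open>
  Operators are extensional functions (undefined outside the carrier), so that they are equal
  as soon as they agree on the carrier.
\<close>

definition bounded_maps :: "'a hspace \<Rightarrow> 'b hspace \<Rightarrow> ('a \<Rightarrow> 'b) set" where
  "bounded_maps H H' = {A \<in> carrier H \<rightarrow>\<^sub>E carrier H'.
     (\<forall>u\<in>carrier H. \<forall>v\<in>carrier H. A (u \<oplus>\<^bsub>H\<^esub> v) = A u \<oplus>\<^bsub>H'\<^esub> A v) \<and>
     (\<forall>a. \<forall>u\<in>carrier H. A (a \<odot>\<^bsub>H\<^esub> u) = a \<odot>\<^bsub>H'\<^esub> A u) \<and>
     (\<exists>c. \<forall>u\<in>carrier H. hnorm H' (A u) \<le> c * hnorm H u)}"

abbreviation bounded_ops :: "'a hspace \<Rightarrow> ('a \<Rightarrow> 'a) set" where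
  "bounded_ops H \<equiv> bounded_maps H H"

definition unitary_isomorphism :: "'a hspace \<Rightarrow> 'b hspace \<Rightarrow> ('a \<Rightarrow> 'b) \<Rightarrow> bool" where
  "unitary_isomorphism H H' K \<longleftrightarrow> K \<in> bounded_maps H H' \<and> bij_betw K (carrier H) (carrier H') \<and>
     (\<forall>u\<in>carrier H. \<forall>v\<in>carrier H. cinner H' (K u) (K v) = cinner H u v)"

definition adjoint_op :: "'a hspace \<Rightarrow> ('a \<Rightarrow> 'a) \<Rightarrow> 'a \<Rightarrow> 'a" where
  "adjoint_op H A = (THE B. B \<in> bounded_ops H \<and>
     (\<forall>u\<in>carrier H. \<forall>v\<in>carrier H. cinner H (B u) v = cinner H u (A v)))"

definition rank_one :: "'a hspace \<Rightarrow> 'a \<Rightarrow> 'a \<Rightarrow> 'a" where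
  "rank_one H u = (\<lambda>w\<in>carrier H. cinner H u w \<odot>\<^bsub>H\<^esub> u)"

definition positive_op :: "'a hspace \<Rightarrow> ('a \<Rightarrow> 'a) \<Rightarrow> bool" where
  "positive_op H A \<longleftrightarrow> A \<in> bounded_ops H \<and> (\<forall>u\<in>carrier H. cinner H u (A u) \<in> \<real>\<^sub>\<ge>\<^sub>0)"

text \<open>The positive square root of \<open>A\<^sup>* A\<close>.\<close>

definition abs_op :: "'a hspace \<Rightarrow> ('a \<Rightarrow> 'a) \<Rightarrow> 'a \<Rightarrow> 'a" where
  "abs_op H A = (THE B. positive_op H B \<and>
     (\<forall>u\<in>carrier H. B (B u) = adjoint_op H A (A u)))"

text \<open>
  The trace of a trace class operator does not depend on the orthonormal basis, nor does the
  summability in the definition of the trace class; we use one fixed basis.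
\<close>

definition chosen_basis :: "'a hspace \<Rightarrow> 'a set" where
  "chosen_basis H = (SOME E. orthonormal_basis H E)"

definition trace_class :: "'a hspace \<Rightarrow> ('a \<Rightarrow> 'a) \<Rightarrow> bool" where
  "trace_class H A \<longleftrightarrow> A \<in> bounded_ops H \<and>
     (\<lambda>e. cinner H e (abs_op H A e)) summable_on chosen_basis H"

definition op_trace :: "'a hspace \<Rightarrow> ('a \<Rightarrow> 'a) \<Rightarrow> complex" where
  "op_trace H A = (\<Sum>\<^sub>\<infinity>e\<in>chosen_basis H. cinner H e (A e))"


section \<open>Hilbert space tensor products\<close>

text \<open>
  A Hilbert space tensor product is determined, up to a unique unitary isomorphism compatible
  with the elementary tensors, by multilinearity, the inner product of elementary tensors, and
  the density of their span. The \<open>d\<close>-fold power is indexed by a finite type with \<open>d\<close> elements.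
\<close>

definition tensor_power ::
    "'a hspace \<Rightarrow> 'b hspace \<Rightarrow> (('d::finite \<Rightarrow> 'a) \<Rightarrow> 'b) \<Rightarrow> bool" where
  "tensor_power H T \<tau> \<longleftrightarrow> hilbert_space T \<and>
     (\<forall>u j a b. range u \<subseteq> carrier H \<longrightarrow> a \<in> carrier H \<longrightarrow> b \<in> carrier H \<longrightarrow>
        \<tau> (u(j := a \<oplus>\<^bsub>H\<^esub> b)) = \<tau> (u(j := a)) \<oplus>\<^bsub>T\<^esub> \<tau> (u(j := b))) \<and>
     (\<forall>u j a c. range u \<subseteq> carrier H \<longrightarrow> a \<in> carrier H \<longrightarrow>
        \<tau> (u(j := c \<odot>\<^bsub>H\<^esub> a)) = c \<odot>\<^bsub>T\<^esub> \<tau> (u(j := a))) \<and>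
     (\<forall>u v. range u \<subseteq> carrier H \<longrightarrow> range v \<subseteq> carrier H \<longrightarrow>
        cinner T (\<tau> u) (\<tau> v) = (\<Prod>j\<in>UNIV. cinner H (u j) (v j))) \<and>
     total_in T (\<tau> ` {u. range u \<subseteq> carrier H})"

definition tensor_power_op ::
    "'a hspace \<Rightarrow> 'b hspace \<Rightarrow> (('d::finite \<Rightarrow> 'a) \<Rightarrow> 'b) \<Rightarrow> ('d \<Rightarrow> 'a \<Rightarrow> 'a) \<Rightarrow> 'b \<Rightarrow> 'b" where
  "tensor_power_op H T \<tau> B = (THE A. A \<in> bounded_ops T \<and>
     (\<forall>u. range u \<subseteq> carrier H \<longrightarrow> A (\<tau> u) = \<tau> (\<lambda>j. B j (u j))))"

definition tensor_product ::
    "'a hspace \<Rightarrow> 'b hspace \<Rightarrow> 'c hspace \<Rightarrow> ('a \<Rightarrow> 'b \<Rightarrow> 'c) \<Rightarrow> bool" where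
  "tensor_product H H' S \<theta> \<longleftrightarrow> hilbert_space S \<and>
     (\<forall>u\<in>carrier H. \<forall>v\<in>carrier H. \<forall>w\<in>carrier H'. \<theta> (u \<oplus>\<^bsub>H\<^esub> v) w = \<theta> u w \<oplus>\<^bsub>S\<^esub> \<theta> v w) \<and>
     (\<forall>u\<in>carrier H. \<forall>v\<in>carrier H'. \<forall>w\<in>carrier H'. \<theta> u (v \<oplus>\<^bsub>H'\<^esub> w) = \<theta> u v \<oplus>\<^bsub>S\<^esub> \<theta> u w) \<and>
     (\<forall>c. \<forall>u\<in>carrier H. \<forall>v\<in>carrier H'.
        \<theta> (c \<odot>\<^bsub>H\<^esub> u) v = c \<odot>\<^bsub>S\<^esub> \<theta> u v \<and> \<theta> u (c \<odot>\<^bsub>H'\<^esub> v) = c \<odot>\<^bsub>S\<^esub> \<theta> u v) \<and>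
     (\<forall>u\<in>carrier H. \<forall>u'\<in>carrier H. \<forall>v\<in>carrier H'. \<forall>v'\<in>carrier H'.
        cinner S (\<theta> u v) (\<theta> u' v') = cinner H u u' * cinner H' v v') \<and>
     total_in S {\<theta> u v | u v. u \<in> carrier H \<and> v \<in> carrier H'}"

definition tensor_product_op ::
    "'a hspace \<Rightarrow> 'b hspace \<Rightarrow> 'c hspace \<Rightarrow> ('a \<Rightarrow> 'b \<Rightarrow> 'c) \<Rightarrow>
     ('a \<Rightarrow> 'a) \<Rightarrow> ('b \<Rightarrow> 'b) \<Rightarrow> 'c \<Rightarrow> 'c" where
  "tensor_product_op H H' S \<theta> A B = (THE D. D \<in> bounded_ops S \<and>
     (\<forall>u\<in>carrier H. \<forall>v\<in>carrier H'. D (\<theta> u v) = \<theta> (A u) (B v)))"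


section \<open>Sequence spaces and square integrable functions\<close>

definition complex_hspace :: "complex hspace" where
  "complex_hspace = \<lparr>carrier = UNIV, mult = (*), one = 1, zero = 0, add = (+), smult = (*),
     cinner = (\<lambda>a b. cnj a * b)\<rparr>"

text \<open>Square summable families, indexed by \<open>'i\<close>, of vectors of \<open>H\<close>.\<close>

definition l2 :: "'a hspace \<Rightarrow> ('i \<Rightarrow> 'a) hspace" where
  "l2 H = \<lparr>carrier = {W. range W \<subseteq> carrier H \<and> (\<lambda>x. (hnorm H (W x))\<^sup>2) summable_on UNIV},
     mult = undefined, one = undefined,
     zero = (\<lambda>x. \<zero>\<^bsub>H\<^esub>),
     add = (\<lambda>V W x. V x \<oplus>\<^bsub>H\<^esub> W x),
     smult = (\<lambda>c W x. c \<odot>\<^bsub>H\<^esub> W x),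
     cinner = (\<lambda>V W. \<Sum>\<^sub>\<infinity>x. cinner H (V x) (W x))\<rparr>"

definition sq_integrable :: "'w measure \<Rightarrow> ('w \<Rightarrow> complex) set" where
  "sq_integrable M = {f \<in> borel_measurable M. integrable M (\<lambda>w. (cmod (f w))\<^sup>2)}"

definition ae_rel :: "'w measure \<Rightarrow> (('w \<Rightarrow> complex) \<times> ('w \<Rightarrow> complex)) set" where
  "ae_rel M = {(f, g). f \<in> sq_integrable M \<and> g \<in> sq_integrable M \<and> (AE w in M. f w = g w)}"

definition ae_class :: "'w measure \<Rightarrow> ('w \<Rightarrow> complex) \<Rightarrow> ('w \<Rightarrow> complex) set" where
  "ae_class M f = ae_rel M `` {f}"

definition ae_rep :: "('w \<Rightarrow> complex) set \<Rightarrow> 'w \<Rightarrow> complex" where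
  "ae_rep U = (SOME f. f \<in> U)"

definition L2 :: "'w measure \<Rightarrow> ('w \<Rightarrow> complex) set hspace" where
  "L2 M = \<lparr>carrier = sq_integrable M // ae_rel M,
     mult = undefined, one = undefined,
     zero = ae_class M (\<lambda>w. 0),
     add = (\<lambda>U V. ae_class M (\<lambda>w. ae_rep U w + ae_rep V w)),
     smult = (\<lambda>c U. ae_class M (\<lambda>w. c * ae_rep U w)),
     cinner = (\<lambda>U V. LINT w|M. cnj (ae_rep U w) * ae_rep V w)\<rparr>"


section \<open>Bernoulli functionals\<close>

type_synonym functional = "((nat \<Rightarrow> int) \<Rightarrow> complex) set"

definition sign_seqs :: "(nat \<Rightarrow> int) set" where
  "sign_seqs = {f. \<forall>n. f n \<in> {-1, 1}}"

text \<open>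
  A finite set \<open>N\<close> with a map \<open>\<epsilon>\<close> encodes distinct indices \<open>n\<^sub>1, \<dots>, n\<^sub>k\<close> with signs
  \<open>\<epsilon> n\<^sub>1, \<dots>, \<epsilon> n\<^sub>k\<close>.
\<close>

definition bernoulli_measure :: "(nat \<Rightarrow> real) \<Rightarrow> (nat \<Rightarrow> int) measure \<Rightarrow> bool" where
  "bernoulli_measure p P \<longleftrightarrow> prob_space P \<and> space P = sign_seqs \<and>
     sets P = sigma_sets sign_seqs {{f \<in> sign_seqs. f n \<in> B} | n B. B \<subseteq> {-1, 1}} \<and>
     (\<forall>N \<epsilon>. finite N \<and> N \<noteq> {} \<and> (\<forall>n\<in>N. \<epsilon> n \<in> {-1, 1 :: int}) \<longrightarrow>
        measure P {f \<in> sign_seqs. \<forall>n\<in>N. f n = \<epsilon> n} =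
          (\<Prod>n\<in>N. p n powr ((1 + real_of_int (\<epsilon> n)) / 2)
                  * (1 - p n) powr ((1 - real_of_int (\<epsilon> n)) / 2)))"

definition Z_fun :: "(nat \<Rightarrow> real) \<Rightarrow> nat \<Rightarrow> (nat \<Rightarrow> int) \<Rightarrow> real" where
  "Z_fun p n f = (real_of_int (f n) + (1 - p n) - p n) / (2 * sqrt (p n * (1 - p n)))"

definition Z_vec :: "(nat \<Rightarrow> real) \<Rightarrow> (nat \<Rightarrow> int) measure \<Rightarrow> nat set \<Rightarrow> functional" where
  "Z_vec p P \<sigma> = ae_class P (\<lambda>f. complex_of_real (\<Prod>j\<in>\<sigma>. Z_fun p j f))"

definition annihilation ::
    "(nat \<Rightarrow> real) \<Rightarrow> (nat \<Rightarrow> int) measure \<Rightarrow> nat \<Rightarrow> functional \<Rightarrow> functional" where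
  "annihilation p P k = (THE A. A \<in> bounded_ops (L2 P) \<and>
     (\<forall>\<sigma>. finite \<sigma> \<longrightarrow>
        A (Z_vec p P \<sigma>) = (if k \<in> \<sigma> then Z_vec p P (\<sigma> - {k}) else \<zero>\<^bsub>L2 P\<^esub>)))"

definition creation ::
    "(nat \<Rightarrow> real) \<Rightarrow> (nat \<Rightarrow> int) measure \<Rightarrow> nat \<Rightarrow> functional \<Rightarrow> functional" where
  "creation p P k = adjoint_op (L2 P) (annihilation p P k)"

definition L_op ::
    "(nat \<Rightarrow> real) \<Rightarrow> (nat \<Rightarrow> int) measure \<Rightarrow> nat \<Rightarrow> functional \<Rightarrow> functional" where
  "L_op p P n = (\<lambda>u\<in>carrier (L2 P).
     (1/2) \<odot>\<^bsub>L2 P\<^esub> ((creation p P n u \<oplus>\<^bsub>L2 P\<^esub> annihilation p P n u) \<ominus>\<^bsub>L2 P\<^esub> u))"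

definition R_op ::
    "(nat \<Rightarrow> real) \<Rightarrow> (nat \<Rightarrow> int) measure \<Rightarrow> nat \<Rightarrow> functional \<Rightarrow> functional" where
  "R_op p P n = (\<lambda>u\<in>carrier (L2 P).
     (1/2) \<odot>\<^bsub>L2 P\<^esub> ((creation p P n u \<oplus>\<^bsub>L2 P\<^esub> annihilation p P n u) \<oplus>\<^bsub>L2 P\<^esub> u))"

definition signs :: "(int ^ 'd::finite) set" where
  "signs = {\<epsilon>. \<forall>j. \<epsilon> $ j \<in> {-1, 1}}"

definition C_op ::
    "(nat \<Rightarrow> real) \<Rightarrow> (nat \<Rightarrow> int) measure \<Rightarrow> 'b hspace \<Rightarrow> (('d::finite \<Rightarrow> functional) \<Rightarrow> 'b) \<Rightarrow>
     ('b \<Rightarrow> functional) \<Rightarrow> nat \<Rightarrow> int ^ 'd \<Rightarrow> functional \<Rightarrow> functional" where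
  "C_op p P T \<tau> K n \<epsilon> = (\<lambda>u\<in>carrier (L2 P).
     K (tensor_power_op (L2 P) T \<tau> (\<lambda>j. if \<epsilon> $ j = -1 then L_op p P n else R_op p P n)
         (inv_into (carrier T) K u)))"


section \<open>The two walks\<close>

definition nuclei :: "'a hspace \<Rightarrow> (int ^ 'd::finite \<Rightarrow> 'a \<Rightarrow> 'a) set" where
  "nuclei H = {\<omega>. (\<forall>x. positive_op H (\<omega> x) \<and> trace_class H (\<omega> x)) \<and>
     ((\<lambda>x. op_trace H (\<omega> x)) has_sum 1) UNIV}"

definition open_step ::
    "(nat \<Rightarrow> real) \<Rightarrow> (nat \<Rightarrow> int) measure \<Rightarrow> 'b hspace \<Rightarrow> (('d::finite \<Rightarrow> functional) \<Rightarrow> 'b) \<Rightarrow>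
     ('b \<Rightarrow> functional) \<Rightarrow> nat \<Rightarrow> (int ^ 'd \<Rightarrow> functional \<Rightarrow> functional) \<Rightarrow>
     int ^ 'd \<Rightarrow> functional \<Rightarrow> functional" where
  "open_step p P T \<tau> K n \<omega> x = (\<lambda>u\<in>carrier (L2 P).
     \<Oplus>\<^bsub>L2 P\<^esub>\<epsilon>\<in>signs. C_op p P T \<tau> K n \<epsilon> (\<omega> (x - \<epsilon>) (C_op p P T \<tau> K n \<epsilon> u)))"

definition delta_vec :: "'i \<Rightarrow> 'i \<Rightarrow> complex" where
  "delta_vec x = (\<lambda>y. if y = x then 1 else 0)"

text \<open>
  The sum of \<open>|\<delta>\<^sub>x\<rangle>\<langle>\<delta>\<^sub>x| \<otimes> \<omega>(x)\<close> over all \<open>x\<close>, taken in the strong operator topology, on a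
  tensor product \<open>(S, \<theta>)\<close> of the sequence space and \<open>H\<close>.
\<close>

definition density_op ::
    "'a hspace \<Rightarrow> 's hspace \<Rightarrow> ((int ^ 'd::finite \<Rightarrow> complex) \<Rightarrow> 'a \<Rightarrow> 's) \<Rightarrow>
     (int ^ 'd \<Rightarrow> 'a \<Rightarrow> 'a) \<Rightarrow> 's \<Rightarrow> 's" where
  "density_op H S \<theta> \<omega> = (THE A. A \<in> bounded_ops S \<and>
     (\<forall>v\<in>carrier S.
        ((\<lambda>F. hnorm S ((\<Oplus>\<^bsub>S\<^esub>x\<in>F. tensor_product_op (l2 complex_hspace) H S \<theta>
                          (rank_one (l2 complex_hspace) (delta_vec x)) (\<omega> x) v) \<ominus>\<^bsub>S\<^esub> A v))
          \<longlongrightarrow> 0) (finite_subsets_at_top UNIV)))"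

text \<open>\<open>\<rho>\<close> is the state sequence and \<open>\<omega> n\<close> is the nucleus of \<open>\<rho> n\<close>.\<close>

definition open_qbn_walk ::
    "(nat \<Rightarrow> real) \<Rightarrow> (nat \<Rightarrow> int) measure \<Rightarrow> 'b hspace \<Rightarrow> (('d::finite \<Rightarrow> functional) \<Rightarrow> 'b) \<Rightarrow>
     ('b \<Rightarrow> functional) \<Rightarrow> 's hspace \<Rightarrow> ((int ^ 'd \<Rightarrow> complex) \<Rightarrow> functional \<Rightarrow> 's) \<Rightarrow>
     (nat \<Rightarrow> 's \<Rightarrow> 's) \<Rightarrow> (nat \<Rightarrow> int ^ 'd \<Rightarrow> functional \<Rightarrow> functional) \<Rightarrow> bool" where
  "open_qbn_walk p P T \<tau> K S \<theta> \<rho> \<omega> \<longleftrightarrow>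
     (\<forall>n. \<omega> n \<in> nuclei (L2 P)) \<and>
     (\<forall>n. \<rho> n = density_op (L2 P) S \<theta> (\<omega> n)) \<and>
     (\<forall>n. \<omega> (Suc n) = open_step p P T \<tau> K n (\<omega> n))"

definition qbn_step ::
    "(nat \<Rightarrow> real) \<Rightarrow> (nat \<Rightarrow> int) measure \<Rightarrow> 'b hspace \<Rightarrow> (('d::finite \<Rightarrow> functional) \<Rightarrow> 'b) \<Rightarrow>
     ('b \<Rightarrow> functional) \<Rightarrow> nat \<Rightarrow> (int ^ 'd \<Rightarrow> functional) \<Rightarrow> int ^ 'd \<Rightarrow> functional" where
  "qbn_step p P T \<tau> K n = (\<lambda>W\<in>carrier (l2 (L2 P)).
     \<lambda>x. \<Oplus>\<^bsub>L2 P\<^esub>\<epsilon>\<in>signs. C_op p P T \<tau> K n \<epsilon> (W (x - \<epsilon>)))"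

definition qbn_walk ::
    "(nat \<Rightarrow> real) \<Rightarrow> (nat \<Rightarrow> int) measure \<Rightarrow> 'b hspace \<Rightarrow> (('d::finite \<Rightarrow> functional) \<Rightarrow> 'b) \<Rightarrow>
     ('b \<Rightarrow> functional) \<Rightarrow> (nat \<Rightarrow> int ^ 'd \<Rightarrow> functional) \<Rightarrow> bool" where
  "qbn_walk p P T \<tau> K W \<longleftrightarrow>
     (\<forall>n. W n \<in> carrier (l2 (L2 P)) \<and> hnorm (l2 (L2 P)) (W n) = 1) \<and>
     (\<forall>n. W (Suc n) = qbn_step p P T \<tau> K n (W n))"

end

theory Submission
  imports Defs
begin

text \<open>
  Write \<open>X\<^sub>n\<close> for the sum of the creation and the annihilation operator at \<open>n\<close>. It sends
  \<open>Z\<^sub>\<sigma>\<close> to \<open>Z\<close> of the symmetric difference of \<open>\<sigma>\<close> and \<open>{n}\<close>, so it is a self-adjoint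
  involution, and \<open>X\<^sub>m\<close> and \<open>X\<^sub>n\<close> commute. Hence \<open>R\<^sub>n\<close> and \<open>- L\<^sub>n\<close> are the two spectral
  projections of \<open>X\<^sub>n\<close>. Tensor products and conjugation by a unitary map preserve what
  matters here: the operators \<open>C\<^sub>n\<^sup>\<epsilon>\<close> are self-adjoint, for fixed \<open>n\<close> their ranges are
  mutually orthogonal (\<open>C_orthogonal\<close>), and operators of different times commute
  (\<open>C_commute\<close>).

  Unfolding both walks writes \<open>W\<^sub>n(x)\<close> as the sum, over all sign paths that lead to \<open>x\<close>, of
  products of the \<open>C\<^sub>k\<^sup>\<epsilon>\<close> applied to initial vectors, and the trace of the nucleus as the
  sum of the squared norms of the same summands. By commutation a product can be made to
  start with the factor in which two paths differ, so distinct summands are orthogonal and the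
  two numbers agree by Pythagoras. The lemma \<open>trace_conjugated_walk\<close> carries out this
  argument by induction on time, for any Hilbert space and any such family of operators, and
  without mentioning paths: it computes the trace of \<open>M \<omega>\<^sub>n(x) M\<^sup>*\<close> for every \<open>M\<close> that
  commutes with the operators of the first \<open>n\<close> steps.

  The operators in the statement are defined by description from their values on a total set
  and, for the trace, from some orthonormal basis; so the rest of the work is existence. The
  space of square integrable functions is complete because it is the image of a Hilbert space
  under a unitary map (\<open>hilbert_space_unitary_image\<close>). The vectors \<open>Z\<^sub>\<sigma>\<close> are an
  orthonormal basis by independence of the coordinates and a Dynkin argument
  (\<open>Z_vecs_orthonormal_basis\<close>). All operators are obtained from one criterion,
  \<open>bounded_op_exists\<close>, which covers isometries and multiples of orthogonal projections; the
  annihilation operator is a product of one of each.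
\<close>

section \<open>Geometry of Hilbert spaces\<close>

lemma complex_field_simps [simp]:
  "carrier complex_field = UNIV" "\<zero>\<^bsub>complex_field\<^esub> = 0" "\<one>\<^bsub>complex_field\<^esub> = 1"
  "a \<oplus>\<^bsub>complex_field\<^esub> b = a + b" "a \<otimes>\<^bsub>complex_field\<^esub> b = a * b"
  by (simp_all add: complex_field_def)

context hilbert_space
begin

lemma smult_mem [simp, intro]: "u \<in> carrier H \<Longrightarrow> a \<odot> u \<in> carrier H"
  by (rule smult_closed) simp_all

lemma cinner_add_left:
  "\<lbrakk>u \<in> carrier H; v \<in> carrier H; w \<in> carrier H\<rbrakk>
    \<Longrightarrow> cinner H (v \<oplus> w) u = cinner H v u + cinner H w u"
  by (subst (1 2 3) cinner_commute[of u]) (simp_all add: cinner_add)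

lemma cinner_smult_left:
  "\<lbrakk>v \<in> carrier H; u \<in> carrier H\<rbrakk> \<Longrightarrow> cinner H (a \<odot> v) u = cnj a * cinner H v u"
  by (subst (1 2) cinner_commute[of u]) (simp_all add: cinner_smult)

lemma smult_zero_left: "u \<in> carrier H \<Longrightarrow> 0 \<odot> u = \<zero>"
  using smult_l_null[of u] by simp

lemma minus_eq_smult: "u \<in> carrier H \<Longrightarrow> \<ominus> u = (-1) \<odot> u"
proof -
  assume u: "u \<in> carrier H"
  have "(-1) \<odot> u \<oplus> u = (-1) \<odot> u \<oplus> 1 \<odot> u" using u smult_one[of u] by simp
  also have "\<dots> = \<zero>" using u smult_l_distr[of "-1" 1 u] by (simp add: smult_zero_left)
  finally show ?thesis using u by (simp add: M.minus_equality)
qed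

lemma cinner_zero_right [simp]: "u \<in> carrier H \<Longrightarrow> cinner H u \<zero> = 0"
  using cinner_smult[of u u 0] by (simp add: smult_zero_left)

lemma cinner_zero_left [simp]: "u \<in> carrier H \<Longrightarrow> cinner H \<zero> u = 0"
  using cinner_smult_left[of u u 0] by (simp add: smult_zero_left)

lemma cinner_uminus:
  assumes "u \<in> carrier H" "v \<in> carrier H"
  shows "cinner H u (\<ominus> v) = - cinner H u v" "cinner H (\<ominus> v) u = - cinner H v u"
  using assms by (simp_all add: minus_eq_smult cinner_smult cinner_smult_left)

lemma cinner_diff:
  assumes "u \<in> carrier H" "v \<in> carrier H" "w \<in> carrier H"
  shows "cinner H u (v \<ominus> w) = cinner H u v - cinner H u w"
    "cinner H (v \<ominus> w) u = cinner H v u - cinner H w u"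
  using assms by (simp_all add: a_minus_def cinner_add cinner_add_left cinner_uminus)

lemma cinner_finsum:
  assumes "finite F" "u \<in> carrier H" "f \<in> F \<rightarrow> carrier H"
  shows "cinner H u (\<Oplus>i\<in>F. f i) = (\<Sum>i\<in>F. cinner H u (f i))"
  using assms by (induction F rule: finite_induct) (auto simp: cinner_add Pi_def)

lemma cinner_finsum_left:
  assumes "finite F" "u \<in> carrier H" "f \<in> F \<rightarrow> carrier H"
  shows "cinner H (\<Oplus>i\<in>F. f i) u = (\<Sum>i\<in>F. cinner H (f i) u)"
  using assms by (induction F rule: finite_induct) (auto simp: cinner_add_left Pi_def)

lemmas cinner_linear = cinner_add cinner_add_left cinner_smult cinner_smult_left cinner_diff
  cinner_uminus

lemma diff_eq_zero_iff: "\<lbrakk>u \<in> carrier H; v \<in> carrier H\<rbrakk> \<Longrightarrow> u \<ominus> v = \<zero> \<longleftrightarrow> u = v"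
  using M.minus_equality[of u "\<ominus> v"] by (auto simp: a_minus_def M.r_neg)

text \<open>
  With this principle, and linearity of the inner product, an identity between vectors
  becomes an identity between complex numbers.
\<close>

lemma vector_eqI:
  assumes "u \<in> carrier H" "v \<in> carrier H"
    and "\<And>w. w \<in> carrier H \<Longrightarrow> cinner H w u = cinner H w v"
  shows "u = v"
proof -
  have "cinner H (u \<ominus> v) (u \<ominus> v) = 0"
    using assms by (simp add: cinner_diff(1))
  then show ?thesis
    using assms(1,2) cinner_definite diff_eq_zero_iff by blast
qed

lemma cinner_self:
  assumes "u \<in> carrier H"
  shows "cinner H u u = complex_of_real ((hnorm H u)\<^sup>2)"
proof -
  have "Im (cinner H u u) = Im (cnj (cinner H u u))"
    using cinner_commute[OF assms assms] by (rule arg_cong)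
  then show ?thesis
    using cinner_nonneg[OF assms] by (simp add: hnorm_def complex_eq_iff)
qed

lemma hnorm_nonneg [simp]: "u \<in> carrier H \<Longrightarrow> 0 \<le> hnorm H u"
  using cinner_nonneg[of u] by (simp add: hnorm_def)

lemma hnorm_sq: "u \<in> carrier H \<Longrightarrow> (hnorm H u)\<^sup>2 = Re (cinner H u u)"
  using cinner_nonneg[of u] by (simp add: hnorm_def)

lemma hnorm_zero [simp]: "hnorm H \<zero> = 0"
  by (simp add: hnorm_def)

lemma hnorm_eq_zeroD: "\<lbrakk>u \<in> carrier H; hnorm H u = 0\<rbrakk> \<Longrightarrow> u = \<zero>"
  using cinner_definite[of u] cinner_self[of u] by simp

lemma cauchy_schwarz:
  assumes u: "u \<in> carrier H" and v: "v \<in> carrier H"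
  shows "cmod (cinner H u v) \<le> hnorm H u * hnorm H v"
proof (cases "hnorm H v = 0")
  case True
  then have "v = \<zero>" using v hnorm_eq_zeroD by blast
  then show ?thesis using u by simp
next
  case False
  define a where "a = (hnorm H u)\<^sup>2"
  define b where "b = (hnorm H v)\<^sup>2"
  define c where "c = cinner H v u"
  define w where "w = of_real b \<odot> u \<ominus> c \<odot> v"
  have b: "b > 0" using False by (simp add: b_def)
  have w: "w \<in> carrier H" using u v by (simp add: w_def)
  have uv: "cinner H u v = cnj c" using u v unfolding c_def by (rule cinner_commute[rotated])
  have "cinner H w w = of_real b * (of_real b * of_real a) - of_real b * (c * cnj c)"
  proof -
    have "cinner H w w = of_real b * (of_real b * cinner H u u - c * cinner H u v)
        - cnj c * (of_real b * cinner H v u - c * cinner H v v)"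
      using u v unfolding w_def by (simp add: cinner_linear) (simp add: algebra_simps)
    then show ?thesis
      using u v uv by (simp add: cinner_self flip: a_def b_def c_def) (simp add: algebra_simps)
  qed
  also have "\<dots> = complex_of_real (b * (b * a - (cmod c)\<^sup>2))"
    unfolding complex_norm_square[symmetric] by (simp add: algebra_simps)
  finally have "Re (cinner H w w) = b * (b * a - (cmod c)\<^sup>2)"
    by (simp only: Re_complex_of_real)
  then have "0 \<le> b * (b * a - (cmod c)\<^sup>2)" using cinner_nonneg[OF w] by simp
  then have "(cmod c)\<^sup>2 \<le> (hnorm H u * hnorm H v)\<^sup>2"
    using b by (simp add: zero_le_mult_iff a_def b_def power_mult_distrib mult.commute)
  then have "cmod c \<le> hnorm H u * hnorm H v"
    by (rule power2_le_imp_le) (use u v in simp)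
  then show ?thesis
    using uv by simp
qed

lemma hnorm_triangle:
  assumes u: "u \<in> carrier H" and v: "v \<in> carrier H"
  shows "hnorm H (u \<oplus> v) \<le> hnorm H u + hnorm H v"
proof (rule power2_le_imp_le)
  have "Re (cinner H v u) = Re (cinner H u v)"
    using cinner_commute[OF u v] by simp
  then have "(hnorm H (u \<oplus> v))\<^sup>2 = (hnorm H u)\<^sup>2 + 2 * Re (cinner H u v) + (hnorm H v)\<^sup>2"
    using u v by (simp add: hnorm_sq cinner_linear)
  also have "Re (cinner H u v) \<le> hnorm H u * hnorm H v"
    using cauchy_schwarz[OF u v] complex_Re_le_cmod[of "cinner H u v"] by linarith
  finally show "(hnorm H (u \<oplus> v))\<^sup>2 \<le> (hnorm H u + hnorm H v)\<^sup>2"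
    by (simp add: power2_sum)
qed (use u v in simp)

lemma hnorm_smult:
  assumes "u \<in> carrier H"
  shows "hnorm H (a \<odot> u) = cmod a * hnorm H u"
proof (rule power2_eq_imp_eq)
  have "cinner H (a \<odot> u) (a \<odot> u) = complex_of_real ((cmod a)\<^sup>2 * (hnorm H u)\<^sup>2)"
    using assms cinner_self[of u] complex_norm_square[of a]
    by (simp add: cinner_linear algebra_simps)
  then show "(hnorm H (a \<odot> u))\<^sup>2 = (cmod a * hnorm H u)\<^sup>2"
    using assms by (simp add: hnorm_sq power_mult_distrib)
qed (use assms in auto)

lemma hnorm_minus_commute:
  assumes "u \<in> carrier H" "v \<in> carrier H"
  shows "hnorm H (u \<ominus> v) = hnorm H (v \<ominus> u)"
proof -
  have "u \<ominus> v = (-1) \<odot> (v \<ominus> u)"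
    using assms by (intro vector_eqI) (simp_all add: cinner_linear)
  then show ?thesis using assms by (simp add: hnorm_smult)
qed

lemma hnorm_diff_triangle:
  assumes "u \<in> carrier H" "v \<in> carrier H" "w \<in> carrier H"
  shows "hnorm H (u \<ominus> w) \<le> hnorm H (u \<ominus> v) + hnorm H (v \<ominus> w)"
proof -
  have "u \<ominus> w = (u \<ominus> v) \<oplus> (v \<ominus> w)"
    using assms by (intro vector_eqI) (simp_all add: cinner_linear)
  then show ?thesis using assms hnorm_triangle[of "u \<ominus> v" "v \<ominus> w"] by simp
qed

lemma hnorm_le_diff:
  assumes "u \<in> carrier H" "v \<in> carrier H"
  shows "hnorm H u \<le> hnorm H v + hnorm H (u \<ominus> v)"
proof -
  have "v \<oplus> (u \<ominus> v) = u"
    using assms by (intro vector_eqI) (simp_all add: cinner_linear)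
  then show ?thesis using assms hnorm_triangle[of v "u \<ominus> v"] by simp
qed

lemma hnorm_add_diff_le:
  assumes "u \<in> carrier H" "v \<in> carrier H" "u' \<in> carrier H" "v' \<in> carrier H"
  shows "hnorm H ((u \<oplus> v) \<ominus> (u' \<oplus> v')) \<le> hnorm H (u \<ominus> u') + hnorm H (v \<ominus> v')"
proof -
  have "(u \<oplus> v) \<ominus> (u' \<oplus> v') = (u \<ominus> u') \<oplus> (v \<ominus> v')"
    using assms by (intro vector_eqI) (simp_all add: cinner_linear)
  then show ?thesis using assms hnorm_triangle[of "u \<ominus> u'" "v \<ominus> v'"] by simp
qed

lemma hnorm_smult_diff:
  assumes "u \<in> carrier H" "v \<in> carrier H"
  shows "hnorm H (a \<odot> u \<ominus> a \<odot> v) = cmod a * hnorm H (u \<ominus> v)"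
proof -
  have "a \<odot> u \<ominus> a \<odot> v = a \<odot> (u \<ominus> v)"
    using assms by (intro vector_eqI) (simp_all add: cinner_linear right_diff_distrib)
  then show ?thesis using assms hnorm_smult[of "u \<ominus> v" a] by simp
qed

end

section \<open>Total sets and bounded operators\<close>

lemma le_all_eps: "(\<And>e. e > 0 \<Longrightarrow> a \<le> b + c * e) \<Longrightarrow> a \<le> (b::real)"
proof (rule ccontr)
  assume *: "\<And>e. e > 0 \<Longrightarrow> a \<le> b + c * e" and "\<not> a \<le> b"
  \<comment> \<open>small enough for \<open>c * e\<close> to be at most half of the supposed gap\<close>
  define e where "e = (a - b) / (2 * (\<bar>c\<bar> + 1))"
  have e: "e > 0" using \<open>\<not> a \<le> b\<close> by (simp add: e_def add_pos_nonneg)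
  have "c * e \<le> (\<bar>c\<bar> + 1) * e" using e by (intro mult_right_mono) auto
  also have "\<dots> = (a - b) / 2" by (simp add: e_def field_simps add_nonneg_eq_0_iff)
  finally show False using *[OF e] \<open>\<not> a \<le> b\<close> by simp
qed

context hilbert_space
begin

text \<open>
  Closed linear subspaces that contain a total set are the whole space; stated as an
  induction principle.
\<close>

lemma total_induct [consumes 2, case_names base zero add smult limit]:
  assumes total: "total_in H E" and u: "u \<in> carrier H"
    and base: "\<And>e. e \<in> E \<Longrightarrow> Q e"
    and zero: "Q \<zero>"
    and add: "\<And>u v. \<lbrakk>u \<in> carrier H; v \<in> carrier H; Q u; Q v\<rbrakk> \<Longrightarrow> Q (u \<oplus> v)"
    and smult: "\<And>a u. \<lbrakk>u \<in> carrier H; Q u\<rbrakk> \<Longrightarrow> Q (a \<odot> u)"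
    and limit: "\<And>u. \<lbrakk>u \<in> carrier H; \<And>e. e > 0 \<Longrightarrow> \<exists>v\<in>carrier H. Q v \<and> hnorm H (u \<ominus> v) < e\<rbrakk>
      \<Longrightarrow> Q u"
  shows "Q u"
proof -
  have E: "E \<subseteq> carrier H" using total by (simp add: total_in_def)
  have *: "(\<Oplus>e\<in>F. c e \<odot> e) \<in> carrier H \<and> Q (\<Oplus>e\<in>F. c e \<odot> e)"
    if "finite F" "F \<subseteq> E" for F c
    using that
  proof (induction F rule: finite_induct)
    case (insert x F)
    have "(\<lambda>e. c e \<odot> e) \<in> F \<rightarrow> carrier H" using insert.prems E by auto
    moreover have "x \<in> carrier H" "x \<in> E" using insert.prems E by auto
    ultimately show ?case using insert add[of "c x \<odot> x"] smult[of x "c x"] base[of x] by auto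
  qed (simp add: zero)
  show ?thesis
  proof (rule limit[OF u])
    fix e :: real assume "e > 0"
    then obtain v where "v \<in> hspan H E" "hnorm H (u \<ominus> v) < e"
      using total u unfolding total_in_def by blast
    then show "\<exists>v\<in>carrier H. Q v \<and> hnorm H (u \<ominus> v) < e"
      using * unfolding hspan_def by blast
  qed
qed

text \<open>
  The bound is continuity: it makes the kernel of \<open>\<phi>\<close> closed.
\<close>

lemma functional_eq_0:
  fixes \<phi> :: "'a \<Rightarrow> complex"
  assumes "total_in H E" "u \<in> carrier H"
    and "\<And>e. e \<in> E \<Longrightarrow> \<phi> e = 0"
    and add: "\<And>u v. \<lbrakk>u \<in> carrier H; v \<in> carrier H\<rbrakk> \<Longrightarrow> \<phi> (u \<oplus> v) = \<phi> u + \<phi> v"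
    and smult: "\<And>a u. u \<in> carrier H \<Longrightarrow> \<phi> (a \<odot> u) = a * \<phi> u"
    and bound: "\<And>u. u \<in> carrier H \<Longrightarrow> cmod (\<phi> u) \<le> c * hnorm H u"
  shows "\<phi> u = 0"
  using assms(1,2)
proof (induction rule: total_induct)
  case zero
  then show ?case using smult[of \<zero> 0] by (simp add: smult_zero_left)
next
  case (limit u)
  have "cmod (\<phi> u) \<le> 0 + \<bar>c\<bar> * e" if e: "e > 0" for e
  proof -
    from limit(2)[OF e] obtain v where
      v: "v \<in> carrier H" "\<phi> v = 0" "hnorm H (u \<ominus> v) < e" by blast
    have "u = v \<oplus> (u \<ominus> v)"
      using v(1) limit(1) by (intro vector_eqI) (simp_all add: cinner_linear)
    then have "\<phi> u = \<phi> (u \<ominus> v)"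
      using add[of v "u \<ominus> v"] v(1,2) limit(1) by auto
    then have "cmod (\<phi> u) \<le> c * hnorm H (u \<ominus> v)"
      using bound[of "u \<ominus> v"] v(1) limit(1) by simp
    also have "\<dots> \<le> \<bar>c\<bar> * e"
      using v limit(1) by (intro mult_mono) auto
    finally show ?thesis by simp
  qed
  then have "cmod (\<phi> u) \<le> 0" by (rule le_all_eps)
  then show ?case by simp
qed (simp_all add: assms)

lemma bounded_opsD:
  assumes "A \<in> bounded_ops H"
  shows "u \<in> carrier H \<Longrightarrow> A u \<in> carrier H"
    and "\<lbrakk>u \<in> carrier H; v \<in> carrier H\<rbrakk> \<Longrightarrow> A (u \<oplus> v) = A u \<oplus> A v"
    and "u \<in> carrier H \<Longrightarrow> A (a \<odot> u) = a \<odot> A u"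
    and "\<exists>c\<ge>0. \<forall>u\<in>carrier H. hnorm H (A u) \<le> c * hnorm H u"
proof -
  obtain c where c: "\<And>u. u \<in> carrier H \<Longrightarrow> hnorm H (A u) \<le> c * hnorm H u"
    using assms unfolding bounded_maps_def by blast
  have "hnorm H (A u) \<le> \<bar>c\<bar> * hnorm H u" if "u \<in> carrier H" for u
    using order_trans[OF c[OF that] mult_right_mono[OF abs_ge_self hnorm_nonneg[OF that]]] .
  then show "\<exists>c\<ge>0. \<forall>u\<in>carrier H. hnorm H (A u) \<le> c * hnorm H u"
    by (intro exI[of _ "\<bar>c\<bar>"]) auto
qed (use assms in \<open>auto simp: bounded_maps_def\<close>)

lemma bounded_opsI:
  assumes "A \<in> extensional (carrier H)"
    and "\<And>u. u \<in> carrier H \<Longrightarrow> A u \<in> carrier H"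
    and "\<And>u v. \<lbrakk>u \<in> carrier H; v \<in> carrier H\<rbrakk> \<Longrightarrow> A (u \<oplus> v) = A u \<oplus> A v"
    and "\<And>a u. u \<in> carrier H \<Longrightarrow> A (a \<odot> u) = a \<odot> A u"
    and "\<And>u. u \<in> carrier H \<Longrightarrow> hnorm H (A u) \<le> c * hnorm H u"
  shows "A \<in> bounded_ops H"
  using assms unfolding bounded_maps_def by (auto simp: PiE_def intro!: exI[of _ c])

lemma bounded_ops_id: "(\<lambda>u\<in>carrier H. u) \<in> bounded_ops H"
  by (rule bounded_opsI[where c = 1]) auto

lemma bounded_ops_zero: "(\<lambda>u\<in>carrier H. \<zero>) \<in> bounded_ops H"
proof (rule bounded_opsI[where c = 0])
  show "(\<lambda>u\<in>carrier H. \<zero>) (a \<odot> u) = a \<odot> (\<lambda>u\<in>carrier H. \<zero>) u" if "u \<in> carrier H" for a u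
    using that smult_r_null[of a] by simp
qed auto

lemma bounded_ops_comp:
  assumes A: "A \<in> bounded_ops H" and B: "B \<in> bounded_ops H"
  shows "(\<lambda>u\<in>carrier H. A (B u)) \<in> bounded_ops H"
proof -
  obtain a where a: "a \<ge> 0" "\<And>u. u \<in> carrier H \<Longrightarrow> hnorm H (A u) \<le> a * hnorm H u"
    using bounded_opsD(4)[OF A] by blast
  obtain b where b: "b \<ge> 0" "\<And>u. u \<in> carrier H \<Longrightarrow> hnorm H (B u) \<le> b * hnorm H u"
    using bounded_opsD(4)[OF B] by blast
  show ?thesis
  proof (rule bounded_opsI)
    fix u assume u: "u \<in> carrier H"
    have "hnorm H (A (B u)) \<le> a * hnorm H (B u)" using u bounded_opsD(1)[OF B] a by blast
    also have "\<dots> \<le> a * (b * hnorm H u)" using a(1) b(2)[OF u] by (rule mult_left_mono[rotated])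
    finally show "hnorm H ((\<lambda>u\<in>carrier H. A (B u)) u) \<le> (a * b) * hnorm H u"
      using u by (simp add: mult.assoc)
  qed (simp_all add: bounded_opsD[OF A] bounded_opsD[OF B])
qed

lemma bounded_ops_lincomb:
  assumes A: "A \<in> bounded_ops H" and B: "B \<in> bounded_ops H"
  shows "(\<lambda>u\<in>carrier H. a \<odot> A u \<oplus> b \<odot> B u) \<in> bounded_ops H"
proof -
  obtain c where c: "\<And>u. u \<in> carrier H \<Longrightarrow> hnorm H (A u) \<le> c * hnorm H u"
    using bounded_opsD(4)[OF A] by blast
  obtain d where d: "\<And>u. u \<in> carrier H \<Longrightarrow> hnorm H (B u) \<le> d * hnorm H u"
    using bounded_opsD(4)[OF B] by blast
  note [simp] = bounded_opsD(1-3)[OF A] bounded_opsD(1-3)[OF B]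
  show ?thesis
  proof (rule bounded_opsI)
    fix u assume u: "u \<in> carrier H"
    have "hnorm H (a \<odot> A u \<oplus> b \<odot> B u) \<le> cmod a * hnorm H (A u) + cmod b * hnorm H (B u)"
      using u hnorm_triangle[of "a \<odot> A u" "b \<odot> B u"] by (simp add: hnorm_smult)
    also have "\<dots> \<le> cmod a * (c * hnorm H u) + cmod b * (d * hnorm H u)"
      using c[OF u] d[OF u] by (intro add_mono mult_left_mono) auto
    finally show "hnorm H ((\<lambda>u\<in>carrier H. a \<odot> A u \<oplus> b \<odot> B u) u)
        \<le> (cmod a * c + cmod b * d) * hnorm H u"
      using u by (simp add: algebra_simps)
  next
    fix u v assume "u \<in> carrier H" "v \<in> carrier H"
    then show "(\<lambda>u\<in>carrier H. a \<odot> A u \<oplus> b \<odot> B u) (u \<oplus> v) =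
        (\<lambda>u\<in>carrier H. a \<odot> A u \<oplus> b \<odot> B u) u \<oplus> (\<lambda>u\<in>carrier H. a \<odot> A u \<oplus> b \<odot> B u) v"
      by simp (rule vector_eqI; simp add: cinner_linear algebra_simps)
  next
    fix k u assume "u \<in> carrier H"
    then show "(\<lambda>u\<in>carrier H. a \<odot> A u \<oplus> b \<odot> B u) (k \<odot> u) =
        k \<odot> (\<lambda>u\<in>carrier H. a \<odot> A u \<oplus> b \<odot> B u) u"
      by simp (rule vector_eqI; simp add: cinner_linear algebra_simps)
  qed simp_all
qed

text \<open>
  All identities between bounded operators below are checked on a total set and extended by
  this lemma, one argument of the inner product at a time. Taking the identity or the zero
  operator for some of the four gives adjointness, orthogonality of ranges, and equality.
\<close>

lemma total_cinner_eqI: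
  assumes total: "total_in H E"
    and A: "A \<in> bounded_ops H" and B: "B \<in> bounded_ops H"
    and C: "C \<in> bounded_ops H" and D: "D \<in> bounded_ops H"
    and eq: "\<And>e f. \<lbrakk>e \<in> E; f \<in> E\<rbrakk> \<Longrightarrow> cinner H (A e) (B f) = cinner H (C e) (D f)"
    and u: "u \<in> carrier H" and v: "v \<in> carrier H"
  shows "cinner H (A u) (B v) = cinner H (C u) (D v)"
proof -
  note mem [simp] = bounded_opsD(1)[OF A] bounded_opsD(1)[OF B] bounded_opsD(1)[OF C]
    bounded_opsD(1)[OF D]
  obtain a where a: "a \<ge> 0" "\<And>u. u \<in> carrier H \<Longrightarrow> hnorm H (A u) \<le> a * hnorm H u"
    using bounded_opsD(4)[OF A] by blast
  obtain b where b: "b \<ge> 0" "\<And>u. u \<in> carrier H \<Longrightarrow> hnorm H (B u) \<le> b * hnorm H u"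
    using bounded_opsD(4)[OF B] by blast
  obtain c where c: "c \<ge> 0" "\<And>u. u \<in> carrier H \<Longrightarrow> hnorm H (C u) \<le> c * hnorm H u"
    using bounded_opsD(4)[OF C] by blast
  obtain d where d: "d \<ge> 0" "\<And>u. u \<in> carrier H \<Longrightarrow> hnorm H (D u) \<le> d * hnorm H u"
    using bounded_opsD(4)[OF D] by blast
  have bound: "cmod (cinner H (A u) (B v) - cinner H (C u) (D v))
      \<le> (a * b + c * d) * (hnorm H u * hnorm H v)"
    if u: "u \<in> carrier H" and v: "v \<in> carrier H" for u v
  proof -
    have "cmod (cinner H (A u) (B v)) \<le> hnorm H (A u) * hnorm H (B v)"
      using u v by (simp add: cauchy_schwarz)
    also have "\<dots> \<le> (a * hnorm H u) * (b * hnorm H v)"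
      using u v a b by (intro mult_mono) auto
    finally have 1: "cmod (cinner H (A u) (B v)) \<le> (a * hnorm H u) * (b * hnorm H v)" .
    have "cmod (cinner H (C u) (D v)) \<le> hnorm H (C u) * hnorm H (D v)"
      using u v by (simp add: cauchy_schwarz)
    also have "\<dots> \<le> (c * hnorm H u) * (d * hnorm H v)"
      using u v c d by (intro mult_mono) auto
    finally have "cmod (cinner H (C u) (D v)) \<le> (c * hnorm H u) * (d * hnorm H v)" .
    with 1 have "cmod (cinner H (A u) (B v)) + cmod (cinner H (C u) (D v))
        \<le> (a * hnorm H u) * (b * hnorm H v) + (c * hnorm H u) * (d * hnorm H v)"
      by (rule add_mono)
    then show ?thesis
      using norm_triangle_ineq4[of "cinner H (A u) (B v)" "cinner H (C u) (D v)"]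
      by (simp add: algebra_simps)
  qed
  have E: "E \<subseteq> carrier H" using total by (simp add: total_in_def)
  have right: "cinner H (A e) (B v) - cinner H (C e) (D v) = 0" if e: "e \<in> E" for e
  proof -
    have [simp]: "e \<in> carrier H" using E e by blast
    show ?thesis
      using total v
    proof (rule functional_eq_0)
      fix u assume "u \<in> carrier H"
      then show "cmod (cinner H (A e) (B u) - cinner H (C e) (D u))
          \<le> ((a * b + c * d) * hnorm H e) * hnorm H u"
        using bound[of e u] by (simp add: mult.assoc)
    qed (simp_all add: eq e bounded_opsD(2,3)[OF B] bounded_opsD(2,3)[OF D] cinner_linear
        algebra_simps)
  qed
  have "cnj (cinner H (A u) (B v) - cinner H (C u) (D v)) = 0"
    using total u
  proof (rule functional_eq_0)
    fix u assume "u \<in> carrier H"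
    then show "cmod (cnj (cinner H (A u) (B v) - cinner H (C u) (D v)))
        \<le> ((a * b + c * d) * hnorm H v) * hnorm H u"
      using bound[OF _ v, of u] by (simp only: complex_mod_cnj) (simp add: ac_simps)
  next
    fix e assume "e \<in> E"
    then show "cnj (cinner H (A e) (B v) - cinner H (C e) (D v)) = 0"
      using right by simp
  qed (simp_all add: v bounded_opsD(2,3)[OF A] bounded_opsD(2,3)[OF C] cinner_linear
      algebra_simps)
  then show ?thesis by simp
qed

lemma bounded_ops_eqI:
  assumes total: "total_in H E" and A: "A \<in> bounded_ops H" and B: "B \<in> bounded_ops H"
    and eq: "\<And>e. e \<in> E \<Longrightarrow> A e = B e"
  shows "A = B"
proof (rule extensionalityI)
  show "A \<in> extensional (carrier H)" "B \<in> extensional (carrier H)"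
    using A B by (auto simp: bounded_maps_def PiE_def)
  fix u assume u: "u \<in> carrier H"
  show "A u = B u"
  proof (rule vector_eqI)
    fix w assume w: "w \<in> carrier H"
    then show "cinner H w (A u) = cinner H w (B u)"
      using total_cinner_eqI[OF total bounded_ops_id A bounded_ops_id B, of w u] u eq by simp
  qed (use u A B bounded_opsD(1) in auto)
qed

end

section \<open>Existence of bounded operators with prescribed values\<close>

text \<open>
  A relation rather than a function: that the assignment of \<open>w i\<close> to \<open>v i\<close> extends
  linearly to the span without contradiction is only a consequence of the estimates below.
  Induction over this set takes the place of manipulating linear combinations.
\<close>

inductive_set span_graph ::
    "'a hspace \<Rightarrow> 'i set \<Rightarrow> ('i \<Rightarrow> 'a) \<Rightarrow> ('i \<Rightarrow> 'a) \<Rightarrow> ('a \<times> 'a) set"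
  for H I v w where
    base: "i \<in> I \<Longrightarrow> (v i, w i) \<in> span_graph H I v w"
  | zero: "(\<zero>\<^bsub>H\<^esub>, \<zero>\<^bsub>H\<^esub>) \<in> span_graph H I v w"
  | add: "\<lbrakk>(x, y) \<in> span_graph H I v w; (x', y') \<in> span_graph H I v w\<rbrakk>
      \<Longrightarrow> (x \<oplus>\<^bsub>H\<^esub> x', y \<oplus>\<^bsub>H\<^esub> y') \<in> span_graph H I v w"
  | smult: "(x, y) \<in> span_graph H I v w \<Longrightarrow> (a \<odot>\<^bsub>H\<^esub> x, a \<odot>\<^bsub>H\<^esub> y) \<in> span_graph H I v w"

context hilbert_space
begin

lemma span_graph_mem:
  assumes "(x, y) \<in> span_graph H I v w" "v ` I \<subseteq> carrier H" "w ` I \<subseteq> carrier H"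
  shows "x \<in> carrier H" "y \<in> carrier H"
  using assms by (induction rule: span_graph.induct) auto

lemma hspan_subset_Domain_span_graph:
  assumes v: "v ` I \<subseteq> carrier H"
  shows "hspan H (v ` I) \<subseteq> Domain (span_graph H I v w)"
proof -
  have "(\<Oplus>e\<in>F. c e \<odot> e) \<in> Domain (span_graph H I v w)"
    if "finite F" "F \<subseteq> v ` I" for F c
    using that
  proof (induction F rule: finite_induct)
    case empty
    then show ?case using span_graph.zero[of H I v w] by auto
  next
    case (insert x F)
    obtain i where i: "i \<in> I" "x = v i" using insert.prems by auto
    have "(c x \<odot> x, c x \<odot> w i) \<in> span_graph H I v w"
      unfolding i(2) using i(1) by (intro span_graph.smult span_graph.base)
    moreover obtain y where "((\<Oplus>e\<in>F. c e \<odot> e), y) \<in> span_graph H I v w"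
      using insert by auto
    ultimately have "(c x \<odot> x \<oplus> (\<Oplus>e\<in>F. c e \<odot> e), c x \<odot> w i \<oplus> y) \<in> span_graph H I v w"
      by (rule span_graph.add)
    moreover have "insert x F \<subseteq> carrier H" using insert.prems v by (rule subset_trans)
    then have "(\<lambda>e. c e \<odot> e) \<in> F \<rightarrow> carrier H" "x \<in> carrier H" by auto
    ultimately show ?case using insert.hyps by auto
  qed
  then show ?thesis unfolding hspan_def by blast
qed

text \<open>
  Both sides are sesquilinear, so the identity passes from the generators to the span.
\<close>

lemma span_graph_form:
  assumes v: "v ` I \<subseteq> carrier H" and w: "w ` I \<subseteq> carrier H"
    and form: "\<And>i j. \<lbrakk>i \<in> I; j \<in> I\<rbrakk>
      \<Longrightarrow> cinner H (w i) (w j) = s * cinner H (w i) (v j) + t * cinner H (v i) (v j)"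
    and xy: "(x, y) \<in> span_graph H I v w" and xy': "(x', y') \<in> span_graph H I v w"
  shows "cinner H y y' = s * cinner H y x' + t * cinner H x x'"
proof -
  note mem = span_graph_mem[OF _ v w]
  have right: "cinner H (w i) y' = s * cinner H (w i) x' + t * cinner H (v i) x'"
    if i: "i \<in> I" for i
    using xy'
  proof (induction rule: span_graph.induct)
    case (add x y x' y')
    then show ?case using i v w mem[OF add(1)] mem[OF add(2)]
      by (simp add: cinner_linear image_subset_iff algebra_simps)
  next
    case (smult x y a)
    then show ?case using i v w mem[OF smult(1)]
      by (simp add: cinner_linear image_subset_iff algebra_simps)
  qed (use i v w form in \<open>auto simp: image_subset_iff\<close>)
  show ?thesis
    using xy
  proof (induction rule: span_graph.induct)
    case (add x y x'' y'')
    then show ?case using mem[OF add(1)] mem[OF add(2)] mem[OF xy']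
      by (simp add: cinner_linear algebra_simps)
  next
    case (smult x y a)
    then show ?case using mem[OF smult(1)] mem[OF xy']
      by (simp add: cinner_linear algebra_simps)
  qed (use right mem[OF xy'] in auto)
qed

text \<open>
  A contraction defined on the span of a total family extends to the whole space: its values
  on approximating sequences are Cauchy, so completeness provides the limit.
\<close>

lemma contraction_extends:
  assumes total: "total_in H (v ` I)" and w: "w ` I \<subseteq> carrier H"
    and contr: "\<And>x y. (x, y) \<in> span_graph H I v w \<Longrightarrow> hnorm H y \<le> hnorm H x"
  shows "\<exists>A\<in>bounded_ops H. \<forall>i\<in>I. A (v i) = w i"
proof -
  have v: "v ` I \<subseteq> carrier H" using total by (simp add: total_in_def)
  let ?G = "span_graph H I v w"
  note mem = span_graph_mem[OF _ v w]
  \<comment> \<open>the closure of the graph, which will be the graph of the extension\<close>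
  define cl where "cl u y \<longleftrightarrow> u \<in> carrier H \<and> y \<in> carrier H \<and>
    (\<forall>e>0. \<exists>x z. (x, z) \<in> ?G \<and> hnorm H (u \<ominus> x) < e \<and> hnorm H (y \<ominus> z) < e)" for u y
  have cl_mem: "u \<in> carrier H" "y \<in> carrier H" if "cl u y" for u y
    using that by (auto simp: cl_def)
  have cl_approx: "\<exists>x z. (x, z) \<in> ?G \<and> hnorm H (u \<ominus> x) < e \<and> hnorm H (y \<ominus> z) < e"
    if "cl u y" "e > 0" for u y e
    using that by (auto simp: cl_def)
  have cl_base: "cl x y" if "(x, y) \<in> ?G" for x y
  proof -
    have "hnorm H (x \<ominus> x) = 0" "hnorm H (y \<ominus> y) = 0"
      using mem[OF that] by (simp_all add: a_minus_def M.r_neg)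
    then show ?thesis
      unfolding cl_def using that mem[OF that]
      by (intro conjI allI impI exI[of _ x] exI[of _ y]) auto
  qed
  have cl_add: "cl (u \<oplus> u') (y \<oplus> y')" if "cl u y" "cl u' y'" for u y u' y'
    unfolding cl_def
  proof (intro conjI allI impI)
    fix e :: real assume "e > 0"
    then have "e / 2 > 0" by simp
    then obtain x z x' z' where
      G: "(x, z) \<in> ?G" "(x', z') \<in> ?G" and
      less: "hnorm H (u \<ominus> x) < e / 2" "hnorm H (y \<ominus> z) < e / 2"
        "hnorm H (u' \<ominus> x') < e / 2" "hnorm H (y' \<ominus> z') < e / 2"
      using cl_approx[OF \<open>cl u y\<close>, of "e / 2"] cl_approx[OF \<open>cl u' y'\<close>, of "e / 2"] by metis
    have "hnorm H ((u \<oplus> u') \<ominus> (x \<oplus> x')) < e" "hnorm H ((y \<oplus> y') \<ominus> (z \<oplus> z')) < e"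
      using hnorm_add_diff_le[of u u' x x'] hnorm_add_diff_le[of y y' z z'] less
        mem[OF G(1)] mem[OF G(2)] cl_mem[OF that(1)] cl_mem[OF that(2)] by auto
    then show "\<exists>x z. (x, z) \<in> ?G \<and> hnorm H ((u \<oplus> u') \<ominus> x) < e \<and> hnorm H ((y \<oplus> y') \<ominus> z) < e"
      using span_graph.add[OF G] by blast
  qed (use cl_mem that in auto)
  have cl_smult: "cl (a \<odot> u) (a \<odot> y)" if "cl u y" for a u y
    unfolding cl_def
  proof (intro conjI allI impI)
    fix e :: real assume e: "e > 0"
    \<comment> \<open>\<open>cmod a + 1\<close> instead of \<open>cmod a\<close>, as \<open>a\<close> may be zero\<close>
    have pos: "cmod a + 1 > 0" by (simp add: add_nonneg_pos)
    then have "e / (cmod a + 1) > 0" using e by simp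
    then obtain x z where
      G: "(x, z) \<in> ?G" and
      less: "hnorm H (u \<ominus> x) < e / (cmod a + 1)" "hnorm H (y \<ominus> z) < e / (cmod a + 1)"
      using cl_approx[OF \<open>cl u y\<close>] by metis
    have *: "cmod a * h < e" if "h < e / (cmod a + 1)" "h \<ge> 0" for h
    proof -
      have "cmod a * h \<le> (cmod a + 1) * h" using that by (intro mult_right_mono) auto
      also have "\<dots> < e" using that pos by (simp add: pos_less_divide_eq mult.commute)
      finally show ?thesis .
    qed
    have "hnorm H (a \<odot> u \<ominus> a \<odot> x) < e" "hnorm H (a \<odot> y \<ominus> a \<odot> z) < e"
      using *[OF less(1)] *[OF less(2)] mem[OF G] cl_mem[OF that]
      by (simp_all add: hnorm_smult_diff)
    then show "\<exists>x z. (x, z) \<in> ?G \<and> hnorm H (a \<odot> u \<ominus> x) < e \<and> hnorm H (a \<odot> y \<ominus> z) < e"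
      using span_graph.smult[OF G] by blast
  qed (use cl_mem that in auto)
  have cl_contr: "hnorm H y \<le> hnorm H u" if "cl u y" for u y
  proof (rule le_all_eps)
    fix e :: real assume "e > 0"
    then obtain x z where
      G: "(x, z) \<in> ?G" and less: "hnorm H (u \<ominus> x) < e" "hnorm H (y \<ominus> z) < e"
      using cl_approx[OF \<open>cl u y\<close>] by metis
    have "hnorm H y \<le> hnorm H z + hnorm H (y \<ominus> z)"
      using mem[OF G] cl_mem[OF that] by (simp add: hnorm_le_diff)
    also have "hnorm H z \<le> hnorm H x" using contr[OF G] .
    also have "hnorm H x \<le> hnorm H u + hnorm H (u \<ominus> x)"
      using mem[OF G] cl_mem[OF that] by (metis hnorm_le_diff hnorm_minus_commute)
    finally show "hnorm H y \<le> hnorm H u + 2 * e" using less by simp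
  qed
  \<comment> \<open>the difference of two candidates is a value at the zero vector\<close>
  have cl_unique: "y = y'" if "cl u y" "cl u y'" for u y y'
  proof -
    have "cl (u \<oplus> (-1) \<odot> u) (y \<oplus> (-1) \<odot> y')" using that by (intro cl_add cl_smult)
    from cl_contr[OF this] have "hnorm H (y \<ominus> y') \<le> 0"
      using cl_mem[OF that(1)] cl_mem[OF that(2)]
      by (simp add: a_minus_def M.r_neg flip: minus_eq_smult)
    then have "hnorm H (y \<ominus> y') = 0"
      using cl_mem[OF that(1)] cl_mem[OF that(2)] by (simp add: antisym)
    then show ?thesis
      using hnorm_eq_zeroD[of "y \<ominus> y'"] cl_mem[OF that(1)] cl_mem[OF that(2)]
      by (simp add: diff_eq_zero_iff)
  qed
  have cl_total: "\<exists>y. cl u y" if u: "u \<in> carrier H" for u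
  proof -
    have "\<exists>x z. (x, z) \<in> ?G \<and> hnorm H (u \<ominus> x) < e" if "e > 0" for e
    proof -
      obtain x where "x \<in> hspan H (v ` I)" "hnorm H (u \<ominus> x) < e"
        using total u \<open>e > 0\<close> unfolding total_in_def by blast
      then show ?thesis using hspan_subset_Domain_span_graph[OF v, of w] by blast
    qed
    then have "\<exists>x z. (x, z) \<in> ?G \<and> hnorm H (u \<ominus> x) < inverse (real (Suc n))" for n
      by simp
    then obtain X Z where XZ: "\<And>n. (X n, Z n) \<in> ?G"
      and X: "\<And>n. hnorm H (u \<ominus> X n) < inverse (real (Suc n))"
      by metis
    note m = mem[OF XZ]
    have dist: "hnorm H (Z i \<ominus> Z j) < inverse (real (Suc i)) + inverse (real (Suc j))" for i j
    proof -
      have "(X i \<oplus> (-1) \<odot> X j, Z i \<oplus> (-1) \<odot> Z j) \<in> ?G"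
        by (intro span_graph.add span_graph.smult XZ)
      from contr[OF this] have "hnorm H (Z i \<ominus> Z j) \<le> hnorm H (X i \<ominus> X j)"
        using m by (simp add: a_minus_def flip: minus_eq_smult)
      also have "\<dots> \<le> hnorm H (X i \<ominus> u) + hnorm H (u \<ominus> X j)"
        using m u by (simp add: hnorm_diff_triangle)
      also have "hnorm H (X i \<ominus> u) = hnorm H (u \<ominus> X i)"
        using m u by (simp add: hnorm_minus_commute)
      finally show ?thesis using X[of i] X[of j] by linarith
    qed
    have "\<exists>y\<in>carrier H. (\<lambda>n. hnorm H (Z n \<ominus> y)) \<longlonglongrightarrow> 0"
    proof (rule complete)
      show "\<forall>e>0. \<exists>N. \<forall>i\<ge>N. \<forall>j\<ge>N. hnorm H (Z i \<ominus> Z j) < e"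
      proof (intro allI impI)
        fix e :: real assume "e > 0"
        then obtain N where N: "inverse (real (Suc N)) < e / 2"
          using reals_Archimedean[of "e / 2"] by auto
        have "inverse (real (Suc i)) \<le> inverse (real (Suc N))" if "i \<ge> N" for i
          using that by (intro le_imp_inverse_le) auto
        then have "hnorm H (Z i \<ominus> Z j) < e" if "i \<ge> N" "j \<ge> N" for i j
          using dist[of i j] N that by (smt (verit) field_sum_of_halves)
        then show "\<exists>N. \<forall>i\<ge>N. \<forall>j\<ge>N. hnorm H (Z i \<ominus> Z j) < e" by blast
      qed
    qed (use m in auto)
    then obtain y where y: "y \<in> carrier H" "(\<lambda>n. hnorm H (Z n \<ominus> y)) \<longlonglongrightarrow> 0" by blast
    have "cl u y"
      unfolding cl_def
    proof (intro conjI allI impI)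
      fix e :: real assume e: "e > 0"
      have "\<forall>\<^sub>F n in sequentially. hnorm H (Z n \<ominus> y) < e"
        using y(2) e by (rule order_tendstoD(2))
      moreover have "\<forall>\<^sub>F n in sequentially. inverse (real (Suc n)) < e"
        using LIMSEQ_inverse_real_of_nat e by (rule order_tendstoD(2))
      ultimately have "\<forall>\<^sub>F n in sequentially. hnorm H (Z n \<ominus> y) < e \<and> inverse (real (Suc n)) < e"
        by (rule eventually_conj)
      then obtain n where n: "hnorm H (Z n \<ominus> y) < e" "inverse (real (Suc n)) < e"
        using eventually_happens'[OF sequentially_bot] by blast
      have "hnorm H (u \<ominus> X n) < e" "hnorm H (y \<ominus> Z n) < e"
        using n X[of n] hnorm_minus_commute[OF y(1) m(2)] by auto
      then show "\<exists>x z. (x, z) \<in> ?G \<and> hnorm H (u \<ominus> x) < e \<and> hnorm H (y \<ominus> z) < e"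
        using XZ by blast
    qed (use u y in auto)
    then show ?thesis by blast
  qed
  define A where "A = (\<lambda>u\<in>carrier H. THE y. cl u y)"
  have cl_A: "cl u (A u)" if "u \<in> carrier H" for u
    unfolding A_def using that cl_total[OF that] cl_unique by (auto intro: theI)
  have A_eq: "A u = y" if "cl u y" for u y
    using cl_A[OF cl_mem(1)[OF that]] that by (rule cl_unique)
  have "A \<in> bounded_ops H"
  proof (rule bounded_opsI[where c = 1])
    show "A \<in> extensional (carrier H)" by (simp add: A_def)
    show "A (u \<oplus> v) = A u \<oplus> A v" if "u \<in> carrier H" "v \<in> carrier H" for u v
      using that by (intro A_eq cl_add cl_A)
    show "A (a \<odot> u) = a \<odot> A u" if "u \<in> carrier H" for a u
      using that by (intro A_eq cl_smult cl_A)
    show "hnorm H (A u) \<le> 1 * hnorm H u" if "u \<in> carrier H" for u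
      using cl_contr[OF cl_A[OF that]] by simp
  qed (use cl_A cl_mem in blast)
  moreover have "\<forall>i\<in>I. A (v i) = w i"
    by (auto intro!: A_eq cl_base span_graph.base)
  ultimately show ?thesis by blast
qed

text \<open>
  With \<open>s = 1\<close> and \<open>t = 0\<close> the hypothesis on the inner products says that the operator is an
  orthogonal projection, with \<open>s = 0\<close> and \<open>t = 1\<close> that it is an isometry. By Cauchy-Schwarz
  the identity, once extended to the span, makes the operator a contraction.
\<close>

theorem bounded_op_exists:
  assumes total: "total_in H (v ` I)" and w: "w ` I \<subseteq> carrier H"
    and form: "\<And>i j. \<lbrakk>i \<in> I; j \<in> I\<rbrakk>
      \<Longrightarrow> cinner H (w i) (w j) = s * cinner H (w i) (v j) + t * cinner H (v i) (v j)"
    and st: "cmod s + cmod t \<le> 1"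
  shows "\<exists>A\<in>bounded_ops H. \<forall>i\<in>I. A (v i) = w i"
  using total w
proof (rule contraction_extends)
  fix x y assume xy: "(x, y) \<in> span_graph H I v w"
  have v: "v ` I \<subseteq> carrier H" using total by (simp add: total_in_def)
  note m = span_graph_mem[OF xy v w]
  let ?x = "hnorm H x" and ?y = "hnorm H y"
  show "?y \<le> ?x"
  proof (rule ccontr)
    assume "\<not> ?y \<le> ?x"
    then have less: "?x < ?y" by simp
    then have pos: "0 < ?y" using hnorm_nonneg[OF m(1)] by linarith
    have eq: "cinner H y y = s * cinner H y x + t * cinner H x x"
      using v w form xy xy by (rule span_graph_form)
    have "?y\<^sup>2 = cmod (cinner H y y)"
      using m by (simp add: cinner_self norm_power)
    also have "\<dots> \<le> cmod s * cmod (cinner H y x) + cmod t * cmod (cinner H x x)"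
      unfolding eq norm_mult[symmetric] by (rule norm_triangle_ineq)
    also have "\<dots> \<le> cmod s * (?y * ?x) + cmod t * (?x * ?x)"
      using m cauchy_schwarz[of y x] cauchy_schwarz[of x x]
      by (intro add_mono mult_left_mono) auto
    also have "\<dots> \<le> cmod s * (?y * ?x) + cmod t * (?y * ?x)"
      using less m by (intro add_mono mult_left_mono mult_right_mono) auto
    also have "\<dots> = (cmod s + cmod t) * (?y * ?x)" by (simp add: algebra_simps)
    also have "\<dots> \<le> 1 * (?y * ?x)" using st m by (intro mult_right_mono) auto
    also have "\<dots> < ?y\<^sup>2" using less pos by (simp add: power2_eq_square)
    finally show False by simp
  qed
qed

end

section \<open>Orthonormal bases and traces\<close>

context hilbert_space
begin

text \<open>
  A partial sum of the squared coefficients misses the squared norm of the vector by the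
  squared norm of the residual \<open>r\<close>, and no element of the span of the same basis vectors is
  closer to the vector than the partial expansion.
\<close>

lemma parseval:
  assumes E: "orthonormal_basis H E" and u: "u \<in> carrier H"
  shows "((\<lambda>e. (cmod (cinner H e u))\<^sup>2) has_sum (hnorm H u)\<^sup>2) E"
proof -
  have total: "total_in H E"
    and on: "\<And>e f. \<lbrakk>e \<in> E; f \<in> E\<rbrakk> \<Longrightarrow> cinner H e f = (if e = f then 1 else 0)"
    using E by (auto simp: orthonormal_basis_def)
  have EH: "E \<subseteq> carrier H" using total by (simp add: total_in_def)
  have key: "0 \<le> (hnorm H u)\<^sup>2 - (\<Sum>e\<in>F'. (cmod (cinner H e u))\<^sup>2) \<and>
      (hnorm H u)\<^sup>2 - (\<Sum>e\<in>F'. (cmod (cinner H e u))\<^sup>2) \<le> (hnorm H (u \<ominus> (\<Oplus>e\<in>F. c e \<odot> e)))\<^sup>2"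
    if F: "finite F" "F \<subseteq> F'" and F': "finite F'" "F' \<subseteq> E" for F F' c
  proof -
    have memF': "\<And>e. e \<in> F' \<Longrightarrow> e \<in> carrier H" and memF: "\<And>e. e \<in> F \<Longrightarrow> e \<in> carrier H"
      using F F' EH by auto
    define p where "p = (\<Oplus>e\<in>F'. cinner H e u \<odot> e)"
    define v where "v = (\<Oplus>e\<in>F. c e \<odot> e)"
    define r where "r = u \<ominus> p"
    have p: "p \<in> carrier H" unfolding p_def using memF' by (intro M.finsum_closed) auto
    have v: "v \<in> carrier H" unfolding v_def using memF by (intro M.finsum_closed) auto
    have r: "r \<in> carrier H" using u p by (simp add: r_def)
    have re: "cinner H r e = 0" if e: "e \<in> F'" for e
    proof -
      have "cinner H e p = (\<Sum>f\<in>F'. cinner H e (cinner H f u \<odot> f))"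
        unfolding p_def using memF' e F' by (intro cinner_finsum) auto
      also have "\<dots> = (\<Sum>f\<in>F'. if e = f then cinner H f u else 0)"
        using memF' e F' by (intro sum.cong) (auto simp: cinner_smult on subset_iff)
      also have "\<dots> = cinner H e u" using e F' by simp
      finally have "cinner H e r = 0"
        unfolding r_def using u p memF'[OF e] by (simp add: cinner_diff)
      then show ?thesis using cinner_commute[OF memF'[OF e] r] by simp
    qed
    have rp: "cinner H r p = 0"
      unfolding p_def using memF' F' r re
      by (subst cinner_finsum) (auto simp: cinner_smult intro!: sum.neutral)
    have rv: "cinner H r v = 0"
      unfolding v_def using memF F F' r re
      by (subst cinner_finsum) (auto simp: cinner_smult intro!: sum.neutral)
    have "cinner H p u = (\<Sum>e\<in>F'. cinner H (cinner H e u \<odot> e) u)"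
      unfolding p_def using memF' u F' by (intro cinner_finsum_left) auto
    also have "\<dots> = (\<Sum>e\<in>F'. complex_of_real ((cmod (cinner H e u))\<^sup>2))"
      using memF' u by (intro sum.cong) (auto simp: cinner_smult_left complex_norm_square
          simp del: of_real_power)
    finally have pu: "cinner H p u = complex_of_real (\<Sum>e\<in>F'. (cmod (cinner H e u))\<^sup>2)" by simp
    have "cinner H r r = cinner H r u - cinner H r p"
      using r u p by (subst (2) r_def) (simp add: cinner_diff)
    also have "\<dots> = cinner H u u - cinner H p u"
      unfolding rp using u p by (simp add: r_def cinner_diff)
    finally have "complex_of_real ((hnorm H r)\<^sup>2)
        = complex_of_real ((hnorm H u)\<^sup>2 - (\<Sum>e\<in>F'. (cmod (cinner H e u))\<^sup>2))"
      using r u pu by (simp add: cinner_self)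
    then have rr: "(hnorm H r)\<^sup>2 = (hnorm H u)\<^sup>2 - (\<Sum>e\<in>F'. (cmod (cinner H e u))\<^sup>2)"
      by (simp only: of_real_eq_iff)
    \<comment> \<open>\<open>v\<close> lies in the span of \<open>F \<subseteq> F'\<close>, so it is orthogonal to \<open>r\<close>\<close>
    have "cinner H r r = cinner H r (u \<ominus> v)"
      using r u p v rp rv by (subst (2) r_def) (simp add: cinner_diff)
    then have "(hnorm H r)\<^sup>2 = cmod (cinner H r (u \<ominus> v))"
      using r by (metis cinner_self norm_of_real abs_of_nonneg zero_le_power2)
    also have "\<dots> \<le> hnorm H r * hnorm H (u \<ominus> v)"
      using r u v by (simp add: cauchy_schwarz)
    finally have "hnorm H r \<le> hnorm H (u \<ominus> v)"
      using r u v by (cases "hnorm H r = 0") (auto simp: power2_eq_square less_le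
          dest: mult_left_le_imp_le)
    then have "(hnorm H r)\<^sup>2 \<le> (hnorm H (u \<ominus> v))\<^sup>2"
      using r by (intro power_mono) auto
    then show ?thesis unfolding rr[symmetric] v_def by simp
  qed
  show ?thesis
    unfolding has_sum_def tendsto_iff
  proof (intro allI impI)
    fix \<epsilon> :: real assume "\<epsilon> > 0"
    then have "sqrt \<epsilon> > 0" by simp
    then obtain v where "v \<in> hspan H E" and v: "hnorm H (u \<ominus> v) < sqrt \<epsilon>"
      using total u unfolding total_in_def by blast
    then obtain F c where F: "finite F" "F \<subseteq> E" and v_eq: "v = (\<Oplus>e\<in>F. c e \<odot> e)"
      unfolding hspan_def by blast
    have "v \<in> carrier H" unfolding v_eq using F EH by (intro M.finsum_closed) auto
    then have less: "(hnorm H (u \<ominus> v))\<^sup>2 < \<epsilon>"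
      using v u \<open>\<epsilon> > 0\<close> power_strict_mono[of "hnorm H (u \<ominus> v)" "sqrt \<epsilon>" 2] by simp
    show "\<forall>\<^sub>F F' in finite_subsets_at_top E.
        dist (\<Sum>e\<in>F'. (cmod (cinner H e u))\<^sup>2) ((hnorm H u)\<^sup>2) < \<epsilon>"
      unfolding eventually_finite_subsets_at_top
    proof (intro exI[of _ F] conjI allI impI)
      fix F' assume "finite F' \<and> F \<subseteq> F' \<and> F' \<subseteq> E"
      then have F': "F \<subseteq> F'" "finite F'" "F' \<subseteq> E" by auto
      show "dist (\<Sum>e\<in>F'. (cmod (cinner H e u))\<^sup>2) ((hnorm H u)\<^sup>2) < \<epsilon>"
        using key[OF F(1) F', of c] less by (simp add: v_eq dist_real_def)
    qed (use F in auto)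
  qed
qed

lemma pythagoras:
  assumes F: "finite F" and f: "\<And>i. i \<in> F \<Longrightarrow> f i \<in> carrier H"
    and orth: "\<And>i j. \<lbrakk>i \<in> F; j \<in> F; i \<noteq> j\<rbrakk> \<Longrightarrow> cinner H (f i) (f j) = 0"
  shows "(hnorm H (\<Oplus>i\<in>F. f i))\<^sup>2 = (\<Sum>i\<in>F. (hnorm H (f i))\<^sup>2)"
proof -
  have fF: "f \<in> F \<rightarrow> carrier H" using f by auto
  have "cinner H (\<Oplus>i\<in>F. f i) (\<Oplus>i\<in>F. f i) = (\<Sum>i\<in>F. cinner H (\<Oplus>i\<in>F. f i) (f i))"
    using F fF by (intro cinner_finsum) (auto intro!: M.finsum_closed)
  also have "\<dots> = (\<Sum>i\<in>F. \<Sum>j\<in>F. cinner H (f j) (f i))"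
    using F fF f by (intro sum.cong cinner_finsum_left) auto
  also have "\<dots> = (\<Sum>i\<in>F. \<Sum>j\<in>F. if j = i then cinner H (f i) (f i) else 0)"
    using orth by (intro sum.cong) auto
  also have "\<dots> = (\<Sum>i\<in>F. cinner H (f i) (f i))" using F by simp
  also have "\<dots> = complex_of_real (\<Sum>i\<in>F. (hnorm H (f i))\<^sup>2)"
    using f by (simp add: cinner_self)
  also have "cinner H (\<Oplus>i\<in>F. f i) (\<Oplus>i\<in>F. f i) = complex_of_real ((hnorm H (\<Oplus>i\<in>F. f i))\<^sup>2)"
    using fF by (intro cinner_self M.finsum_closed) auto
  finally show ?thesis by (simp only: of_real_eq_iff)
qed

end

section \<open>Traces along commuting families of self-adjoint operators\<close>

lemma has_sum_finite_sum:
  fixes f :: "'i \<Rightarrow> 'k \<Rightarrow> complex"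
  assumes "\<And>i. i \<in> F \<Longrightarrow> (f i has_sum s i) E"
  shows "((\<lambda>e. \<Sum>i\<in>F. f i e) has_sum (\<Sum>i\<in>F. s i)) E"
proof -
  have "sum (\<lambda>e. \<Sum>i\<in>F. f i e) = (\<lambda>X. \<Sum>i\<in>F. sum (f i) X)"
    by (rule ext) (rule sum.swap)
  then show ?thesis
    using assms unfolding has_sum_def by (auto intro: tendsto_sum)
qed

text \<open>
  Having an adjoint is all that the main induction needs to know about an operator: it implies
  linearity (\<open>adjoint_pair_finsum\<close>), it is stable under composition, and it lets an operator
  be moved from one argument of the inner product to the other.
\<close>

definition adjoint_pair :: "'a hspace \<Rightarrow> ('a \<Rightarrow> 'a) \<Rightarrow> ('a \<Rightarrow> 'a) \<Rightarrow> bool" where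
  "adjoint_pair H M M' \<longleftrightarrow>
     (\<forall>u\<in>carrier H. M u \<in> carrier H \<and> M' u \<in> carrier H) \<and>
     (\<forall>u\<in>carrier H. \<forall>v\<in>carrier H. cinner H (M u) v = cinner H u (M' v))"

context hilbert_space
begin

lemma adjoint_pairD:
  assumes "adjoint_pair H M M'" and u: "u \<in> carrier H"
  shows "M u \<in> carrier H" "M' u \<in> carrier H"
    and "v \<in> carrier H \<Longrightarrow> cinner H (M u) v = cinner H u (M' v)"
    and "v \<in> carrier H \<Longrightarrow> cinner H u (M v) = cinner H (M' u) v"
proof -
  show M: "M u \<in> carrier H" "M' u \<in> carrier H"
    and "v \<in> carrier H \<Longrightarrow> cinner H (M u) v = cinner H u (M' v)"
    using assms by (auto simp: adjoint_pair_def)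
  assume v: "v \<in> carrier H"
  then have "M v \<in> carrier H" "cinner H (M v) u = cinner H v (M' u)"
    using assms by (auto simp: adjoint_pair_def)
  then show "cinner H u (M v) = cinner H (M' u) v"
    using cinner_commute[of "M v" u] cinner_commute[of v "M' u"] M u v by simp
qed

lemma adjoint_pair_finsum:
  assumes adj: "adjoint_pair H M M'" and F: "finite F" and f: "\<And>i. i \<in> F \<Longrightarrow> f i \<in> carrier H"
  shows "M (\<Oplus>i\<in>F. f i) = (\<Oplus>i\<in>F. M (f i))"
proof (rule vector_eqI)
  have s: "(\<Oplus>i\<in>F. f i) \<in> carrier H" using f by (intro M.finsum_closed) auto
  then show "M (\<Oplus>i\<in>F. f i) \<in> carrier H" by (rule adjoint_pairD(1)[OF adj])
  show "(\<Oplus>i\<in>F. M (f i)) \<in> carrier H"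
    using f adjoint_pairD(1)[OF adj] by (intro M.finsum_closed) auto
  fix w assume w: "w \<in> carrier H"
  have "cinner H w (M (\<Oplus>i\<in>F. f i)) = cinner H (M' w) (\<Oplus>i\<in>F. f i)"
    using adjoint_pairD(4)[OF adj w s] .
  also have "\<dots> = (\<Sum>i\<in>F. cinner H (M' w) (f i))"
    using F f adjoint_pairD(2)[OF adj w] by (intro cinner_finsum) auto
  also have "\<dots> = (\<Sum>i\<in>F. cinner H w (M (f i)))"
    using f by (intro sum.cong refl adjoint_pairD(4)[OF adj w, symmetric])
  also have "\<dots> = cinner H w (\<Oplus>i\<in>F. M (f i))"
    using F w f adjoint_pairD(1)[OF adj] by (intro cinner_finsum[symmetric]) auto
  finally show "cinner H w (M (\<Oplus>i\<in>F. f i)) = cinner H w (\<Oplus>i\<in>F. M (f i))" .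
qed

lemma adjoint_pair_comp:
  assumes M: "adjoint_pair H M M'" and N: "adjoint_pair H N N'"
  shows "adjoint_pair H (\<lambda>u. M (N u)) (\<lambda>u. N' (M' u))"
  using adjoint_pairD(1-3)[OF M] adjoint_pairD(1-3)[OF N] unfolding adjoint_pair_def by simp

lemma bounded_op_zero: "A \<in> bounded_ops H \<Longrightarrow> A \<zero> = \<zero>"
  using bounded_opsD(3)[of A "\<zero>" 0] bounded_opsD(1)[of A "\<zero>"] by (simp add: smult_zero_left)

lemma adjoint_pair_totalI:
  assumes total: "total_in H E" and A: "A \<in> bounded_ops H" and B: "B \<in> bounded_ops H"
    and eq: "\<And>e f. \<lbrakk>e \<in> E; f \<in> E\<rbrakk> \<Longrightarrow> cinner H (A e) f = cinner H e (B f)"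
  shows "adjoint_pair H A B"
  unfolding adjoint_pair_def
proof (intro conjI ballI)
  fix u v assume uv: "u \<in> carrier H" "v \<in> carrier H"
  have E: "E \<subseteq> carrier H" using total by (simp add: total_in_def)
  have "cinner H (A u) ((\<lambda>u\<in>carrier H. u) v) = cinner H ((\<lambda>u\<in>carrier H. u) u) (B v)"
    using total A bounded_ops_id bounded_ops_id B _ uv
    by (rule total_cinner_eqI) (use E eq in auto)
  then show "cinner H (A u) v = cinner H u (B v)" using uv by simp
qed (use A B bounded_opsD(1) in auto)

lemma bounded_ops_commute_totalI:
  assumes total: "total_in H E" and A: "A \<in> bounded_ops H" and B: "B \<in> bounded_ops H"
    and eq: "\<And>e. e \<in> E \<Longrightarrow> A (B e) = B (A e)" and u: "u \<in> carrier H"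
  shows "A (B u) = B (A u)"
proof -
  have E: "E \<subseteq> carrier H" using total by (simp add: total_in_def)
  have "(\<lambda>u\<in>carrier H. A (B u)) = (\<lambda>u\<in>carrier H. B (A u))"
    by (rule bounded_ops_eqI[OF total bounded_ops_comp[OF A B] bounded_ops_comp[OF B A]])
      (use E eq in auto)
  from fun_cong[OF this, of u] show ?thesis using u by simp
qed

lemma adjoint_op_eqI:
  assumes B: "B \<in> bounded_ops H" and adj: "adjoint_pair H B A"
  shows "adjoint_op H A = B"
  unfolding adjoint_op_def
proof (rule the_equality)
  show "B \<in> bounded_ops H \<and> (\<forall>u\<in>carrier H. \<forall>v\<in>carrier H. cinner H (B u) v = cinner H u (A v))"
    using B adj by (simp add: adjoint_pair_def)
  fix B'
  assume B': "B' \<in> bounded_ops H \<and>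
    (\<forall>u\<in>carrier H. \<forall>v\<in>carrier H. cinner H (B' u) v = cinner H u (A v))"
  show "B' = B"
  proof (rule extensionalityI)
    show "B' \<in> extensional (carrier H)" "B \<in> extensional (carrier H)"
      using B B' by (auto simp: bounded_maps_def PiE_def)
    fix u assume u: "u \<in> carrier H"
    show "B' u = B u"
    proof (rule vector_eqI)
      show mem: "B' u \<in> carrier H" "B u \<in> carrier H" using u B B' bounded_opsD(1) by auto
      fix w assume w: "w \<in> carrier H"
      have "cinner H (B' u) w = cinner H (B u) w"
        using B' u w adjoint_pairD(3)[OF adj u w] by simp
      then show "cinner H w (B' u) = cinner H w (B u)"
        using cinner_commute[OF mem(1) w] cinner_commute[OF mem(2) w] by simp
    qed
  qed
qed

text \<open>
  The induction is over \<open>n\<close>, for all \<open>M\<close> that commute with the operators of the earlier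
  steps. In the step, \<open>M\<close> is replaced by the operators \<open>M C\<^sub>n\<^sup>\<epsilon>\<close>; the trace is then a sum of
  squared norms over \<open>\<epsilon>\<close>, and so is the squared norm of the vector, by Pythagoras: as \<open>M\<close>
  commutes with every \<open>C\<^sub>n\<^sup>\<epsilon>\<close>, the summands lie in the ranges of these operators, which are
  mutually orthogonal.
\<close>

lemma trace_conjugated_walk:
  fixes C :: "nat \<Rightarrow> 'g::ab_group_add \<Rightarrow> 'a \<Rightarrow> 'a" and \<omega> :: "nat \<Rightarrow> 'g \<Rightarrow> 'a \<Rightarrow> 'a"
  assumes E: "orthonormal_basis H E" and fin: "finite S"
    and C_adj: "\<And>n \<epsilon>. \<epsilon> \<in> S \<Longrightarrow> adjoint_pair H (C n \<epsilon>) (C n \<epsilon>)"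
    and C_orth: "\<And>n \<epsilon> \<epsilon>' u v. \<lbrakk>\<epsilon> \<in> S; \<epsilon>' \<in> S; \<epsilon> \<noteq> \<epsilon>'; u \<in> carrier H; v \<in> carrier H\<rbrakk>
      \<Longrightarrow> cinner H (C n \<epsilon> u) (C n \<epsilon>' v) = 0"
    and C_comm: "\<And>m n \<epsilon> \<epsilon>' u. \<lbrakk>m < n; \<epsilon> \<in> S; \<epsilon>' \<in> S; u \<in> carrier H\<rbrakk>
      \<Longrightarrow> C n \<epsilon> (C m \<epsilon>' u) = C m \<epsilon>' (C n \<epsilon> u)"
    and W_mem: "\<And>n x. W n x \<in> carrier H"
    and W_Suc: "\<And>n x. W (Suc n) x = (\<Oplus>\<epsilon>\<in>S. C n \<epsilon> (W n (x - \<epsilon>)))"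
    and \<omega>_mem: "\<And>n x u. u \<in> carrier H \<Longrightarrow> \<omega> n x u \<in> carrier H"
    and \<omega>_Suc: "\<And>n x u. u \<in> carrier H
      \<Longrightarrow> \<omega> (Suc n) x u = (\<Oplus>\<epsilon>\<in>S. C n \<epsilon> (\<omega> n (x - \<epsilon>) (C n \<epsilon> u)))"
    and \<omega>_0: "\<And>x u. u \<in> carrier H \<Longrightarrow> \<omega> 0 x u = cinner H (W 0 x) u \<odot> W 0 x"
    and M: "adjoint_pair H M M'"
    and M_comm: "\<And>m \<epsilon> u. \<lbrakk>m < n; \<epsilon> \<in> S; u \<in> carrier H\<rbrakk> \<Longrightarrow> M (C m \<epsilon> u) = C m \<epsilon> (M u)"
  shows "((\<lambda>e. cinner H e (M (\<omega> n x (M' e)))) has_sum complex_of_real ((hnorm H (M (W n x)))\<^sup>2)) E"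
  using M M_comm
proof (induction n arbitrary: M M' x)
  case 0
  have EH: "E \<subseteq> carrier H" using E by (auto simp: orthonormal_basis_def total_in_def)
  have "cinner H e (M (\<omega> 0 x (M' e))) = complex_of_real ((cmod (cinner H e (M (W 0 x))))\<^sup>2)"
    if "e \<in> E" for e
  proof -
    have e: "e \<in> carrier H" using that EH by blast
    note a = adjoint_pairD[OF 0(1)]
    have "cinner H e (M (\<omega> 0 x (M' e))) = cinner H (M' e) (\<omega> 0 x (M' e))"
      using e by (intro a(4) \<omega>_mem a(2))
    also have "\<dots> = cinner H (W 0 x) (M' e) * cinner H (M' e) (W 0 x)"
      using a(2)[OF e] W_mem by (simp add: \<omega>_0 cinner_smult)
    also have "\<dots> = cnj (cinner H (M' e) (W 0 x)) * cinner H (M' e) (W 0 x)"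
      by (subst cinner_commute[OF a(2)[OF e] W_mem]) simp
    also have "cinner H (M' e) (W 0 x) = cinner H e (M (W 0 x))"
      using a(4)[OF e W_mem] by simp
    finally show ?thesis by (simp only: complex_norm_square mult.commute)
  qed
  then show ?case
    using has_sum_of_real[OF parseval[OF E adjoint_pairD(1)[OF 0(1) W_mem]]]
    by (simp cong: has_sum_cong)
next
  case (Suc n)
  note a = adjoint_pairD[OF Suc.prems(1)]
  have EH: "E \<subseteq> carrier H" using E by (auto simp: orthonormal_basis_def total_in_def)
  have C_mem: "C k \<epsilon> u \<in> carrier H" if "\<epsilon> \<in> S" "u \<in> carrier H" for k \<epsilon> u
    using adjoint_pairD(1)[OF C_adj] that by blast
  have IH: "((\<lambda>e. cinner H e (M (C n \<epsilon> (\<omega> n (x - \<epsilon>) (C n \<epsilon> (M' e))))))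
      has_sum complex_of_real ((hnorm H (M (C n \<epsilon> (W n (x - \<epsilon>)))))\<^sup>2)) E" if \<epsilon>: "\<epsilon> \<in> S" for \<epsilon>
  proof (rule Suc.IH)
    show "adjoint_pair H (\<lambda>u. M (C n \<epsilon> u)) (\<lambda>u. C n \<epsilon> (M' u))"
      by (rule adjoint_pair_comp[OF Suc.prems(1) C_adj[OF \<epsilon>]])
    show "M (C n \<epsilon> (C m \<epsilon>' u)) = C m \<epsilon>' (M (C n \<epsilon> u))"
      if "m < n" "\<epsilon>' \<in> S" "u \<in> carrier H" for m \<epsilon>' u
      using that \<epsilon> C_comm Suc.prems(2)[of m \<epsilon>' "C n \<epsilon> u"] C_mem by simp
  qed
  have trace: "cinner H e (M (\<omega> (Suc n) x (M' e)))
      = (\<Sum>\<epsilon>\<in>S. cinner H e (M (C n \<epsilon> (\<omega> n (x - \<epsilon>) (C n \<epsilon> (M' e))))))"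
    if "e \<in> E" for e
  proof -
    have e: "e \<in> carrier H" using that EH by blast
    have mem: "C n \<epsilon> (\<omega> n (x - \<epsilon>) (C n \<epsilon> (M' e))) \<in> carrier H" if "\<epsilon> \<in> S" for \<epsilon>
      using that e by (intro C_mem \<omega>_mem a(2))
    have "M (\<omega> (Suc n) x (M' e)) = (\<Oplus>\<epsilon>\<in>S. M (C n \<epsilon> (\<omega> n (x - \<epsilon>) (C n \<epsilon> (M' e)))))"
      unfolding \<omega>_Suc[OF a(2)[OF e]] using fin mem
      by (rule adjoint_pair_finsum[OF Suc.prems(1)])
    then show ?thesis
      using cinner_finsum[OF fin e] mem a(1) by (simp add: Pi_def)
  qed
  have norm: "(hnorm H (M (W (Suc n) x)))\<^sup>2 = (\<Sum>\<epsilon>\<in>S. (hnorm H (M (C n \<epsilon> (W n (x - \<epsilon>)))))\<^sup>2)"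
    unfolding W_Suc
  proof (subst adjoint_pair_finsum[OF Suc.prems(1) fin C_mem[OF _ W_mem]], assumption,
      rule pythagoras[OF fin])
    fix \<epsilon> \<epsilon>' assume "\<epsilon> \<in> S" "\<epsilon>' \<in> S" "\<epsilon> \<noteq> \<epsilon>'"
    then show "cinner H (M (C n \<epsilon> (W n (x - \<epsilon>)))) (M (C n \<epsilon>' (W n (x - \<epsilon>')))) = 0"
      using Suc.prems(2) W_mem C_orth a(1) by simp
  qed (use a(1) C_mem W_mem in blast)
  have "((\<lambda>e. \<Sum>\<epsilon>\<in>S. cinner H e (M (C n \<epsilon> (\<omega> n (x - \<epsilon>) (C n \<epsilon> (M' e))))))
      has_sum (\<Sum>\<epsilon>\<in>S. complex_of_real ((hnorm H (M (C n \<epsilon> (W n (x - \<epsilon>)))))\<^sup>2))) E"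
    using IH by (rule has_sum_finite_sum)
  then show ?case
    unfolding norm of_real_sum by (rule iffD2[OF has_sum_cong, rotated]) (rule trace)
qed

end

section \<open>Transport of structure along a unitary map\<close>

lemma unitary_isomorphismD:
  assumes "unitary_isomorphism T H K"
  shows "u \<in> carrier T \<Longrightarrow> K u \<in> carrier H"
    and "\<lbrakk>u \<in> carrier T; v \<in> carrier T\<rbrakk> \<Longrightarrow> K (u \<oplus>\<^bsub>T\<^esub> v) = K u \<oplus>\<^bsub>H\<^esub> K v"
    and "u \<in> carrier T \<Longrightarrow> K (a \<odot>\<^bsub>T\<^esub> u) = a \<odot>\<^bsub>H\<^esub> K u"
    and "\<lbrakk>u \<in> carrier T; v \<in> carrier T\<rbrakk> \<Longrightarrow> cinner H (K u) (K v) = cinner T u v"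
    and "u \<in> carrier T \<Longrightarrow> inv_into (carrier T) K (K u) = u"
    and "x \<in> carrier H \<Longrightarrow> inv_into (carrier T) K x \<in> carrier T"
    and "x \<in> carrier H \<Longrightarrow> K (inv_into (carrier T) K x) = x"
  using assms
  by (auto simp: unitary_isomorphism_def bounded_maps_def bij_betw_def inv_into_into
      f_inv_into_f)

text \<open>
  All the axioms of a Hilbert space, completeness included, pass from the domain of a
  surjective isometry to its codomain; this spares a direct proof that square integrable
  functions form a complete space. The last hypothesis ties the zero vector of \<open>H\<close> to its
  other operations.
\<close>

lemma hilbert_space_unitary_image:
  assumes T: "hilbert_space T" and K: "unitary_isomorphism T H K"
    and zero: "\<And>u. u \<in> carrier H \<Longrightarrow> 0 \<odot>\<^bsub>H\<^esub> u = \<zero>\<^bsub>H\<^esub>"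
  shows "hilbert_space H"
proof -
  interpret T: hilbert_space T by (rule T)
  note k = unitary_isomorphismD[OF K]
  have ex: "\<exists>u\<in>carrier T. x = K u" if "x \<in> carrier H" for x
    using k(6,7)[OF that] by metis
  have K0: "K \<zero>\<^bsub>T\<^esub> = \<zero>\<^bsub>H\<^esub>"
    using k(3)[of "\<zero>\<^bsub>T\<^esub>" 0] k(1)[of "\<zero>\<^bsub>T\<^esub>"] zero by (simp add: T.smult_zero_left)
  have "abelian_group H"
  proof (rule abelian_groupI)
    fix x y assume "x \<in> carrier H" "y \<in> carrier H"
    then obtain u v where uv: "u \<in> carrier T" "x = K u" "v \<in> carrier T" "y = K v"
      using ex by metis
    then show "x \<oplus>\<^bsub>H\<^esub> y \<in> carrier H" "x \<oplus>\<^bsub>H\<^esub> y = y \<oplus>\<^bsub>H\<^esub> x"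
      using k(1) T.M.a_comm by (simp_all flip: k(2))
  next
    show "\<zero>\<^bsub>H\<^esub> \<in> carrier H" using k(1)[of "\<zero>\<^bsub>T\<^esub>"] K0 by simp
  next
    fix x y z assume "x \<in> carrier H" "y \<in> carrier H" "z \<in> carrier H"
    then obtain u v w where "u \<in> carrier T" "x = K u" "v \<in> carrier T" "y = K v"
        "w \<in> carrier T" "z = K w"
      using ex by metis
    then show "(x \<oplus>\<^bsub>H\<^esub> y) \<oplus>\<^bsub>H\<^esub> z = x \<oplus>\<^bsub>H\<^esub> (y \<oplus>\<^bsub>H\<^esub> z)"
      by (simp add: T.M.a_assoc flip: k(2))
  next
    fix x assume "x \<in> carrier H"
    then obtain u where u: "u \<in> carrier T" "x = K u" using ex by metis
    show "\<zero>\<^bsub>H\<^esub> \<oplus>\<^bsub>H\<^esub> x = x" using u by (simp flip: K0 k(2))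
    have "K (\<ominus>\<^bsub>T\<^esub> u) \<oplus>\<^bsub>H\<^esub> x = \<zero>\<^bsub>H\<^esub>" "K (\<ominus>\<^bsub>T\<^esub> u) \<in> carrier H"
      using u k(1) by (simp_all add: T.M.l_neg K0 flip: k(2))
    then show "\<exists>y\<in>carrier H. y \<oplus>\<^bsub>H\<^esub> x = \<zero>\<^bsub>H\<^esub>" by blast
  qed
  then have "module complex_field H"
  proof (rule moduleI[rotated])
    show "cring complex_field" by (rule T.R.is_cring)
  next
    fix a b x y
    assume "x \<in> carrier H" "y \<in> carrier H"
    then obtain u v where "u \<in> carrier T" "x = K u" "v \<in> carrier T" "y = K v"
      using ex by metis
    then show "a \<odot>\<^bsub>H\<^esub> (x \<oplus>\<^bsub>H\<^esub> y) = a \<odot>\<^bsub>H\<^esub> x \<oplus>\<^bsub>H\<^esub> a \<odot>\<^bsub>H\<^esub> y"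
      using T.smult_r_distr[of a u v] by (simp flip: k(2,3))
  next
    fix a b x
    assume "x \<in> carrier H"
    then obtain u where u: "u \<in> carrier T" "x = K u"
      using ex by metis
    show "a \<odot>\<^bsub>H\<^esub> x \<in> carrier H"
      using u k(1) by (simp flip: k(3))
    show "(a \<oplus>\<^bsub>complex_field\<^esub> b) \<odot>\<^bsub>H\<^esub> x = a \<odot>\<^bsub>H\<^esub> x \<oplus>\<^bsub>H\<^esub> b \<odot>\<^bsub>H\<^esub> x"
      using u T.smult_l_distr[of a b u] by (simp flip: k(2,3))
    show "(a \<otimes>\<^bsub>complex_field\<^esub> b) \<odot>\<^bsub>H\<^esub> x = a \<odot>\<^bsub>H\<^esub> (b \<odot>\<^bsub>H\<^esub> x)"
      using u T.smult_assoc1[of a b u] by (simp flip: k(2,3))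
    show "\<one>\<^bsub>complex_field\<^esub> \<odot>\<^bsub>H\<^esub> x = x"
      using u T.smult_one[of u] by (simp flip: k(2,3))
  qed
  then interpret H: module complex_field H .
  have K_minus: "K u \<ominus>\<^bsub>H\<^esub> K v = K (u \<ominus>\<^bsub>T\<^esub> v)" if "u \<in> carrier T" "v \<in> carrier T" for u v
  proof -
    have "K (\<ominus>\<^bsub>T\<^esub> v) \<oplus>\<^bsub>H\<^esub> K v = \<zero>\<^bsub>H\<^esub>"
      using that by (simp add: T.M.l_neg K0 flip: k(2))
    then have "\<ominus>\<^bsub>H\<^esub> K v = K (\<ominus>\<^bsub>T\<^esub> v)"
      using that k(1) by (intro H.M.minus_equality) auto
    then show ?thesis using that by (simp add: a_minus_def k(2))
  qed
  have K_norm: "hnorm H (K u) = hnorm T u" if "u \<in> carrier T" for u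
    using that by (simp add: hnorm_def k(4))
  show ?thesis
  proof
    fix x y z assume "x \<in> carrier H" "y \<in> carrier H" "z \<in> carrier H"
    then obtain u v w where "u \<in> carrier T" "x = K u" "v \<in> carrier T" "y = K v"
        "w \<in> carrier T" "z = K w"
      using ex by metis
    then show "cinner H x (y \<oplus>\<^bsub>H\<^esub> z) = cinner H x y + cinner H x z"
      by (simp add: k(4) T.cinner_add flip: k(2))
  next
    fix a x y assume "x \<in> carrier H" "y \<in> carrier H"
    then obtain u v where uv: "u \<in> carrier T" "x = K u" "v \<in> carrier T" "y = K v"
      using ex by metis
    then show "cinner H x (a \<odot>\<^bsub>H\<^esub> y) = a * cinner H x y"
      by (simp add: k(4) T.cinner_smult flip: k(3))
    show "cinner H y x = cnj (cinner H x y)"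
      unfolding uv k(4)[OF uv(1,3)] k(4)[OF uv(3,1)] by (rule T.cinner_commute[OF uv(1,3)])
  next
    fix x assume "x \<in> carrier H"
    then obtain u where u: "u \<in> carrier T" "x = K u" using ex by metis
    then show "0 \<le> Re (cinner H x x)" by (simp add: k(4) T.cinner_nonneg)
    show "x = \<zero>\<^bsub>H\<^esub>" if "cinner H x x = 0"
      using that u T.cinner_definite[of u] K0 by (simp add: k(4))
  next
    fix X :: "nat \<Rightarrow> 'b"
    assume X: "range X \<subseteq> carrier H"
      and cauchy: "\<forall>e>0. \<exists>N. \<forall>m\<ge>N. \<forall>n\<ge>N. hnorm H (X m \<ominus>\<^bsub>H\<^esub> X n) < e"
    define Y where "Y n = inv_into (carrier T) K (X n)" for n
    have Y: "Y n \<in> carrier T" "X n = K (Y n)" for n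
      using X k(6,7)[of "X n"] by (auto simp: Y_def range_subsetD)
    have "\<exists>u\<in>carrier T. (\<lambda>n. hnorm T (Y n \<ominus>\<^bsub>T\<^esub> u)) \<longlonglongrightarrow> 0"
    proof (rule T.complete)
      show "\<forall>e>0. \<exists>N. \<forall>m\<ge>N. \<forall>n\<ge>N. hnorm T (Y m \<ominus>\<^bsub>T\<^esub> Y n) < e"
        using cauchy Y(1) by (simp add: Y(2) K_minus K_norm)
    qed (use Y in auto)
    then obtain u where u: "u \<in> carrier T" "(\<lambda>n. hnorm T (Y n \<ominus>\<^bsub>T\<^esub> u)) \<longlonglongrightarrow> 0" by blast
    then have "(\<lambda>n. hnorm H (X n \<ominus>\<^bsub>H\<^esub> K u)) \<longlonglongrightarrow> 0"
      using Y(1) by (simp add: Y(2) K_minus K_norm)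
    then show "\<exists>x\<in>carrier H. (\<lambda>n. hnorm H (X n \<ominus>\<^bsub>H\<^esub> x)) \<longlonglongrightarrow> 0"
      using u(1) k(1) by blast
  qed
qed

section \<open>Tensor powers of self-adjoint operators\<close>

text \<open>
  The hypothesis \<open>form\<close> holds for \<open>s j\<close> times an orthogonal projection. The inner product of
  elementary tensors is a product, so the identity holds for the tensor product of the
  operators as well, with the product of the scalars, and \<open>bounded_op_exists\<close> applies.
\<close>

lemma tensor_power_op_bounded:
  fixes \<tau> :: "('d::finite \<Rightarrow> 'a) \<Rightarrow> 'b"
  assumes tensor: "tensor_power H T \<tau>"
    and B: "\<And>j u. u \<in> carrier H \<Longrightarrow> B j u \<in> carrier H"
    and form: "\<And>j u v. \<lbrakk>u \<in> carrier H; v \<in> carrier H\<rbrakk>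
      \<Longrightarrow> cinner H (B j u) (B j v) = s j * cinner H (B j u) v"
    and s: "\<And>j. cmod (s j) \<le> 1"
  shows "tensor_power_op H T \<tau> B \<in> bounded_ops T"
    and "range u \<subseteq> carrier H \<Longrightarrow> tensor_power_op H T \<tau> B (\<tau> u) = \<tau> (\<lambda>j. B j (u j))"
proof -
  interpret T: hilbert_space T using tensor by (simp add: tensor_power_def)
  let ?I = "{u. range u \<subseteq> carrier H}"
  have total: "total_in T (\<tau> ` ?I)"
    and inner: "\<And>u v. \<lbrakk>range u \<subseteq> carrier H; range v \<subseteq> carrier H\<rbrakk>
      \<Longrightarrow> cinner T (\<tau> u) (\<tau> v) = (\<Prod>j\<in>UNIV. cinner H (u j) (v j))"
    using tensor by (auto simp: tensor_power_def)
  have mem: "\<tau> u \<in> carrier T" if "range u \<subseteq> carrier H" for u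
    using total that by (auto simp: total_in_def)
  have Bmem: "range (\<lambda>j. B j (u j)) \<subseteq> carrier H" if "range u \<subseteq> carrier H" for u
    using that B by auto
  have "\<exists>A\<in>bounded_ops T. \<forall>u\<in>?I. A (\<tau> u) = \<tau> (\<lambda>j. B j (u j))"
  proof (rule T.bounded_op_exists[OF total, where s = "\<Prod>j\<in>UNIV. s j" and t = 0])
    fix u v :: "'d \<Rightarrow> 'a" assume "u \<in> ?I" "v \<in> ?I"
    then have u: "range u \<subseteq> carrier H" and v: "range v \<subseteq> carrier H" by auto
    then have "u j \<in> carrier H" "v j \<in> carrier H" for j by auto
    then show "cinner T (\<tau> (\<lambda>j. B j (u j))) (\<tau> (\<lambda>j. B j (v j)))
        = (\<Prod>j\<in>UNIV. s j) * cinner T (\<tau> (\<lambda>j. B j (u j))) (\<tau> v) + 0 * cinner T (\<tau> u) (\<tau> v)"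
      using u v Bmem by (simp add: inner form prod.distrib)
  next
    have "cmod (\<Prod>j\<in>UNIV. s j) \<le> 1"
      unfolding prod_norm[symmetric] using s by (intro prod_le_1) auto
    then show "cmod (\<Prod>j\<in>UNIV. s j) + cmod 0 \<le> 1" by simp
  qed (use mem Bmem in auto)
  then obtain A where A: "A \<in> bounded_ops T"
    "\<And>u. range u \<subseteq> carrier H \<Longrightarrow> A (\<tau> u) = \<tau> (\<lambda>j. B j (u j))"
    by blast
  have "tensor_power_op H T \<tau> B = A"
    unfolding tensor_power_op_def
  proof (rule the_equality)
    fix A' assume A': "A' \<in> bounded_ops T \<and>
      (\<forall>u. range u \<subseteq> carrier H \<longrightarrow> A' (\<tau> u) = \<tau> (\<lambda>j. B j (u j)))"
    then show "A' = A"
      using A by (intro T.bounded_ops_eqI[OF total]) auto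
  qed (use A in auto)
  with A show "tensor_power_op H T \<tau> B \<in> bounded_ops T"
    and "range u \<subseteq> carrier H \<Longrightarrow> tensor_power_op H T \<tau> B (\<tau> u) = \<tau> (\<lambda>j. B j (u j))"
    by auto
qed

lemma tensor_power_op_selfadjoint:
  assumes tensor: "tensor_power H T \<tau>"
    and B: "\<And>j. adjoint_pair H (B j) (B j)"
    and A: "A \<in> bounded_ops T" "\<And>u. range u \<subseteq> carrier H \<Longrightarrow> A (\<tau> u) = \<tau> (\<lambda>j. B j (u j))"
  shows "adjoint_pair T A A"
proof -
  interpret T: hilbert_space T using tensor by (simp add: tensor_power_def)
  have total: "total_in T (\<tau> ` {u. range u \<subseteq> carrier H})"
    and inner: "\<And>u v. \<lbrakk>range u \<subseteq> carrier H; range v \<subseteq> carrier H\<rbrakk>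
      \<Longrightarrow> cinner T (\<tau> u) (\<tau> v) = (\<Prod>j\<in>UNIV. cinner H (u j) (v j))"
    using tensor by (auto simp: tensor_power_def)
  have Bmem: "range (\<lambda>j. B j (u j)) \<subseteq> carrier H" if "range u \<subseteq> carrier H" for u
    using that B by (auto simp: adjoint_pair_def)
  show ?thesis
    using total A(1) A(1)
  proof (rule T.adjoint_pair_totalI)
    fix e f assume "e \<in> \<tau> ` {u. range u \<subseteq> carrier H}" "f \<in> \<tau> ` {u. range u \<subseteq> carrier H}"
    then obtain u v where uv: "range u \<subseteq> carrier H" "e = \<tau> u" "range v \<subseteq> carrier H" "f = \<tau> v"
      by auto
    then have "u j \<in> carrier H" "v j \<in> carrier H" for j by auto
    then have "(\<Prod>j\<in>UNIV. cinner H (B j (u j)) (v j)) = (\<Prod>j\<in>UNIV. cinner H (u j) (B j (v j)))"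
      using B by (simp add: adjoint_pair_def)
    then show "cinner T (A e) f = cinner T e (A f)"
      using uv Bmem by (simp add: A(2) inner)
  qed
qed

text \<open>
  A single index \<open>j\<close> with orthogonal ranges is enough, because it contributes a zero factor.
\<close>

lemma tensor_power_op_orthogonal:
  fixes \<tau> :: "('d::finite \<Rightarrow> 'a) \<Rightarrow> 'b"
  assumes tensor: "tensor_power H T \<tau>"
    and B: "\<And>j u. u \<in> carrier H \<Longrightarrow> B j u \<in> carrier H"
    and B': "\<And>j u. u \<in> carrier H \<Longrightarrow> B' j u \<in> carrier H"
    and orth: "\<And>u v. \<lbrakk>u \<in> carrier H; v \<in> carrier H\<rbrakk> \<Longrightarrow> cinner H (B j u) (B' j v) = 0"
    and A: "A \<in> bounded_ops T" "\<And>u. range u \<subseteq> carrier H \<Longrightarrow> A (\<tau> u) = \<tau> (\<lambda>j. B j (u j))"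
    and A': "A' \<in> bounded_ops T" "\<And>u. range u \<subseteq> carrier H \<Longrightarrow> A' (\<tau> u) = \<tau> (\<lambda>j. B' j (u j))"
    and x: "x \<in> carrier T" and y: "y \<in> carrier T"
  shows "cinner T (A x) (A' y) = 0"
proof -
  interpret T: hilbert_space T using tensor by (simp add: tensor_power_def)
  have total: "total_in T (\<tau> ` {u. range u \<subseteq> carrier H})"
    and inner: "\<And>u v. \<lbrakk>range u \<subseteq> carrier H; range v \<subseteq> carrier H\<rbrakk>
      \<Longrightarrow> cinner T (\<tau> u) (\<tau> v) = (\<Prod>j\<in>UNIV. cinner H (u j) (v j))"
    using tensor by (auto simp: tensor_power_def)
  have mem: "\<tau> u \<in> carrier T" if "range u \<subseteq> carrier H" for u
    using total that by (auto simp: total_in_def)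
  have Bmem: "range (\<lambda>j. B j (u j)) \<subseteq> carrier H" "range (\<lambda>j. B' j (u j)) \<subseteq> carrier H"
    if "range u \<subseteq> carrier H" for u
    using that B B' by auto
  have "cinner T (A x) (A' y) = cinner T ((\<lambda>u\<in>carrier T. \<zero>\<^bsub>T\<^esub>) x) ((\<lambda>u\<in>carrier T. \<zero>\<^bsub>T\<^esub>) y)"
    using total A(1) A'(1) T.bounded_ops_zero T.bounded_ops_zero _ x y
  proof (rule T.total_cinner_eqI)
    fix e f assume "e \<in> \<tau> ` {u. range u \<subseteq> carrier H}" "f \<in> \<tau> ` {u. range u \<subseteq> carrier H}"
    then obtain u v where uv: "range u \<subseteq> carrier H" "e = \<tau> u" "range v \<subseteq> carrier H" "f = \<tau> v"
      by auto
    then have "u j \<in> carrier H" "v j \<in> carrier H" by auto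
    then have "(\<Prod>i\<in>UNIV. cinner H (B i (u i)) (B' i (v i))) = 0"
      using orth by (intro prod_zero) auto
    then show "cinner T (A e) (A' f)
        = cinner T ((\<lambda>u\<in>carrier T. \<zero>\<^bsub>T\<^esub>) e) ((\<lambda>u\<in>carrier T. \<zero>\<^bsub>T\<^esub>) f)"
      using uv mem Bmem by (simp add: A(2) A'(2) inner)
  qed
  then show ?thesis using x y by simp
qed

lemma tensor_power_op_commute:
  assumes tensor: "tensor_power H T \<tau>"
    and B: "\<And>j u. u \<in> carrier H \<Longrightarrow> B j u \<in> carrier H"
    and B': "\<And>j u. u \<in> carrier H \<Longrightarrow> B' j u \<in> carrier H"
    and comm: "\<And>j u. u \<in> carrier H \<Longrightarrow> B j (B' j u) = B' j (B j u)"
    and A: "A \<in> bounded_ops T" "\<And>u. range u \<subseteq> carrier H \<Longrightarrow> A (\<tau> u) = \<tau> (\<lambda>j. B j (u j))"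
    and A': "A' \<in> bounded_ops T" "\<And>u. range u \<subseteq> carrier H \<Longrightarrow> A' (\<tau> u) = \<tau> (\<lambda>j. B' j (u j))"
    and x: "x \<in> carrier T"
  shows "A (A' x) = A' (A x)"
proof -
  interpret T: hilbert_space T using tensor by (simp add: tensor_power_def)
  have total: "total_in T (\<tau> ` {u. range u \<subseteq> carrier H})"
    using tensor by (auto simp: tensor_power_def)
  have Bmem: "range (\<lambda>j. B j (u j)) \<subseteq> carrier H" "range (\<lambda>j. B' j (u j)) \<subseteq> carrier H"
    if "range u \<subseteq> carrier H" for u
    using that B B' by auto
  show ?thesis
    using total A(1) A'(1) _ x
  proof (rule T.bounded_ops_commute_totalI)
    fix e assume "e \<in> \<tau> ` {u. range u \<subseteq> carrier H}"
    then obtain u where u: "range u \<subseteq> carrier H" "e = \<tau> u" by auto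
    then have "u j \<in> carrier H" for j by auto
    then have "(\<lambda>j. B j (B' j (u j))) = (\<lambda>j. B' j (B j (u j)))" using comm by simp
    then show "A (A' e) = A' (A e)"
      using u Bmem by (simp add: A(2) A'(2))
  qed
qed

section \<open>The space of square integrable functions\<close>

lemma sq_integrableD:
  assumes "f \<in> sq_integrable M"
  shows "f \<in> borel_measurable M" "integrable M (\<lambda>w. (cmod (f w))\<^sup>2)"
  using assms by (auto simp: sq_integrable_def)

lemma sq_integrable_add:
  assumes f: "f \<in> sq_integrable M" and g: "g \<in> sq_integrable M"
  shows "(\<lambda>w. f w + g w) \<in> sq_integrable M"
proof -
  note [measurable] = sq_integrableD(1)[OF f] sq_integrableD(1)[OF g]
  have "integrable M (\<lambda>w. (cmod (f w + g w))\<^sup>2)"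
  proof (rule Bochner_Integration.integrable_bound)
    show "integrable M (\<lambda>w. 2 * (cmod (f w))\<^sup>2 + 2 * (cmod (g w))\<^sup>2)"
      using sq_integrableD(2)[OF f] sq_integrableD(2)[OF g] by simp
    have "(cmod (f w + g w))\<^sup>2 \<le> 2 * (cmod (f w))\<^sup>2 + 2 * (cmod (g w))\<^sup>2" for w
    proof -
      have "(cmod (f w + g w))\<^sup>2 \<le> (cmod (f w) + cmod (g w))\<^sup>2"
        by (intro power_mono norm_triangle_ineq) auto
      also have "\<dots> \<le> 2 * (cmod (f w))\<^sup>2 + 2 * (cmod (g w))\<^sup>2"
        using sum_squares_bound[of "cmod (f w)" "cmod (g w)"] by (simp add: power2_sum)
      finally show ?thesis .
    qed
    then show "AE w in M. norm ((cmod (f w + g w))\<^sup>2)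
        \<le> norm (2 * (cmod (f w))\<^sup>2 + 2 * (cmod (g w))\<^sup>2)"
      by simp
  qed simp
  then show ?thesis by (simp add: sq_integrable_def)
qed

lemma sq_integrable_smult:
  "f \<in> sq_integrable M \<Longrightarrow> (\<lambda>w. c * f w) \<in> sq_integrable M"
  by (auto simp: sq_integrable_def norm_mult power_mult_distrib)

lemma sq_integrable_bounded:
  assumes "finite_measure M" "f \<in> borel_measurable M" "\<And>w. w \<in> space M \<Longrightarrow> cmod (f w) \<le> b"
  shows "f \<in> sq_integrable M"
proof -
  interpret finite_measure M by fact
  have "integrable M (\<lambda>w. (cmod (f w))\<^sup>2)"
    using assms(2,3) by (intro integrable_const_bound[where B = "b\<^sup>2"]) (auto intro!: AE_I2 power_mono)
  then show ?thesis using assms(2) by (simp add: sq_integrable_def)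
qed

lemma equiv_ae_rel: "equiv (sq_integrable M) (ae_rel M)"
proof (rule equivI)
  show "trans (ae_rel M)"
  proof (rule transI)
    fix f g h assume fg: "(f, g) \<in> ae_rel M" and gh: "(g, h) \<in> ae_rel M"
    have "AE w in M. f w = g w" "AE w in M. g w = h w"
      using fg gh by (auto simp: ae_rel_def)
    then have "AE w in M. f w = h w" by eventually_elim simp
    then show "(f, h) \<in> ae_rel M" using fg gh by (auto simp: ae_rel_def)
  qed
qed (auto simp: ae_rel_def refl_on_def sym_def eq_commute)

lemma ae_class_mem: "f \<in> sq_integrable M \<Longrightarrow> ae_class M f \<in> carrier (L2 M)"
  by (simp add: ae_class_def L2_def quotientI)

lemma ae_class_cong:
  assumes "f \<in> sq_integrable M" "g \<in> sq_integrable M" "AE w in M. f w = g w"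
  shows "ae_class M f = ae_class M g"
  using assms equiv_class_eq[OF equiv_ae_rel, of f g M] by (simp add: ae_class_def ae_rel_def)

lemma ae_rep_ae_class:
  assumes "f \<in> sq_integrable M"
  shows "ae_rep (ae_class M f) \<in> sq_integrable M"
    and "AE w in M. ae_rep (ae_class M f) w = f w"
proof -
  have "f \<in> ae_class M f" using assms by (simp add: ae_class_def ae_rel_def)
  then have "ae_rep (ae_class M f) \<in> ae_class M f" unfolding ae_rep_def
    by (rule someI[where P = "\<lambda>g. g \<in> ae_class M f"])
  then have "(f, ae_rep (ae_class M f)) \<in> ae_rel M" by (simp add: ae_class_def)
  then show "ae_rep (ae_class M f) \<in> sq_integrable M"
    and "AE w in M. ae_rep (ae_class M f) w = f w"
    by (auto simp: ae_rel_def eq_commute)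
qed

lemma L2_cases:
  assumes "U \<in> carrier (L2 M)"
  obtains f where "f \<in> sq_integrable M" "U = ae_class M f"
  using assms by (auto simp: L2_def ae_class_def elim: quotientE)

lemma L2_add:
  assumes f: "f \<in> sq_integrable M" and g: "g \<in> sq_integrable M"
  shows "ae_class M f \<oplus>\<^bsub>L2 M\<^esub> ae_class M g = ae_class M (\<lambda>w. f w + g w)"
proof -
  have "AE w in M. ae_rep (ae_class M f) w + ae_rep (ae_class M g) w = f w + g w"
    using ae_rep_ae_class(2)[OF f] ae_rep_ae_class(2)[OF g] by eventually_elim simp
  then have "ae_class M (\<lambda>w. ae_rep (ae_class M f) w + ae_rep (ae_class M g) w)
      = ae_class M (\<lambda>w. f w + g w)"
    using f g by (intro ae_class_cong sq_integrable_add ae_rep_ae_class(1)) auto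
  then show ?thesis by (simp add: L2_def)
qed

lemma L2_smult:
  assumes f: "f \<in> sq_integrable M"
  shows "c \<odot>\<^bsub>L2 M\<^esub> ae_class M f = ae_class M (\<lambda>w. c * f w)"
proof -
  have "AE w in M. c * ae_rep (ae_class M f) w = c * f w"
    using ae_rep_ae_class(2)[OF f] by eventually_elim simp
  then have "ae_class M (\<lambda>w. c * ae_rep (ae_class M f) w) = ae_class M (\<lambda>w. c * f w)"
    using f by (intro ae_class_cong sq_integrable_smult ae_rep_ae_class(1)) auto
  then show ?thesis by (simp add: L2_def)
qed

lemma L2_zero_smult: "0 \<odot>\<^bsub>L2 M\<^esub> U = \<zero>\<^bsub>L2 M\<^esub>"
  by (simp add: L2_def)

lemma borel_measurable_cnj [measurable (raw)]:
  "f \<in> borel_measurable M \<Longrightarrow> (\<lambda>w. cnj (f w)) \<in> borel_measurable M"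
  by (rule measurable_compose[OF _ borel_measurable_continuous_onI]) (auto intro: continuous_intros)

lemma L2_cinner:
  assumes f: "f \<in> sq_integrable M" and g: "g \<in> sq_integrable M"
  shows "cinner (L2 M) (ae_class M f) (ae_class M g) = (LINT w|M. cnj (f w) * g w)"
proof -
  note [measurable] = sq_integrableD(1)[OF f] sq_integrableD(1)[OF g]
    sq_integrableD(1)[OF ae_rep_ae_class(1)[OF f]] sq_integrableD(1)[OF ae_rep_ae_class(1)[OF g]]
  have "AE w in M. cnj (ae_rep (ae_class M f) w) * ae_rep (ae_class M g) w = cnj (f w) * g w"
    using ae_rep_ae_class(2)[OF f] ae_rep_ae_class(2)[OF g] by eventually_elim simp
  then have "(LINT w|M. cnj (ae_rep (ae_class M f) w) * ae_rep (ae_class M g) w)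
      = (LINT w|M. cnj (f w) * g w)"
    by (intro integral_cong_AE) auto
  then show ?thesis by (simp add: L2_def)
qed

lemma L2_norm:
  assumes f: "f \<in> sq_integrable M"
  shows "hnorm (L2 M) (ae_class M f) = sqrt (LINT w|M. (cmod (f w))\<^sup>2)"
proof -
  have "cinner (L2 M) (ae_class M f) (ae_class M f)
      = (LINT w|M. complex_of_real ((cmod (f w))\<^sup>2))"
    unfolding L2_cinner[OF f f] complex_norm_square by (simp only: mult.commute)
  then show ?thesis by (simp add: hnorm_def del: of_real_power)
qed

lemma L2_diff_norm:
  assumes H: "hilbert_space (L2 M)" and f: "f \<in> sq_integrable M" and g: "g \<in> sq_integrable M"
  shows "hnorm (L2 M) (ae_class M f \<ominus>\<^bsub>L2 M\<^esub> ae_class M g)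
    = sqrt (LINT w|M. (cmod (f w - g w))\<^sup>2)"
proof -
  interpret H: hilbert_space "L2 M" by (rule H)
  have "ae_class M f \<ominus>\<^bsub>L2 M\<^esub> ae_class M g = ae_class M (\<lambda>w. f w + (-1) * g w)"
    unfolding a_minus_def H.minus_eq_smult[OF ae_class_mem[OF g]] L2_smult[OF g]
      L2_add[OF f sq_integrable_smult[OF g]] ..
  then show ?thesis
    using L2_norm[OF sq_integrable_add[OF f sq_integrable_smult[OF g, of "-1"]]] by simp
qed

section \<open>The closed span of a set\<close>

context hilbert_space
begin

text \<open>
  The closed span is used to prove totality: it is a closed linear subspace, so it suffices to
  put enough vectors into it.
\<close>

definition closed_span :: "'a set \<Rightarrow> 'a set" where
  "closed_span E = {u \<in> carrier H. \<forall>e>0. \<exists>v\<in>hspan H E. hnorm H (u \<ominus> v) < e}"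

lemma hspanI: "\<lbrakk>finite F; F \<subseteq> E\<rbrakk> \<Longrightarrow> (\<Oplus>e\<in>F. c e \<odot> e) \<in> hspan H E"
  unfolding hspan_def by blast

lemma hspan_mem: "\<lbrakk>E \<subseteq> carrier H; v \<in> hspan H E\<rbrakk> \<Longrightarrow> v \<in> carrier H"
  unfolding hspan_def by (auto intro!: M.finsum_closed smult_mem)

lemma hspan_add:
  assumes E: "E \<subseteq> carrier H" and u: "u \<in> hspan H E" and v: "v \<in> hspan H E"
  shows "u \<oplus> v \<in> hspan H E"
proof -
  obtain F c where F: "finite F" "F \<subseteq> E" and u_eq: "u = (\<Oplus>e\<in>F. c e \<odot> e)"
    using u unfolding hspan_def by blast
  obtain G d where G: "finite G" "G \<subseteq> E" and v_eq: "v = (\<Oplus>e\<in>G. d e \<odot> e)"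
    using v unfolding hspan_def by blast
  define b where "b e = (if e \<in> F then c e else 0) + (if e \<in> G then d e else 0)" for e
  have memF: "\<And>e. e \<in> F \<Longrightarrow> e \<in> carrier H" and memG: "\<And>e. e \<in> G \<Longrightarrow> e \<in> carrier H"
    using F G E by auto
  have "u \<oplus> v = (\<Oplus>e\<in>F \<union> G. b e \<odot> e)"
  proof (rule vector_eqI)
    show "u \<oplus> v \<in> carrier H" using hspan_mem[OF E] u v by simp
    show "(\<Oplus>e\<in>F \<union> G. b e \<odot> e) \<in> carrier H"
      using memF memG by (intro M.finsum_closed) auto
    fix w assume w: "w \<in> carrier H"
    have "cinner H w (\<Oplus>e\<in>F \<union> G. b e \<odot> e) = (\<Sum>e\<in>F \<union> G. cinner H w (b e \<odot> e))"
      using F G w memF memG by (intro cinner_finsum) auto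
    also have "\<dots> = (\<Sum>e\<in>F \<union> G. (if e \<in> F then c e * cinner H w e else 0)
        + (if e \<in> G then d e * cinner H w e else 0))"
      using w memF memG by (intro sum.cong) (auto simp: cinner_smult b_def algebra_simps)
    also have "\<dots> = (\<Sum>e\<in>F. c e * cinner H w e) + (\<Sum>e\<in>G. d e * cinner H w e)"
      using F G sum.inter_restrict[of "F \<union> G" "\<lambda>e. c e * cinner H w e" F]
        sum.inter_restrict[of "F \<union> G" "\<lambda>e. d e * cinner H w e" G]
      by (simp add: sum.distrib Int_absorb1)
    also have "\<dots> = cinner H w u + cinner H w v"
    proof -
      have "cinner H w u = (\<Sum>e\<in>F. cinner H w (c e \<odot> e))"
        unfolding u_eq using F w memF by (intro cinner_finsum) auto
      moreover have "cinner H w v = (\<Sum>e\<in>G. cinner H w (d e \<odot> e))"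
        unfolding v_eq using G w memG by (intro cinner_finsum) auto
      ultimately show ?thesis using w memF memG by (simp add: cinner_smult)
    qed
    finally show "cinner H w (u \<oplus> v) = cinner H w (\<Oplus>e\<in>F \<union> G. b e \<odot> e)"
      using w hspan_mem[OF E] u v by (simp add: cinner_add)
  qed
  then show ?thesis using F G unfolding hspan_def by blast
qed

lemma hspan_smult:
  assumes E: "E \<subseteq> carrier H" and u: "u \<in> hspan H E"
  shows "a \<odot> u \<in> hspan H E"
proof -
  obtain F c where F: "finite F" "F \<subseteq> E" and u_eq: "u = (\<Oplus>e\<in>F. c e \<odot> e)"
    using u unfolding hspan_def by blast
  have "a \<odot> u = (\<Oplus>e\<in>F. a \<odot> (c e \<odot> e))"
    unfolding u_eq using F E by (intro finsum_smult_ldistr) auto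
  also have "\<dots> = (\<Oplus>e\<in>F. (a * c e) \<odot> e)"
    using F E smult_assoc1[of a] by (intro M.finsum_cong') auto
  finally show ?thesis using hspanI[OF F] by simp
qed

lemma closed_span_base:
  assumes E: "E \<subseteq> carrier H" and e: "e \<in> E"
  shows "e \<in> closed_span E"
proof -
  have [simp]: "e \<in> carrier H" using E e by blast
  have "(\<Oplus>x\<in>{e}. 1 \<odot> x) = e" using smult_one[of e] by simp
  then have "e \<in> hspan H E"
    unfolding hspan_def using e
    by (intro CollectI exI[of _ "{e}"] exI[of _ "\<lambda>_. 1"]) auto
  moreover have "e \<ominus> e = \<zero>" by (simp add: diff_eq_zero_iff)
  ultimately show ?thesis unfolding closed_span_def by (auto intro!: bexI[of _ e])
qed

lemma closed_span_add:
  assumes E: "E \<subseteq> carrier H" and u: "u \<in> closed_span E" and v: "v \<in> closed_span E"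
  shows "u \<oplus> v \<in> closed_span E"
  unfolding closed_span_def
proof (intro CollectI conjI allI impI)
  have uv: "u \<in> carrier H" "v \<in> carrier H" using u v by (auto simp: closed_span_def)
  then show "u \<oplus> v \<in> carrier H" by simp
  fix e :: real assume "e > 0"
  then have e2: "e / 2 > 0" by simp
  obtain u' where u': "u' \<in> hspan H E" "hnorm H (u \<ominus> u') < e / 2"
    using u e2 unfolding closed_span_def by blast
  obtain v' where v': "v' \<in> hspan H E" "hnorm H (v \<ominus> v') < e / 2"
    using v e2 unfolding closed_span_def by blast
  have "hnorm H ((u \<oplus> v) \<ominus> (u' \<oplus> v')) < e"
    using hnorm_add_diff_le[OF uv hspan_mem[OF E u'(1)] hspan_mem[OF E v'(1)]] u'(2) v'(2)
    by simp
  then show "\<exists>x\<in>hspan H E. hnorm H ((u \<oplus> v) \<ominus> x) < e"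
    using hspan_add[OF E u'(1) v'(1)] by blast
qed

lemma closed_span_smult:
  assumes E: "E \<subseteq> carrier H" and u: "u \<in> closed_span E"
  shows "a \<odot> u \<in> closed_span E"
  unfolding closed_span_def
proof (intro CollectI conjI allI impI)
  have uH: "u \<in> carrier H" using u by (auto simp: closed_span_def)
  then show "a \<odot> u \<in> carrier H" by simp
  fix e :: real assume e: "e > 0"
  have pos: "cmod a + 1 > 0" by (simp add: add_nonneg_pos)
  then have "e / (cmod a + 1) > 0" using e by simp
  then obtain u' where u': "u' \<in> hspan H E" "hnorm H (u \<ominus> u') < e / (cmod a + 1)"
    using u unfolding closed_span_def by blast
  have u'H: "u' \<in> carrier H" using hspan_mem[OF E u'(1)] .
  have "hnorm H (a \<odot> u \<ominus> a \<odot> u') \<le> (cmod a + 1) * hnorm H (u \<ominus> u')"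
    using uH u'H by (simp add: hnorm_smult_diff algebra_simps)
  also have "\<dots> < e" using u'(2) pos by (simp add: pos_less_divide_eq mult.commute)
  finally show "\<exists>x\<in>hspan H E. hnorm H (a \<odot> u \<ominus> x) < e"
    using hspan_smult[OF E u'(1)] by blast
qed

lemma closed_span_closed:
  assumes E: "E \<subseteq> carrier H" and u: "u \<in> carrier H"
    and approx: "\<And>e. e > 0 \<Longrightarrow> \<exists>v\<in>closed_span E. hnorm H (u \<ominus> v) < e"
  shows "u \<in> closed_span E"
  unfolding closed_span_def
proof (intro CollectI conjI allI impI u)
  fix e :: real assume "e > 0"
  then have e2: "e / 2 > 0" by simp
  then obtain v where v: "v \<in> closed_span E" "hnorm H (u \<ominus> v) < e / 2"
    using approx by blast
  then obtain v' where v': "v' \<in> hspan H E" "hnorm H (v \<ominus> v') < e / 2"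
    using e2 unfolding closed_span_def by blast
  have "v \<in> carrier H" using v by (simp add: closed_span_def)
  then have "hnorm H (u \<ominus> v') < e"
    using hnorm_diff_triangle[of u v v'] u v v' hspan_mem[OF E v'(1)] by simp
  then show "\<exists>x\<in>hspan H E. hnorm H (u \<ominus> x) < e" using v'(1) by blast
qed

lemma total_in_iff_closed_span:
  "E \<subseteq> carrier H \<Longrightarrow> total_in H E \<longleftrightarrow> closed_span E = carrier H"
  unfolding total_in_def closed_span_def by blast

end

section \<open>The orthonormal basis of Bernoulli functionals\<close>

locale bernoulli_space =
  fixes p :: "nat \<Rightarrow> real" and P :: "(nat \<Rightarrow> int) measure"
  assumes p01: "\<And>n. 0 < p n \<and> p n < 1" and bernoulli: "bernoulli_measure p P"
begin

sublocale prob_space P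
  using bernoulli by (simp add: bernoulli_measure_def)

lemma space_P: "space P = sign_seqs"
  using bernoulli by (simp add: bernoulli_measure_def)

lemma sets_P: "sets P = sigma_sets sign_seqs {{f \<in> sign_seqs. f n \<in> B} | n B. B \<subseteq> {-1, 1}}"
  using bernoulli by (simp add: bernoulli_measure_def)

lemma sign_seqs_cases: "f \<in> sign_seqs \<Longrightarrow> f n = -1 \<or> f n = 1"
  by (auto simp: sign_seqs_def)

lemma coordinate_sets [measurable]: "{f \<in> sign_seqs. f n \<in> B} \<in> sets P"
proof -
  have "{f \<in> sign_seqs. f n \<in> B} = {f \<in> sign_seqs. f n \<in> B \<inter> {-1, 1}}"
    using sign_seqs_cases by auto
  then show ?thesis unfolding sets_P by (intro sigma_sets.Basic) blast
qed

lemma coordinate_measurable [measurable]: "(\<lambda>f. f n) \<in> measurable P (count_space UNIV)"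
  using coordinate_sets[of n]
  by (intro measurableI) (auto simp: space_P vimage_def Int_def conj_commute)

definition cylinder :: "nat set \<Rightarrow> (nat \<Rightarrow> int set) \<Rightarrow> (nat \<Rightarrow> int) set" where
  "cylinder N B = {f \<in> sign_seqs. \<forall>n\<in>N. f n \<in> B n}"

lemma cylinder_sets: "finite N \<Longrightarrow> cylinder N B \<in> sets P"
proof -
  assume "finite N"
  then have "{f \<in> space P. \<forall>n\<in>N. f n \<in> B n} \<in> sets P"
    using coordinate_sets by (intro sets.sets_Collect_finite_All) (auto simp: space_P)
  then show ?thesis by (simp add: space_P cylinder_def)
qed

definition sign_prob :: "nat \<Rightarrow> int \<Rightarrow> real" where
  "sign_prob n y = (if y = 1 then p n else 1 - p n)"

lemma measure_point_cylinder:
  assumes N: "finite N" and \<epsilon>: "\<And>n. n \<in> N \<Longrightarrow> \<epsilon> n \<in> {-1, 1}"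
  shows "prob (cylinder N (\<lambda>n. {\<epsilon> n})) = (\<Prod>n\<in>N. sign_prob n (\<epsilon> n))"
proof (cases "N = {}")
  case True
  then show ?thesis using prob_space by (simp add: cylinder_def space_P)
next
  case False
  have "prob (cylinder N (\<lambda>n. {\<epsilon> n}))
      = (\<Prod>n\<in>N. p n powr ((1 + real_of_int (\<epsilon> n)) / 2)
            * (1 - p n) powr ((1 - real_of_int (\<epsilon> n)) / 2))"
    using bernoulli N \<epsilon> False unfolding bernoulli_measure_def cylinder_def by simp
  also have "\<dots> = (\<Prod>n\<in>N. sign_prob n (\<epsilon> n))"
  proof (rule prod.cong)
    fix n assume "n \<in> N"
    then have "\<epsilon> n = -1 \<or> \<epsilon> n = 1" using \<epsilon> by blast
    then show "p n powr ((1 + real_of_int (\<epsilon> n)) / 2)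
            * (1 - p n) powr ((1 - real_of_int (\<epsilon> n)) / 2) = sign_prob n (\<epsilon> n)"
      using p01[of n] by (auto simp: sign_prob_def)
  qed simp
  finally show ?thesis .
qed

text \<open>
  This is independence of the coordinates. A function of one sign is a combination of
  indicators of the two signs; multiplying out turns the integrand into a combination of
  indicators of cylinders, whose probabilities are products.
\<close>

lemma expectation_prod:
  fixes \<phi> :: "nat \<Rightarrow> int \<Rightarrow> complex"
  assumes N: "finite N"
  shows "(LINT f|P. (\<Prod>n\<in>N. \<phi> n (f n)))
    = (\<Prod>n\<in>N. of_real (p n) * \<phi> n 1 + of_real (1 - p n) * \<phi> n (-1))"
proof -
  let ?E = "N \<rightarrow>\<^sub>E {-1, 1 :: int}"
  have E: "finite ?E" using N by (intro finite_PiE) auto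
  have "(\<Prod>n\<in>N. \<phi> n (f n))
      = (\<Sum>g\<in>?E. (\<Prod>n\<in>N. \<phi> n (g n)) * indicator (cylinder N (\<lambda>n. {g n})) f)"
    if f: "f \<in> space P" for f
  proof -
    have "(\<Prod>n\<in>N. \<phi> n (f n)) = (\<Prod>n\<in>N. \<Sum>y\<in>{-1, 1}. if f n = y then \<phi> n y else 0)"
    proof (rule prod.cong)
      fix n show "\<phi> n (f n) = (\<Sum>y\<in>{-1, 1}. if f n = y then \<phi> n y else 0)"
        using sign_seqs_cases[of f n] f by (auto simp: space_P)
    qed simp
    also have "\<dots> = (\<Sum>g\<in>?E. \<Prod>n\<in>N. if f n = g n then \<phi> n (g n) else 0)"
      using N by (intro prod_sum_PiE) auto
    also have "\<dots> = (\<Sum>g\<in>?E. (\<Prod>n\<in>N. \<phi> n (g n)) * indicator (cylinder N (\<lambda>n. {g n})) f)"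
    proof (rule sum.cong)
      fix g
      show "(\<Prod>n\<in>N. if f n = g n then \<phi> n (g n) else 0)
          = (\<Prod>n\<in>N. \<phi> n (g n)) * indicator (cylinder N (\<lambda>n. {g n})) f"
      proof (cases "\<forall>n\<in>N. f n = g n")
        case True
        then show ?thesis using f by (simp add: cylinder_def space_P)
      next
        case False
        then have "f \<notin> cylinder N (\<lambda>n. {g n})" by (auto simp: cylinder_def)
        moreover have "(\<Prod>n\<in>N. if f n = g n then \<phi> n (g n) else 0) = 0"
          using False N by (auto intro: prod_zero)
        ultimately show ?thesis by simp
      qed
    qed simp
    finally show ?thesis .
  qed
  then have "(LINT f|P. (\<Prod>n\<in>N. \<phi> n (f n)))
      = (LINT f|P. (\<Sum>g\<in>?E. (\<Prod>n\<in>N. \<phi> n (g n)) * indicator (cylinder N (\<lambda>n. {g n})) f))"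
    by (rule Bochner_Integration.integral_cong[OF refl])
  also have "\<dots> = (\<Sum>g\<in>?E. (\<Prod>n\<in>N. \<phi> n (g n)) * of_real (prob (cylinder N (\<lambda>n. {g n}))))"
  proof (rule has_bochner_integral_integral_eq, rule has_bochner_integral_sum)
    fix g
    have "(\<lambda>f. c * indicator A f) = (\<lambda>f. indicator A f *\<^sub>R c)" for c :: complex and A :: "(nat \<Rightarrow> int) set"
      by (rule ext) (simp add: indicator_def)
    then show "has_bochner_integral P
        (\<lambda>f. (\<Prod>n\<in>N. \<phi> n (g n)) * indicator (cylinder N (\<lambda>n. {g n})) f)
        ((\<Prod>n\<in>N. \<phi> n (g n)) * of_real (prob (cylinder N (\<lambda>n. {g n}))))"
      using has_bochner_integral_indicator[OF cylinder_sets[OF N], of "\<lambda>n. {g n}" "\<Prod>n\<in>N. \<phi> n (g n)"]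
      by (simp add: scaleR_conv_of_real mult.commute less_top[symmetric])
  qed
  also have "\<dots> = (\<Sum>g\<in>?E. \<Prod>n\<in>N. of_real (sign_prob n (g n)) * \<phi> n (g n))"
  proof (rule sum.cong)
    fix g assume "g \<in> ?E"
    then have "prob (cylinder N (\<lambda>n. {g n})) = (\<Prod>n\<in>N. sign_prob n (g n))"
      using N by (intro measure_point_cylinder) auto
    then show "(\<Prod>n\<in>N. \<phi> n (g n)) * of_real (prob (cylinder N (\<lambda>n. {g n})))
        = (\<Prod>n\<in>N. of_real (sign_prob n (g n)) * \<phi> n (g n))"
      by (simp add: prod.distrib mult.commute)
  qed simp
  also have "\<dots> = (\<Prod>n\<in>N. \<Sum>y\<in>{-1, 1}. of_real (sign_prob n y) * \<phi> n y)"
    using N by (intro prod_sum_PiE[symmetric]) auto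
  also have "\<dots> = (\<Prod>n\<in>N. of_real (p n) * \<phi> n 1 + of_real (1 - p n) * \<phi> n (-1))"
    by (simp add: sign_prob_def add.commute)
  finally show ?thesis .
qed

text \<open>
  The functional \<open>Z\<^sub>n\<close> as a function of the sign at \<open>n\<close>.
\<close>

definition zeta :: "nat \<Rightarrow> int \<Rightarrow> real" where
  "zeta n y = (real_of_int y + (1 - p n) - p n) / (2 * sqrt (p n * (1 - p n)))"

lemma Z_fun_eq: "Z_fun p n f = zeta n (f n)"
  by (simp add: Z_fun_def zeta_def)

lemma zeta_values:
  "zeta n 1 = (1 - p n) / sqrt (p n * (1 - p n))" "zeta n (-1) = - p n / sqrt (p n * (1 - p n))"
proof -
  have "zeta n 1 = (2 * (1 - p n)) / (2 * sqrt (p n * (1 - p n)))"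
    unfolding zeta_def by (rule arg_cong2[where f = "(/)"]) simp_all
  then show "zeta n 1 = (1 - p n) / sqrt (p n * (1 - p n))"
    unfolding mult_divide_mult_cancel_left_if by simp
  have "zeta n (-1) = (2 * (- p n)) / (2 * sqrt (p n * (1 - p n)))"
    unfolding zeta_def by (rule arg_cong2[where f = "(/)"]) simp_all
  then show "zeta n (-1) = - p n / sqrt (p n * (1 - p n))"
    unfolding mult_divide_mult_cancel_left_if by simp
qed

lemma sqrt_pq: "0 < sqrt (p n * (1 - p n))" "(sqrt (p n * (1 - p n)))\<^sup>2 = p n * (1 - p n)"
  using p01[of n] by simp_all

lemma zeta_mean: "p n * zeta n 1 + (1 - p n) * zeta n (-1) = 0"
  by (simp add: zeta_values)

lemma zeta_variance: "p n * (zeta n 1)\<^sup>2 + (1 - p n) * (zeta n (-1))\<^sup>2 = 1"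
proof -
  have "p n * (zeta n 1)\<^sup>2 + (1 - p n) * (zeta n (-1))\<^sup>2
      = (p n * (1 - p n)\<^sup>2 + (1 - p n) * (p n)\<^sup>2) / (p n * (1 - p n))"
    unfolding zeta_values power_divide sqrt_pq(2) by (simp add: add_divide_distrib)
  also have "p n * (1 - p n)\<^sup>2 + (1 - p n) * (p n)\<^sup>2 = p n * (1 - p n)"
    by (simp add: power2_eq_square algebra_simps)
  finally show ?thesis using p01[of n] by simp
qed

lemma prod_coordinates_sq_integrable:
  fixes \<phi> :: "nat \<Rightarrow> int \<Rightarrow> complex"
  assumes N: "finite N"
  shows "(\<lambda>f. \<Prod>n\<in>N. \<phi> n (f n)) \<in> sq_integrable P"
proof (rule sq_integrable_bounded)
  show "finite_measure P" by unfold_locales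
  have "(\<lambda>f. \<phi> n (f n)) \<in> borel_measurable P" for n
    by (rule measurable_compose[OF coordinate_measurable]) simp
  then show "(\<lambda>f. \<Prod>n\<in>N. \<phi> n (f n)) \<in> borel_measurable P" by simp
  fix f assume "f \<in> space P"
  then have "cmod (\<phi> n (f n)) \<le> cmod (\<phi> n 1) + cmod (\<phi> n (-1))" for n
    using sign_seqs_cases[of f n] by (auto simp: space_P)
  then show "cmod (\<Prod>n\<in>N. \<phi> n (f n)) \<le> (\<Prod>n\<in>N. cmod (\<phi> n 1) + cmod (\<phi> n (-1)))"
    unfolding prod_norm[symmetric] by (intro prod_mono) auto
qed

definition Z_product :: "nat set \<Rightarrow> (nat \<Rightarrow> int) \<Rightarrow> complex" where
  "Z_product \<sigma> f = (\<Prod>n\<in>\<sigma>. complex_of_real (zeta n (f n)))"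

lemma Z_vec_eq: "Z_vec p P \<sigma> = ae_class P (Z_product \<sigma>)"
  by (simp add: Z_vec_def Z_fun_eq Z_product_def[abs_def])

lemma Z_product_sq_integrable: "finite \<sigma> \<Longrightarrow> Z_product \<sigma> \<in> sq_integrable P"
  unfolding Z_product_def[abs_def] by (rule prod_coordinates_sq_integrable)

lemma Z_vec_mem: "finite \<sigma> \<Longrightarrow> Z_vec p P \<sigma> \<in> carrier (L2 P)"
  by (simp add: Z_vec_eq ae_class_mem Z_product_sq_integrable)

text \<open>
  By independence the inner product is a product of expectations: an index in exactly one of
  the two sets contributes the mean \<open>0\<close> of \<open>Z\<^sub>n\<close>, an index in both contributes its second
  moment \<open>1\<close>.
\<close>

lemma cinner_Z_vec:
  assumes \<sigma>: "finite \<sigma>" and \<tau>: "finite \<tau>"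
  shows "cinner (L2 P) (Z_vec p P \<sigma>) (Z_vec p P \<tau>) = (if \<sigma> = \<tau> then 1 else 0)"
proof -
  define \<phi> where "\<phi> n y = (if n \<in> \<sigma> then complex_of_real (zeta n y) else 1)
    * (if n \<in> \<tau> then complex_of_real (zeta n y) else 1)" for n y
  have "cnj (Z_product \<sigma> f) * Z_product \<tau> f = (\<Prod>n\<in>\<sigma> \<union> \<tau>. \<phi> n (f n))" for f
  proof -
    have "(\<Prod>n\<in>\<sigma> \<union> \<tau>. \<phi> n (f n))
        = (\<Prod>n\<in>(\<sigma> \<union> \<tau>) \<inter> \<sigma>. complex_of_real (zeta n (f n)))
          * (\<Prod>n\<in>(\<sigma> \<union> \<tau>) \<inter> \<tau>. complex_of_real (zeta n (f n)))"
      using \<sigma> \<tau> by (simp only: \<phi>_def prod.distrib prod.inter_restrict finite_UnI)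
    then show ?thesis
      by (simp add: Z_product_def Int_absorb1)
  qed
  then have "cinner (L2 P) (Z_vec p P \<sigma>) (Z_vec p P \<tau>) = (LINT f|P. (\<Prod>n\<in>\<sigma> \<union> \<tau>. \<phi> n (f n)))"
    unfolding Z_vec_eq L2_cinner[OF Z_product_sq_integrable[OF \<sigma>] Z_product_sq_integrable[OF \<tau>]]
    by simp
  also have "\<dots> = (\<Prod>n\<in>\<sigma> \<union> \<tau>. of_real (p n) * \<phi> n 1 + of_real (1 - p n) * \<phi> n (-1))"
    using \<sigma> \<tau> by (intro expectation_prod) auto
  also have "\<dots> = (\<Prod>n\<in>\<sigma> \<union> \<tau>. if n \<in> \<sigma> \<inter> \<tau> then 1 else 0)"
  proof (rule prod.cong)
    fix n assume n: "n \<in> \<sigma> \<union> \<tau>"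
    show "of_real (p n) * \<phi> n 1 + of_real (1 - p n) * \<phi> n (-1) = (if n \<in> \<sigma> \<inter> \<tau> then 1 else 0)"
    proof (cases "n \<in> \<sigma> \<inter> \<tau>")
      case True
      then have "of_real (p n) * \<phi> n 1 + of_real (1 - p n) * \<phi> n (-1)
          = complex_of_real (p n * (zeta n 1)\<^sup>2 + (1 - p n) * (zeta n (-1))\<^sup>2)"
        by (simp add: \<phi>_def power2_eq_square)
      then show ?thesis using True by (simp only: zeta_variance) simp
    next
      case False
      then have "of_real (p n) * \<phi> n 1 + of_real (1 - p n) * \<phi> n (-1)
          = complex_of_real (p n * zeta n 1 + (1 - p n) * zeta n (-1))"
        using n by (auto simp: \<phi>_def)
      then show ?thesis using False by (simp only: zeta_mean) simp
    qed
  qed simp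
  also have "\<dots> = (if \<sigma> = \<tau> then 1 else 0)"
  proof (cases "\<sigma> = \<tau>")
    case False
    then have "\<exists>n\<in>\<sigma> \<union> \<tau>. n \<notin> \<sigma> \<inter> \<tau>" by blast
    then show ?thesis using False \<sigma> \<tau> by (auto intro!: prod_zero)
  qed simp
  finally show ?thesis .
qed

end

section \<open>Density of the Bernoulli functionals\<close>

locale bernoulli_hilbert_space = bernoulli_space p P + H: hilbert_space "L2 P"
  for p :: "nat \<Rightarrow> real" and P :: "(nat \<Rightarrow> int) measure"
begin

abbreviation Z_vecs :: "functional set" where
  "Z_vecs \<equiv> Z_vec p P ` {\<sigma>. finite \<sigma>}"

lemma Z_vecs_mem: "Z_vecs \<subseteq> carrier (L2 P)"
  using Z_vec_mem by auto

text \<open>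
  To be shown: every square integrable function is approximable. The set of approximable
  functions is linear and closed under dominated limits; it contains the indicators of
  cylinders, hence by a Dynkin argument the indicators of all events, hence the simple
  functions, hence everything.
\<close>

definition approximable :: "((nat \<Rightarrow> int) \<Rightarrow> complex) set" where
  "approximable = {f \<in> sq_integrable P. ae_class P f \<in> H.closed_span Z_vecs}"

lemma approximable_Z: "finite \<sigma> \<Longrightarrow> Z_product \<sigma> \<in> approximable"
  using H.closed_span_base[OF Z_vecs_mem]
  by (auto simp: approximable_def Z_product_sq_integrable simp flip: Z_vec_eq)

lemma approximable_add:
  "\<lbrakk>f \<in> approximable; g \<in> approximable\<rbrakk> \<Longrightarrow> (\<lambda>w. f w + g w) \<in> approximable"
  using H.closed_span_add[OF Z_vecs_mem, of "ae_class P f" "ae_class P g"]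
  by (simp add: approximable_def sq_integrable_add L2_add)

lemma approximable_smult: "f \<in> approximable \<Longrightarrow> (\<lambda>w. c * f w) \<in> approximable"
  using H.closed_span_smult[OF Z_vecs_mem, of "ae_class P f" c]
  by (simp add: approximable_def sq_integrable_smult L2_smult)

lemma approximable_sum:
  assumes "finite I" "\<And>i. i \<in> I \<Longrightarrow> f i \<in> approximable"
  shows "(\<lambda>w. \<Sum>i\<in>I. f i w) \<in> approximable"
  using assms
proof (induction I rule: finite_induct)
  case empty
  show ?case using approximable_smult[OF approximable_Z[of "{}"], of 0] by simp
next
  case (insert i I)
  then show ?case using approximable_add[of "f i" "\<lambda>w. \<Sum>i\<in>I. f i w"] by simp
qed

lemma approximable_cong:
  assumes f: "f \<in> approximable" and eq: "\<And>w. w \<in> space P \<Longrightarrow> f w = g w"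
  shows "g \<in> approximable"
proof -
  have fsq: "f \<in> sq_integrable P" using f by (simp add: approximable_def)
  have "g \<in> borel_measurable P \<longleftrightarrow> f \<in> borel_measurable P"
    using eq by (intro measurable_cong) simp
  moreover have "integrable P (\<lambda>w. (cmod (g w))\<^sup>2) \<longleftrightarrow> integrable P (\<lambda>w. (cmod (f w))\<^sup>2)"
    using eq by (intro Bochner_Integration.integrable_cong) simp_all
  ultimately have gsq: "g \<in> sq_integrable P" using fsq by (simp add: sq_integrable_def)
  have "ae_class P f = ae_class P g"
    using fsq gsq by (rule ae_class_cong) (auto intro: AE_I2 eq)
  then show ?thesis using f gsq by (simp add: approximable_def)
qed

lemma approximable_limit:
  assumes s: "\<And>n. s n \<in> approximable" and f: "f \<in> sq_integrable P"
    and lim: "\<And>w. w \<in> space P \<Longrightarrow> (\<lambda>n. s n w) \<longlonglongrightarrow> f w"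
    and h: "integrable P h" and bound: "\<And>n w. w \<in> space P \<Longrightarrow> (cmod (f w - s n w))\<^sup>2 \<le> h w"
  shows "f \<in> approximable"
proof -
  have ssq: "s n \<in> sq_integrable P" and sV: "ae_class P (s n) \<in> H.closed_span Z_vecs" for n
    using s by (auto simp: approximable_def)
  note [measurable] = sq_integrableD(1)[OF f] sq_integrableD(1)[OF ssq]
  have "(\<lambda>n. LINT w|P. (cmod (f w - s n w))\<^sup>2) \<longlonglongrightarrow> (LINT w|P. 0)"
  proof (rule integral_dominated_convergence[OF _ _ h])
    show "AE w in P. (\<lambda>n. (cmod (f w - s n w))\<^sup>2) \<longlonglongrightarrow> 0"
    proof (rule AE_I2)
      fix w assume "w \<in> space P"
      then have "(\<lambda>n. (cmod (f w - s n w))\<^sup>2) \<longlonglongrightarrow> (cmod (f w - f w))\<^sup>2"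
        by (intro tendsto_intros lim)
      then show "(\<lambda>n. (cmod (f w - s n w))\<^sup>2) \<longlonglongrightarrow> 0" by simp
    qed
  qed (auto intro: AE_I2 bound)
  then have conv: "(\<lambda>n. LINT w|P. (cmod (f w - s n w))\<^sup>2) \<longlonglongrightarrow> 0" by simp
  have "ae_class P f \<in> H.closed_span Z_vecs"
  proof (rule H.closed_span_closed[OF Z_vecs_mem ae_class_mem[OF f]])
    fix e :: real assume e: "e > 0"
    then have "\<forall>\<^sub>F n in sequentially. (LINT w|P. (cmod (f w - s n w))\<^sup>2) < e\<^sup>2"
      using conv by (intro order_tendstoD(2)) auto
    then obtain n where "(LINT w|P. (cmod (f w - s n w))\<^sup>2) < e\<^sup>2"
      using eventually_happens'[OF sequentially_bot] by blast
    then have "sqrt (LINT w|P. (cmod (f w - s n w))\<^sup>2) < sqrt (e\<^sup>2)"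
      by (rule real_sqrt_less_mono)
    then have "sqrt (LINT w|P. (cmod (f w - s n w))\<^sup>2) < e"
      using e by simp
    then have "hnorm (L2 P) (ae_class P f \<ominus>\<^bsub>L2 P\<^esub> ae_class P (s n)) < e"
      using L2_diff_norm[OF H.hilbert_space_axioms f ssq] by simp
    then show "\<exists>v\<in>H.closed_span Z_vecs. hnorm (L2 P) (ae_class P f \<ominus>\<^bsub>L2 P\<^esub> v) < e"
      using sV by blast
  qed
  then show ?thesis using f by (simp add: approximable_def)
qed

text \<open>
  On \<open>{-1, 1}\<close> every function is affine in \<open>zeta n\<close>, so the indicator of a cylinder is a
  product of affine functions of the \<open>Z\<^sub>n\<close>; expanding it gives a combination of the
  products \<open>Z\<^sub>\<sigma>\<close>.
\<close>

lemma approximable_cylinder: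
  assumes N: "finite N"
  shows "indicator (cylinder N B) \<in> approximable"
proof -
  \<comment> \<open>\<open>a + b * zeta n\<close> interpolates the indicator at the two signs; the two values of
    \<open>zeta n\<close> are \<open>1 / sqrt (p n * (1 - p n))\<close> apart\<close>
  define b where "b n = complex_of_real ((indicator (B n) 1 - indicator (B n) (-1))
    * sqrt (p n * (1 - p n)))" for n
  define a where "a n = indicator (B n) 1 - b n * complex_of_real (zeta n 1)" for n
  have affine: "indicator (B n) y = a n + b n * complex_of_real (zeta n y)" if "y = -1 \<or> y = 1" for n y
  proof -
    have "zeta n 1 - zeta n (-1) = 1 / sqrt (p n * (1 - p n))"
      unfolding zeta_values by (simp add: diff_divide_distrib)
    then have "sqrt (p n * (1 - p n)) * (zeta n 1 - zeta n (-1)) = 1"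
      using p01[of n] by simp
    then have "b n * complex_of_real (zeta n 1 - zeta n (-1))
        = complex_of_real (indicator (B n) 1 - indicator (B n) (-1))"
      unfolding b_def of_real_mult[symmetric] by (simp add: mult.assoc)
    moreover have "complex_of_real (indicator (B n) y) = indicator (B n) y" for y
      by (simp add: indicator_def)
    ultimately have "b n * complex_of_real (zeta n 1) - b n * complex_of_real (zeta n (-1))
        = indicator (B n) 1 - indicator (B n) (-1)"
      by (simp add: right_diff_distrib)
    then have "b n * complex_of_real (zeta n (-1))
        = b n * complex_of_real (zeta n 1) - (indicator (B n) 1 - indicator (B n) (-1))"
      by (simp add: algebra_simps)
    then show ?thesis using that by (auto simp: a_def)
  qed
  have "(\<lambda>w. \<Sum>\<sigma>\<in>Pow N. ((\<Prod>n\<in>\<sigma>. b n) * (\<Prod>n\<in>N - \<sigma>. a n)) * Z_product \<sigma> w) \<in> approximable"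
    using N by (intro approximable_sum approximable_smult approximable_Z)
      (auto intro: finite_subset)
  then show ?thesis
  proof (rule approximable_cong)
    fix w assume w: "w \<in> space P"
    have "indicator (cylinder N B) w = (\<Prod>n\<in>N. indicator (B n) (w n) :: complex)"
    proof (cases "w \<in> cylinder N B")
      case True
      then show ?thesis by (simp add: cylinder_def)
    next
      case False
      then obtain n where "n \<in> N" "w n \<notin> B n" using w by (auto simp: cylinder_def space_P)
      then have "(\<Prod>n\<in>N. indicator (B n) (w n) :: complex) = 0"
        using N by (auto intro!: prod_zero bexI[of _ n])
      then show ?thesis using False by simp
    qed
    also have "\<dots> = (\<Prod>n\<in>N. b n * complex_of_real (zeta n (w n)) + a n)"
      using w sign_seqs_cases affine by (intro prod.cong) (auto simp: space_P add.commute)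
    also have "\<dots> = (\<Sum>\<sigma>\<in>Pow N. (\<Prod>n\<in>\<sigma>. b n * complex_of_real (zeta n (w n))) * (\<Prod>n\<in>N - \<sigma>. a n))"
      using N by (rule prod_add)
    also have "\<dots> = (\<Sum>\<sigma>\<in>Pow N. ((\<Prod>n\<in>\<sigma>. b n) * (\<Prod>n\<in>N - \<sigma>. a n)) * Z_product \<sigma> w)"
      by (simp add: Z_product_def prod.distrib ac_simps)
    finally show "(\<Sum>\<sigma>\<in>Pow N. ((\<Prod>n\<in>\<sigma>. b n) * (\<Prod>n\<in>N - \<sigma>. a n)) * Z_product \<sigma> w)
        = indicator (cylinder N B) w" ..
  qed
qed

lemma sets_subset_sigma_cylinders:
  "sets P \<subseteq> sigma_sets sign_seqs {cylinder N B | N B. finite N}"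
  unfolding sets_P
proof (rule sigma_sets_subseteq, safe)
  fix n :: nat and B :: "int set"
  show "\<exists>N B'. {f \<in> sign_seqs. f n \<in> B} = cylinder N B' \<and> finite N"
    by (intro exI[of _ "{n}"] exI[of _ "\<lambda>_. B"]) (auto simp: cylinder_def)
qed

lemma Int_stable_cylinders: "Int_stable {cylinder N B | N B. finite N}"
proof (rule Int_stableI)
  fix A A' assume "A \<in> {cylinder N B | N B. finite N}" "A' \<in> {cylinder N B | N B. finite N}"
  then obtain N B N' B' where A: "finite N" "A = cylinder N B" "finite N'" "A' = cylinder N' B'"
    by blast
  have "A \<inter> A' = cylinder (N \<union> N')
      (\<lambda>n. (if n \<in> N then B n else UNIV) \<inter> (if n \<in> N' then B' n else UNIV))"
    unfolding A by (auto simp: cylinder_def)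
  then show "A \<inter> A' \<in> {cylinder N B | N B. finite N}" using A by blast
qed

lemma approximable_indicator:
  assumes A: "A \<in> sets P"
  shows "indicator A \<in> approximable"
proof -
  let ?C = "{cylinder N B | N B. finite N}"
  have C_sets: "?C \<subseteq> sets P" using cylinder_sets by auto
  have sub: "sigma_sets sign_seqs ?C \<subseteq> sets P"
    using sets.sigma_sets_subset[OF C_sets] by (simp add: space_P)
  have ind_sq: "(indicator A :: _ \<Rightarrow> complex) \<in> sq_integrable P" if "A \<in> sets P" for A
    using that by (intro sq_integrable_bounded[where b = 1]) (auto simp: indicator_def finite_measure_axioms)
  have one: "indicator sign_seqs \<in> approximable"
    using approximable_cylinder[of "{}"] by (simp add: cylinder_def)
  have closed: "?C \<subseteq> Pow sign_seqs" by (auto simp: cylinder_def)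
  have "A \<in> sigma_sets sign_seqs ?C" using A sets_subset_sigma_cylinders by blast
  with Int_stable_cylinders closed show ?thesis
  proof (induction rule: sigma_sets_induct_disjoint)
    case (basic A)
    then show ?case using approximable_cylinder by auto
  next
    case empty
    show ?case using approximable_smult[OF one, of 0] by (simp add: indicator_def[abs_def])
  next
    case (compl A)
    have "(\<lambda>w. indicator sign_seqs w + (-1) * indicator A w) \<in> approximable"
      using one compl(2) by (intro approximable_add approximable_smult)
    then show ?case
      by (rule approximable_cong) (auto simp: indicator_def space_P)
  next
    case (union A)
    have Asets: "A i \<in> sets P" for i using union(2) sub by auto
    have partial: "indicator (\<Union>i<n. A i) = (\<lambda>w. \<Sum>i<n. indicator (A i) w :: complex)" for n
    proof (rule ext)
      fix w show "indicator (\<Union>i<n. A i) w = (\<Sum>i<n. indicator (A i) w :: complex)"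
        using union(1) by (intro indicator_UN_disjoint) (auto simp: disjoint_family_on_def)
    qed
    show ?case
    proof (rule approximable_limit)
      show "indicator (\<Union>i<n. A i) \<in> approximable" for n
        unfolding partial using union(3) by (intro approximable_sum) auto
      show "(\<lambda>n. indicator (\<Union>i<n. A i) w :: complex) \<longlonglongrightarrow> indicator (\<Union>i. A i) w" for w
        by (rule LIMSEQ_indicator_UN)
      show "(cmod (indicator (\<Union>i. A i) w - indicator (\<Union>i<n. A i) w))\<^sup>2 \<le> 1" for n w
        by (auto simp: indicator_def)
    qed (use Asets ind_sq in auto)
  qed
qed

lemma approximable_all:
  assumes f: "f \<in> sq_integrable P"
  shows "f \<in> approximable"
proof -
  obtain s where s: "\<And>i. simple_function P (s i)"
    and lim: "\<And>w. w \<in> space P \<Longrightarrow> (\<lambda>i. s i w) \<longlonglongrightarrow> f w"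
    and bound: "\<And>i w. w \<in> space P \<Longrightarrow> dist (s i w) 0 \<le> 2 * dist (f w) 0"
    using borel_measurable_implies_sequence_metric[OF sq_integrableD(1)[OF f], of 0] by blast
  show ?thesis
  proof (rule approximable_limit[OF _ f lim])
    fix i
    have "(\<lambda>w. \<Sum>y\<in>s i ` space P. y * indicator (s i -` {y} \<inter> space P) w) \<in> approximable"
      using s[of i] unfolding simple_function_def
      by (intro approximable_sum approximable_smult approximable_indicator) auto
    then show "s i \<in> approximable"
    proof (rule approximable_cong)
      fix w assume w: "w \<in> space P"
      have "(\<Sum>y\<in>s i ` space P. y * indicator (s i -` {y} \<inter> space P) w)
          = (\<Sum>y\<in>s i ` space P. if y = s i w then y else 0)"
        using w by (intro sum.cong) (auto simp: indicator_def)
      then show "(\<Sum>y\<in>s i ` space P. y * indicator (s i -` {y} \<inter> space P) w) = s i w"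
        using w s[of i] by (simp add: simple_function_def)
    qed
  next
    \<comment> \<open>\<open>s i\<close> is bounded by \<open>2 * cmod f\<close>, so the difference is bounded by \<open>3 * cmod f\<close>\<close>
    show "integrable P (\<lambda>w. 9 * (cmod (f w))\<^sup>2)" using sq_integrableD(2)[OF f] by simp
    fix i w assume "w \<in> space P"
    then have "cmod (f w - s i w) \<le> 3 * cmod (f w)"
      using bound[of w i] norm_triangle_ineq4[of "f w" "s i w"] by simp
    then have "(cmod (f w - s i w))\<^sup>2 \<le> (3 * cmod (f w))\<^sup>2" by (intro power_mono) auto
    then show "(cmod (f w - s i w))\<^sup>2 \<le> 9 * (cmod (f w))\<^sup>2" by (simp add: power_mult_distrib)
  qed
qed

theorem Z_vecs_orthonormal_basis: "orthonormal_basis (L2 P) Z_vecs"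
  unfolding orthonormal_basis_def
proof (intro conjI ballI)
  have "carrier (L2 P) \<subseteq> H.closed_span Z_vecs"
  proof
    fix U assume "U \<in> carrier (L2 P)"
    then obtain f where "f \<in> sq_integrable P" "U = ae_class P f" by (rule L2_cases)
    then show "U \<in> H.closed_span Z_vecs"
      using approximable_all[of f] by (simp add: approximable_def)
  qed
  then show "total_in (L2 P) Z_vecs"
    unfolding H.total_in_iff_closed_span[OF Z_vecs_mem] by (auto simp: H.closed_span_def)
  fix e f assume "e \<in> Z_vecs" "f \<in> Z_vecs"
  then obtain \<sigma> \<tau> where "finite \<sigma>" "e = Z_vec p P \<sigma>" "finite \<tau>" "f = Z_vec p P \<tau>" by auto
  then show "cinner (L2 P) e f = (if e = f then 1 else 0)"
    using cinner_Z_vec[of \<sigma> \<tau>] cinner_Z_vec[of \<sigma> \<sigma>] by (cases "\<sigma> = \<tau>") auto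
qed

end

section \<open>Annihilation and creation operators\<close>

definition flip :: "nat \<Rightarrow> nat set \<Rightarrow> nat set" where
  "flip k \<sigma> = (if k \<in> \<sigma> then \<sigma> - {k} else insert k \<sigma>)"

lemma finite_flip [simp]: "finite (flip k \<sigma>) = finite \<sigma>"
  by (simp add: flip_def)

lemma flip_flip [simp]: "flip k (flip k \<sigma>) = \<sigma>"
  by (auto simp: flip_def)

lemma flip_commute: "flip k (flip l \<sigma>) = flip l (flip k \<sigma>)"
  by (auto simp: flip_def)

lemma flip_eq_iff: "flip k \<sigma> = flip k \<tau> \<longleftrightarrow> \<sigma> = \<tau>" "flip k \<sigma> = \<tau> \<longleftrightarrow> \<sigma> = flip k \<tau>"
  using flip_flip[of k \<sigma>] flip_flip[of k \<tau>] by (metis, metis)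

context bernoulli_hilbert_space
begin

abbreviation Z :: "nat set \<Rightarrow> functional" where
  "Z \<equiv> Z_vec p P"

lemma total_Z: "total_in (L2 P) Z_vecs"
  using Z_vecs_orthonormal_basis by (simp add: orthonormal_basis_def)

text \<open>
  An isometry, because \<open>flip k\<close> permutes the basis; it turns out to be the sum of the creation
  and the annihilation operator at \<open>k\<close>.
\<close>

definition flip_op :: "nat \<Rightarrow> functional \<Rightarrow> functional" where
  "flip_op k = (SOME A. A \<in> bounded_ops (L2 P) \<and> (\<forall>\<sigma>. finite \<sigma> \<longrightarrow> A (Z \<sigma>) = Z (flip k \<sigma>)))"

lemma flip_op:
  shows flip_op_bounded: "flip_op k \<in> bounded_ops (L2 P)"
    and flip_op_Z: "finite \<sigma> \<Longrightarrow> flip_op k (Z \<sigma>) = Z (flip k \<sigma>)"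
proof -
  have "\<exists>A\<in>bounded_ops (L2 P). \<forall>\<sigma>\<in>{\<sigma>. finite \<sigma>}. A (Z \<sigma>) = Z (flip k \<sigma>)"
    using total_Z
  proof (rule H.bounded_op_exists[where s = 0 and t = 1])
    show "(\<lambda>\<sigma>. Z (flip k \<sigma>)) ` {\<sigma>. finite \<sigma>} \<subseteq> carrier (L2 P)"
      by (auto intro: Z_vec_mem)
  qed (simp_all add: cinner_Z_vec flip_eq_iff(1))
  then have "\<exists>A. A \<in> bounded_ops (L2 P) \<and> (\<forall>\<sigma>. finite \<sigma> \<longrightarrow> A (Z \<sigma>) = Z (flip k \<sigma>))" by blast
  from someI_ex[OF this] show "flip_op k \<in> bounded_ops (L2 P)"
    and "finite \<sigma> \<Longrightarrow> flip_op k (Z \<sigma>) = Z (flip k \<sigma>)"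
    by (auto simp: flip_op_def)
qed

text \<open>The projection onto the closed span of the \<open>Z\<^sub>\<sigma>\<close> with \<open>k \<in> \<sigma>\<close>.\<close>

definition number_op :: "nat \<Rightarrow> functional \<Rightarrow> functional" where
  "number_op k = (SOME A. A \<in> bounded_ops (L2 P) \<and>
     (\<forall>\<sigma>. finite \<sigma> \<longrightarrow> A (Z \<sigma>) = (if k \<in> \<sigma> then Z \<sigma> else \<zero>\<^bsub>L2 P\<^esub>)))"

lemma number_op:
  shows number_op_bounded: "number_op k \<in> bounded_ops (L2 P)"
    and number_op_Z: "finite \<sigma> \<Longrightarrow> number_op k (Z \<sigma>) = (if k \<in> \<sigma> then Z \<sigma> else \<zero>\<^bsub>L2 P\<^esub>)"
proof -
  have "\<exists>A\<in>bounded_ops (L2 P). \<forall>\<sigma>\<in>{\<sigma>. finite \<sigma>}. A (Z \<sigma>) = (if k \<in> \<sigma> then Z \<sigma> else \<zero>\<^bsub>L2 P\<^esub>)"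
    using total_Z
  proof (rule H.bounded_op_exists[where s = 1 and t = 0])
    show "(\<lambda>\<sigma>. if k \<in> \<sigma> then Z \<sigma> else \<zero>\<^bsub>L2 P\<^esub>) ` {\<sigma>. finite \<sigma>} \<subseteq> carrier (L2 P)"
      by (auto intro: Z_vec_mem)
  qed (auto simp: cinner_Z_vec Z_vec_mem)
  then have "\<exists>A. A \<in> bounded_ops (L2 P) \<and>
     (\<forall>\<sigma>. finite \<sigma> \<longrightarrow> A (Z \<sigma>) = (if k \<in> \<sigma> then Z \<sigma> else \<zero>\<^bsub>L2 P\<^esub>))" by blast
  from someI_ex[OF this] show "number_op k \<in> bounded_ops (L2 P)"
    and "finite \<sigma> \<Longrightarrow> number_op k (Z \<sigma>) = (if k \<in> \<sigma> then Z \<sigma> else \<zero>\<^bsub>L2 P\<^esub>)"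
    by (auto simp: number_op_def)
qed

lemmas op_mem [simp] =
  H.bounded_opsD(1)[OF flip_op_bounded] H.bounded_opsD(1)[OF number_op_bounded]

lemma flip_op_adjoint: "adjoint_pair (L2 P) (flip_op k) (flip_op k)"
proof (rule H.adjoint_pair_totalI[OF total_Z flip_op_bounded flip_op_bounded])
  fix e f assume "e \<in> Z_vecs" "f \<in> Z_vecs"
  then obtain \<sigma> \<tau> where "finite \<sigma>" "e = Z \<sigma>" "finite \<tau>" "f = Z \<tau>" by blast
  then show "cinner (L2 P) (flip_op k e) f = cinner (L2 P) e (flip_op k f)"
    using flip_eq_iff(2)[of k \<sigma> \<tau>] by (simp add: flip_op_Z cinner_Z_vec)
qed

lemma number_op_adjoint: "adjoint_pair (L2 P) (number_op k) (number_op k)"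
  by (rule H.adjoint_pair_totalI[OF total_Z number_op_bounded number_op_bounded])
    (auto simp: number_op_Z cinner_Z_vec Z_vec_mem)

lemma flip_op_involution:
  assumes "u \<in> carrier (L2 P)"
  shows "flip_op k (flip_op k u) = u"
proof -
  have "(\<lambda>u\<in>carrier (L2 P). flip_op k (flip_op k u)) = (\<lambda>u\<in>carrier (L2 P). u)"
    by (rule H.bounded_ops_eqI[OF total_Z
          H.bounded_ops_comp[OF flip_op_bounded flip_op_bounded] H.bounded_ops_id])
      (auto simp: flip_op_Z Z_vec_mem)
  from fun_cong[OF this, of u] show ?thesis using assms by simp
qed

lemma flip_op_commute:
  "u \<in> carrier (L2 P) \<Longrightarrow> flip_op k (flip_op l u) = flip_op l (flip_op k u)"
  by (rule H.bounded_ops_commute_totalI[OF total_Z flip_op_bounded flip_op_bounded])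
    (auto simp: flip_op_Z flip_commute)

text \<open>
  The annihilation operator is neither an isometry nor a projection, but it first discards the
  \<open>Z\<^sub>\<sigma>\<close> with \<open>k \<notin> \<sigma>\<close> and then removes \<open>k\<close>, which on the remaining ones is a flip.
  This shows that the operator exists, and its adjoint can be read off.
\<close>

lemma annihilation_eq: "annihilation p P k = (\<lambda>u\<in>carrier (L2 P). flip_op k (number_op k u))"
  unfolding annihilation_def
proof (rule the_equality)
  let ?A = "\<lambda>u\<in>carrier (L2 P). flip_op k (number_op k u)"
  have A: "?A \<in> bounded_ops (L2 P)"
    by (rule H.bounded_ops_comp[OF flip_op_bounded number_op_bounded])
  have A_Z: "?A (Z \<sigma>) = (if k \<in> \<sigma> then Z (\<sigma> - {k}) else \<zero>\<^bsub>L2 P\<^esub>)" if "finite \<sigma>" for \<sigma>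
    using that by (simp add: Z_vec_mem number_op_Z flip_op_Z flip_def
        H.bounded_op_zero[OF flip_op_bounded])
  show "?A \<in> bounded_ops (L2 P) \<and>
     (\<forall>\<sigma>. finite \<sigma> \<longrightarrow> ?A (Z \<sigma>) = (if k \<in> \<sigma> then Z (\<sigma> - {k}) else \<zero>\<^bsub>L2 P\<^esub>))"
    using A A_Z by blast
  fix B assume B: "B \<in> bounded_ops (L2 P) \<and>
     (\<forall>\<sigma>. finite \<sigma> \<longrightarrow> B (Z \<sigma>) = (if k \<in> \<sigma> then Z (\<sigma> - {k}) else \<zero>\<^bsub>L2 P\<^esub>))"
  show "B = ?A"
  proof (rule H.bounded_ops_eqI[OF total_Z _ A])
    fix e assume "e \<in> Z_vecs"
    then obtain \<sigma> where \<sigma>: "finite \<sigma>" "e = Z \<sigma>" by blast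
    show "B e = ?A e" unfolding \<sigma>(2) A_Z[OF \<sigma>(1)] using B \<sigma>(1) by blast
  qed (use B in blast)
qed

lemma creation_eq: "creation p P k = (\<lambda>u\<in>carrier (L2 P). number_op k (flip_op k u))"
  unfolding creation_def annihilation_eq
proof (rule H.adjoint_op_eqI)
  show "(\<lambda>u\<in>carrier (L2 P). number_op k (flip_op k u)) \<in> bounded_ops (L2 P)"
    by (rule H.bounded_ops_comp[OF number_op_bounded flip_op_bounded])
  show "adjoint_pair (L2 P) (\<lambda>u\<in>carrier (L2 P). number_op k (flip_op k u))
      (\<lambda>u\<in>carrier (L2 P). flip_op k (number_op k u))"
    using H.adjoint_pair_comp[OF number_op_adjoint flip_op_adjoint, of k k]
    by (simp add: adjoint_pair_def)
qed

lemma creation_plus_annihilation: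
  assumes u: "u \<in> carrier (L2 P)"
  shows "creation p P k u \<oplus>\<^bsub>L2 P\<^esub> annihilation p P k u = flip_op k u"
proof -
  let ?C = "\<lambda>u\<in>carrier (L2 P). number_op k (flip_op k u)"
  let ?A = "\<lambda>u\<in>carrier (L2 P). flip_op k (number_op k u)"
  have one: "1 \<odot>\<^bsub>L2 P\<^esub> v = v" if "v \<in> carrier (L2 P)" for v
    using H.smult_one[OF that] by simp
  have "(\<lambda>u\<in>carrier (L2 P). 1 \<odot>\<^bsub>L2 P\<^esub> ?C u \<oplus>\<^bsub>L2 P\<^esub> 1 \<odot>\<^bsub>L2 P\<^esub> ?A u) = flip_op k"
  proof (rule H.bounded_ops_eqI[OF total_Z _ flip_op_bounded])
    show "(\<lambda>u\<in>carrier (L2 P). 1 \<odot>\<^bsub>L2 P\<^esub> ?C u \<oplus>\<^bsub>L2 P\<^esub> 1 \<odot>\<^bsub>L2 P\<^esub> ?A u) \<in> bounded_ops (L2 P)"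
      by (intro H.bounded_ops_lincomb H.bounded_ops_comp flip_op_bounded number_op_bounded)
    fix e assume "e \<in> Z_vecs"
    then obtain \<sigma> where \<sigma>: "finite \<sigma>" "e = Z \<sigma>" by blast
    show "(\<lambda>u\<in>carrier (L2 P). 1 \<odot>\<^bsub>L2 P\<^esub> ?C u \<oplus>\<^bsub>L2 P\<^esub> 1 \<odot>\<^bsub>L2 P\<^esub> ?A u) e = flip_op k e"
      using \<sigma> by (cases "k \<in> \<sigma>") (simp_all add: one Z_vec_mem flip_op_Z number_op_Z
          H.bounded_op_zero[OF flip_op_bounded] flip_def)
  qed
  from fun_cong[OF this, of u] show ?thesis
    using u by (simp add: creation_eq annihilation_eq one)
qed

text \<open>
  For \<open>s = 1\<close> and \<open>s = -1\<close> this is, up to the sign \<open>s\<close>, the spectral projection of the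
  self-adjoint involution \<open>flip_op n\<close> for the eigenvalue \<open>s\<close>.
\<close>

definition spectral_op :: "real \<Rightarrow> nat \<Rightarrow> functional \<Rightarrow> functional" where
  "spectral_op s n = (\<lambda>u\<in>carrier (L2 P).
     (1/2) \<odot>\<^bsub>L2 P\<^esub> (flip_op n u \<oplus>\<^bsub>L2 P\<^esub> complex_of_real s \<odot>\<^bsub>L2 P\<^esub> u))"

lemma L_op_eq: "L_op p P n = spectral_op (-1) n"
proof (rule ext)
  fix u show "L_op p P n u = spectral_op (-1) n u"
    by (cases "u \<in> carrier (L2 P)")
      (simp_all add: L_op_def spectral_op_def creation_plus_annihilation a_minus_def
        H.minus_eq_smult)
qed

lemma R_op_eq: "R_op p P n = spectral_op 1 n"
proof (rule ext)
  fix u show "R_op p P n u = spectral_op 1 n u"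
    using H.smult_one[of u]
    by (cases "u \<in> carrier (L2 P)")
      (simp_all add: R_op_def spectral_op_def creation_plus_annihilation)
qed

lemma spectral_op_mem [simp]: "u \<in> carrier (L2 P) \<Longrightarrow> spectral_op s n u \<in> carrier (L2 P)"
  by (simp add: spectral_op_def)

lemma cinner_flip_op:
  assumes u: "u \<in> carrier (L2 P)" and v: "v \<in> carrier (L2 P)"
  shows "cinner (L2 P) u (flip_op n v) = cinner (L2 P) (flip_op n u) v"
    and "cinner (L2 P) (flip_op n u) (flip_op n v) = cinner (L2 P) u v"
proof -
  note adj = H.adjoint_pairD(3)[OF flip_op_adjoint u]
  show "cinner (L2 P) u (flip_op n v) = cinner (L2 P) (flip_op n u) v"
    using adj[OF v] by (rule sym)
  show "cinner (L2 P) (flip_op n u) (flip_op n v) = cinner (L2 P) u v"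
    unfolding adj[OF op_mem(1)[OF v]] flip_op_involution[OF v] ..
qed

lemma cinner_spectral_op:
  assumes u: "u \<in> carrier (L2 P)" and v: "v \<in> carrier (L2 P)"
  shows "cinner (L2 P) (spectral_op s n u) v
      = (cinner (L2 P) (flip_op n u) v + of_real s * cinner (L2 P) u v) / 2"
    and "cinner (L2 P) u (spectral_op s n v)
      = (cinner (L2 P) (flip_op n u) v + of_real s * cinner (L2 P) u v) / 2"
  using u v cinner_flip_op(1)[OF u v, of n] by (simp_all add: spectral_op_def H.cinner_linear)

lemma spectral_op_adjoint: "adjoint_pair (L2 P) (spectral_op s n) (spectral_op s n)"
  unfolding adjoint_pair_def by (simp add: cinner_spectral_op)

lemma flip_op_spectral_op:
  assumes u: "u \<in> carrier (L2 P)" and v: "v \<in> carrier (L2 P)"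
  shows "cinner (L2 P) (flip_op n u) (spectral_op s n v)
    = (cinner (L2 P) u v + of_real s * cinner (L2 P) (flip_op n u) v) / 2"
  using cinner_spectral_op(2)[OF op_mem(1)[OF u] v] by (simp add: flip_op_involution[OF u])

text \<open>
  One computation for two facts: with \<open>t = s\<close> it shows that \<open>spectral_op s n\<close> is \<open>s\<close> times
  a projection, and with \<open>t = - s\<close> both coefficients vanish, so the ranges are orthogonal.
\<close>

lemma cinner_spectral_op_spectral_op:
  assumes u: "u \<in> carrier (L2 P)" and v: "v \<in> carrier (L2 P)"
  shows "cinner (L2 P) (spectral_op s n u) (spectral_op t n v)
    = ((1 + of_real (s * t)) * cinner (L2 P) u v
        + of_real (s + t) * cinner (L2 P) (flip_op n u) v) / 4"
  unfolding cinner_spectral_op(1)[OF u spectral_op_mem[OF v]] flip_op_spectral_op[OF u v]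
    cinner_spectral_op(2)[OF u v]
  by (simp add: algebra_simps add_divide_distrib)

lemma spectral_op_form:
  assumes u: "u \<in> carrier (L2 P)" and v: "v \<in> carrier (L2 P)" and s: "s = 1 \<or> s = -1"
  shows "cinner (L2 P) (spectral_op s n u) (spectral_op s n v)
    = complex_of_real s * cinner (L2 P) (spectral_op s n u) v"
  using s unfolding cinner_spectral_op_spectral_op[OF u v] cinner_spectral_op(1)[OF u v]
  by (auto simp: field_simps)

lemma spectral_op_orthogonal:
  assumes u: "u \<in> carrier (L2 P)" and v: "v \<in> carrier (L2 P)" and s: "s = 1 \<or> s = -1"
  shows "cinner (L2 P) (spectral_op s n u) (spectral_op (- s) n v) = 0"
  using s unfolding cinner_spectral_op_spectral_op[OF u v] by auto

lemma spectral_op_commute: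
  assumes u: "u \<in> carrier (L2 P)"
  shows "spectral_op s m (spectral_op t n u) = spectral_op t n (spectral_op s m u)"
proof (rule H.vector_eqI)
  fix w assume w: "w \<in> carrier (L2 P)"
  have eq: "cinner (L2 P) w (spectral_op s m (spectral_op t n u))
      = (cinner (L2 P) w (flip_op n (flip_op m u)) + of_real t * cinner (L2 P) w (flip_op m u)
        + of_real s * (cinner (L2 P) w (flip_op n u) + of_real t * cinner (L2 P) w u)) / 4"
    for s t m n
    unfolding cinner_spectral_op(2)[OF w spectral_op_mem[OF u]]
      cinner_spectral_op(2)[OF op_mem(1)[OF w] u] cinner_spectral_op(2)[OF w u]
    using u w flip_op_commute[OF w, of m n]
    by (simp add: cinner_flip_op(1) add_divide_distrib algebra_simps)
  show "cinner (L2 P) w (spectral_op s m (spectral_op t n u))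
      = cinner (L2 P) w (spectral_op t n (spectral_op s m u))"
    unfolding eq[of s m t n] eq[of t n s m]
    by (simp add: flip_op_commute[OF u, of m n] algebra_simps)
qed (use u in simp_all)

end

section \<open>The operators of the walk\<close>

lemma finite_signs: "finite (signs :: (int ^ 'd::finite) set)"
proof -
  have "finite ((UNIV :: 'd set) \<rightarrow>\<^sub>E {-1, 1 :: int})" by (rule finite_PiE) auto
  moreover have "(signs :: (int ^ 'd) set) \<subseteq> (\<lambda>f. \<chi> j. f j) ` (UNIV \<rightarrow>\<^sub>E {-1, 1})"
  proof
    fix \<epsilon> :: "int ^ 'd" assume "\<epsilon> \<in> signs"
    then have "(\<lambda>j. \<epsilon> $ j) \<in> UNIV \<rightarrow>\<^sub>E {-1, 1}" by (auto simp: signs_def)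
    moreover have "\<epsilon> = (\<chi> j. \<epsilon> $ j)" by (simp add: vec_eq_iff)
    ultimately show "\<epsilon> \<in> (\<lambda>f. \<chi> j. f j) ` (UNIV \<rightarrow>\<^sub>E {-1, 1})" by blast
  qed
  ultimately show ?thesis by (rule finite_surj)
qed

locale qbn_setting = bernoulli_hilbert_space p P
  for p :: "nat \<Rightarrow> real" and P :: "(nat \<Rightarrow> int) measure" +
  fixes T :: "'b hspace" and \<tau> :: "('d::finite \<Rightarrow> functional) \<Rightarrow> 'b" and K :: "'b \<Rightarrow> functional"
  assumes tensor: "tensor_power (L2 P) T \<tau>" and unitary: "unitary_isomorphism T (L2 P) K"
begin

definition B_op :: "nat \<Rightarrow> int ^ 'd \<Rightarrow> 'd \<Rightarrow> functional \<Rightarrow> functional" where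
  "B_op n \<epsilon> j = (if \<epsilon> $ j = -1 then L_op p P n else R_op p P n)"

lemma signs_nth: "\<epsilon> \<in> signs \<Longrightarrow> \<epsilon> $ j = -1 \<or> \<epsilon> $ j = 1"
  by (auto simp: signs_def)

lemma signs_cases: "\<epsilon> \<in> signs \<Longrightarrow> real_of_int (\<epsilon> $ j) = 1 \<or> real_of_int (\<epsilon> $ j) = -1"
  using signs_nth[of \<epsilon> j] by auto

lemma B_op_eq: "\<epsilon> \<in> signs \<Longrightarrow> B_op n \<epsilon> j = spectral_op (of_int (\<epsilon> $ j)) n"
  using signs_nth[of \<epsilon> j] by (auto simp: B_op_def L_op_eq R_op_eq)

definition tensor_op :: "nat \<Rightarrow> int ^ 'd \<Rightarrow> 'b \<Rightarrow> 'b" where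
  "tensor_op n \<epsilon> = tensor_power_op (L2 P) T \<tau> (B_op n \<epsilon>)"

lemma tensor_op:
  assumes "\<epsilon> \<in> signs"
  shows tensor_op_bounded: "tensor_op n \<epsilon> \<in> bounded_ops T"
    and tensor_op_tensor: "range u \<subseteq> carrier (L2 P) \<Longrightarrow> tensor_op n \<epsilon> (\<tau> u) = \<tau> (\<lambda>j. B_op n \<epsilon> j (u j))"
proof -
  have mem: "B_op n \<epsilon> j u \<in> carrier (L2 P)" if "u \<in> carrier (L2 P)" for j u
    using that assms by (simp add: B_op_eq)
  have form: "cinner (L2 P) (B_op n \<epsilon> j u) (B_op n \<epsilon> j v)
      = complex_of_real (of_int (\<epsilon> $ j)) * cinner (L2 P) (B_op n \<epsilon> j u) v"
    if "u \<in> carrier (L2 P)" "v \<in> carrier (L2 P)" for j u v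
    unfolding B_op_eq[OF assms] using that signs_cases[OF assms] by (rule spectral_op_form)
  have bound: "cmod (complex_of_real (of_int (\<epsilon> $ j))) \<le> 1" for j
    using signs_cases[OF assms, of j] unfolding norm_of_real by linarith
  show "tensor_op n \<epsilon> \<in> bounded_ops T"
    unfolding tensor_op_def using tensor mem form bound by (rule tensor_power_op_bounded(1))
  show "tensor_op n \<epsilon> (\<tau> u) = \<tau> (\<lambda>j. B_op n \<epsilon> j (u j))" if "range u \<subseteq> carrier (L2 P)"
    unfolding tensor_op_def using tensor mem form bound that by (rule tensor_power_op_bounded(2))
qed

lemma T_hilbert_space: "hilbert_space T"
  using tensor by (simp add: tensor_power_def)

lemma tensor_op_mem: "\<lbrakk>\<epsilon> \<in> signs; x \<in> carrier T\<rbrakk> \<Longrightarrow> tensor_op n \<epsilon> x \<in> carrier T"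
  using hilbert_space.bounded_opsD(1)[OF T_hilbert_space tensor_op_bounded] .

abbreviation C :: "nat \<Rightarrow> int ^ 'd \<Rightarrow> functional \<Rightarrow> functional" where
  "C \<equiv> C_op p P T \<tau> K"

lemma C_eq:
  "u \<in> carrier (L2 P) \<Longrightarrow> C n \<epsilon> u = K (tensor_op n \<epsilon> (inv_into (carrier T) K u))"
  by (simp add: C_op_def tensor_op_def B_op_def[abs_def])

lemma C_adjoint:
  assumes \<epsilon>: "\<epsilon> \<in> signs"
  shows "adjoint_pair (L2 P) (C n \<epsilon>) (C n \<epsilon>)"
proof -
  note k = unitary_isomorphismD[OF unitary]
  interpret T: hilbert_space T by (rule T_hilbert_space)
  have adj: "adjoint_pair T (tensor_op n \<epsilon>) (tensor_op n \<epsilon>)"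
    using tensor _ tensor_op_bounded[OF \<epsilon>] tensor_op_tensor[OF \<epsilon>]
  proof (rule tensor_power_op_selfadjoint)
    show "adjoint_pair (L2 P) (B_op n \<epsilon> j) (B_op n \<epsilon> j)" for j
      unfolding B_op_eq[OF \<epsilon>] by (rule spectral_op_adjoint)
  qed
  have "cinner (L2 P) (C n \<epsilon> u) v = cinner (L2 P) u (C n \<epsilon> v)"
    if u: "u \<in> carrier (L2 P)" and v: "v \<in> carrier (L2 P)" for u v
  proof -
    let ?u = "inv_into (carrier T) K u" and ?v = "inv_into (carrier T) K v"
    have "cinner (L2 P) (K (tensor_op n \<epsilon> ?u)) (K ?v) = cinner T (tensor_op n \<epsilon> ?u) ?v"
      using u v \<epsilon> by (intro k(4) tensor_op_mem k(6))
    also have "\<dots> = cinner T ?u (tensor_op n \<epsilon> ?v)"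
      using u v by (intro T.adjoint_pairD(3)[OF adj] k(6))
    also have "\<dots> = cinner (L2 P) (K ?u) (K (tensor_op n \<epsilon> ?v))"
      using u v \<epsilon> by (intro k(4)[symmetric] tensor_op_mem k(6))
    finally show ?thesis using u v by (simp add: C_eq k(7))
  qed
  moreover have "C n \<epsilon> u \<in> carrier (L2 P)" if "u \<in> carrier (L2 P)" for u
    using that \<epsilon> by (simp add: C_eq k(1,6) tensor_op_mem)
  ultimately show ?thesis by (simp add: adjoint_pair_def)
qed

text \<open>
  Different sign vectors differ at some index \<open>j\<close>; there one tensor factor is \<open>L\<^sub>n\<close> and the
  other is \<open>R\<^sub>n\<close>, which have orthogonal ranges.
\<close>

lemma C_orthogonal:
  assumes \<epsilon>: "\<epsilon> \<in> signs" "\<epsilon>' \<in> signs" "\<epsilon> \<noteq> \<epsilon>'"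
    and u: "u \<in> carrier (L2 P)" and v: "v \<in> carrier (L2 P)"
  shows "cinner (L2 P) (C n \<epsilon> u) (C n \<epsilon>' v) = 0"
proof -
  note k = unitary_isomorphismD[OF unitary]
  obtain j where j: "\<epsilon> $ j \<noteq> \<epsilon>' $ j" using \<epsilon>(3) by (auto simp: vec_eq_iff)
  have neg: "real_of_int (\<epsilon>' $ j) = - real_of_int (\<epsilon> $ j)"
    using j signs_cases[OF \<epsilon>(1), of j] signs_cases[OF \<epsilon>(2), of j] by auto
  let ?u = "inv_into (carrier T) K u" and ?v = "inv_into (carrier T) K v"
  have "cinner T (tensor_op n \<epsilon> ?u) (tensor_op n \<epsilon>' ?v) = 0"
  proof (rule tensor_power_op_orthogonal[OF tensor, where A = "tensor_op n \<epsilon>" and A' = "tensor_op n \<epsilon>'"])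
    show "cinner (L2 P) (B_op n \<epsilon> j u) (B_op n \<epsilon>' j v) = 0"
      if "u \<in> carrier (L2 P)" "v \<in> carrier (L2 P)" for u v
      unfolding B_op_eq[OF \<epsilon>(1)] B_op_eq[OF \<epsilon>(2)] neg
      using that signs_cases[OF \<epsilon>(1)] by (rule spectral_op_orthogonal)
  qed (use u v \<epsilon> in \<open>auto simp: B_op_eq k(6) tensor_op_bounded tensor_op_tensor\<close>)
  then show ?thesis
    using u v \<epsilon> by (simp add: C_eq k(4,6) tensor_op_mem)
qed

lemma C_commute:
  assumes \<epsilon>: "\<epsilon> \<in> signs" "\<epsilon>' \<in> signs" and u: "u \<in> carrier (L2 P)"
  shows "C m \<epsilon> (C n \<epsilon>' u) = C n \<epsilon>' (C m \<epsilon> u)"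
proof -
  note k = unitary_isomorphismD[OF unitary]
  let ?u = "inv_into (carrier T) K u"
  have "tensor_op m \<epsilon> (tensor_op n \<epsilon>' ?u) = tensor_op n \<epsilon>' (tensor_op m \<epsilon> ?u)"
  proof (rule tensor_power_op_commute[OF tensor])
    show "B_op m \<epsilon> j (B_op n \<epsilon>' j u) = B_op n \<epsilon>' j (B_op m \<epsilon> j u)"
      if "u \<in> carrier (L2 P)" for j u
      unfolding B_op_eq[OF \<epsilon>(1)] B_op_eq[OF \<epsilon>(2)] using that by (rule spectral_op_commute)
  qed (use u \<epsilon> in \<open>auto simp: B_op_eq k(6) tensor_op_bounded tensor_op_tensor\<close>)
  then show ?thesis
    using u \<epsilon> by (simp add: C_eq k(1,5,6) tensor_op_mem)
qed

end

theorem theorem4p1: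
  fixes p :: "nat \<Rightarrow> real"
    and P :: "(nat \<Rightarrow> int) measure"
    and T :: "'b hspace"
    and \<tau> :: "('d::finite \<Rightarrow> functional) \<Rightarrow> 'b"
    and K :: "'b \<Rightarrow> functional"
    and S :: "'s hspace"
    and \<theta> :: "(int ^ 'd \<Rightarrow> complex) \<Rightarrow> functional \<Rightarrow> 's"
    and \<rho> :: "nat \<Rightarrow> 's \<Rightarrow> 's"
    and \<omega> :: "nat \<Rightarrow> int ^ 'd \<Rightarrow> functional \<Rightarrow> functional"
    and W :: "nat \<Rightarrow> int ^ 'd \<Rightarrow> functional"
  assumes "CARD('d) \<ge> 2"
    and "\<And>n. 0 < p n \<and> p n < 1"
    and "bernoulli_measure p P"
    and "tensor_power (L2 P) T \<tau>"
    and "unitary_isomorphism T (L2 P) K"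
    and "tensor_product (l2 complex_hspace) (L2 P) S \<theta>"
    and "open_qbn_walk p P T \<tau> K S \<theta> \<rho> \<omega>"
    and "qbn_walk p P T \<tau> K W"
    and "\<And>x. \<omega> 0 x = rank_one (L2 P) (W 0 x)"
  shows "\<forall>n x. op_trace (L2 P) (\<omega> n x) = complex_of_real ((hnorm (L2 P) (W n x))\<^sup>2)"
proof (intro allI)
  fix n x
  \<comment> \<open>completeness is part of the notion of a tensor power and is carried over by \<open>K\<close>\<close>
  have "hilbert_space T" using assms(4) by (simp add: tensor_power_def)
  then have H: "hilbert_space (L2 P)"
    using assms(5) L2_zero_smult by (rule hilbert_space_unitary_image)
  interpret qbn_setting p P T \<tau> K
    by (intro qbn_setting.intro bernoulli_hilbert_space.intro bernoulli_space.intro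
        qbn_setting_axioms.intro H assms)
  have basis: "orthonormal_basis (L2 P) (chosen_basis (L2 P))"
    unfolding chosen_basis_def using Z_vecs_orthonormal_basis by (rule someI)
  have \<omega>: "\<omega> n \<in> nuclei (L2 P)" "\<omega> (Suc n) = open_step p P T \<tau> K n (\<omega> n)" for n
    using assms(7) by (auto simp: open_qbn_walk_def)
  have W: "W n \<in> carrier (l2 (L2 P))" "W (Suc n) = qbn_step p P T \<tau> K n (W n)" for n
    using assms(8) by (auto simp: qbn_walk_def)
  have "((\<lambda>e. cinner (L2 P) e (\<omega> n x e)) has_sum complex_of_real ((hnorm (L2 P) (W n x))\<^sup>2))
      (chosen_basis (L2 P))"
  proof (rule H.trace_conjugated_walk[where C = C and S = signs and M = "\<lambda>u. u" and M' = "\<lambda>u. u"])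
    show "\<omega> n x u \<in> carrier (L2 P)" if "u \<in> carrier (L2 P)" for n x u
    proof -
      have "\<omega> n x \<in> bounded_ops (L2 P)"
        using \<omega>(1)[of n] by (auto simp: nuclei_def positive_op_def)
      then show ?thesis using that by (rule H.bounded_opsD(1))
    qed
    show "W n x \<in> carrier (L2 P)" for n x
      using W(1)[of n] by (auto simp: l2_def)
    show "W (Suc n) x = (\<Oplus>\<^bsub>L2 P\<^esub>\<epsilon>\<in>signs. C n \<epsilon> (W n (x - \<epsilon>)))" for n x
      using W(1)[of n] by (simp add: W(2) qbn_step_def)
    show "\<omega> (Suc n) x u = (\<Oplus>\<^bsub>L2 P\<^esub>\<epsilon>\<in>signs. C n \<epsilon> (\<omega> n (x - \<epsilon>) (C n \<epsilon> u)))"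
      if "u \<in> carrier (L2 P)" for n x u
      using that by (simp add: \<omega>(2) open_step_def)
    show "\<omega> 0 x u = cinner (L2 P) (W 0 x) u \<odot>\<^bsub>L2 P\<^esub> W 0 x" if "u \<in> carrier (L2 P)" for x u
      using that by (simp add: assms(9) rank_one_def)
    show "adjoint_pair (L2 P) (\<lambda>u. u) (\<lambda>u. u)" by (simp add: adjoint_pair_def)
  qed (simp_all add: basis finite_signs C_adjoint C_orthogonal C_commute)
  then show "op_trace (L2 P) (\<omega> n x) = complex_of_real ((hnorm (L2 P) (W n x))\<^sup>2)"
    unfolding op_trace_def by (rule infsumI)
qed

end
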